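(* There exist absolute constants $A,B>0$ for which the following holds. Suppose that $\mu$ is a probability measure with full support on the hypercube $\{\pm1\}^n$, so $\mu(x)\propto\exp(H(x))$ for some function $H:\{\pm1\}^n\to\mathbb{R}$. Suppose furthermore that $$\beta:=\max_{\sigma\in\{\pm1\}^n}\|\nabla^2H(\sigma)\|_{\mathrm{op}}\le A,$$ where $\nabla^2 H$ is the Hessian of the multilinear extension of $H$. Then: 1. The spectral gap of the Glauber dynamics on $\mu$ is at least $\frac{1}{(1+B\beta)n}$. 2. The homogenization $\mu^{\mathrm{hom}}$ is $\frac{1}{1+B\beta}$-fractionally log-concave. 3. $\mu$ satisfies approximate tensorization of entropy with constant $C=O(n^{B\beta})$. 4. The Glauber dynamics on $\mu$ satisfies the modified log-Sobolev inequality with constant $\rho=\Omega(1/n^{1+B\beta})$. 5. The Glauber dynamics on $\mu$ satisfies, for $\epsilon\in(0,1)$, $$\tau_{\mathrm{mix}}(\epsilon)=O\left(n^{1+B\beta}\left[\log\log\left(1/\min_\sigma\mu(\sigma)\right)+\log(1/\epsilon)\right]\right).$$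
   Context: $O(\cdot)$ and $\Omega(\cdot)$ hide absolute positive constants, and the asymptotic statements are for $n\ge2$. Multilinear extension: $H:\{\pm1\}^n\to\mathbb{R}$ is identified with $H:\mathbb{R}^n\to\mathbb{R}$, $H(x)=\sum_{S\subset[n]}\hat H(S)\prod_{i\in S}x_i$, where $\hat H(S)=2^{-n}\sum_{\sigma\in\{\pm1\}^n}H(\sigma)\prod_{i\in S}\sigma_i$; $\nabla^2H$ is the usual Hessian of this polynomial. Glauber dynamics (discrete time): at each step select $i\in[n]$ uniformly at random and resample $\sigma_i$ from its conditional law under $\mu$ given the other coordinates. Let $P$ be its transition matrix on $\Omega=\{\pm1\}^n$. Dirichlet form: $\mathcal{E}_P(f,g)=\frac12\sum_{x,y\in\Omega}\mu(x)P(x,y)(f(x)-f(y))(g(x)-g(y))$. The spectral gap is the largest $\gamma$ with $\gamma\,\mathrm{Var}_\mu[f]\le\mathcal{E}_P(f,f)$ for all $f:\Omega\to\mathbb{R}$. The modified log-Sobolev constant is the largest $\rho$ with $\rho\,\mathrm{Ent}_\mu[f]\le\mathcal{E}_P(f,\log f)$ for all $f:\Omega\to\mathbb{R}_{\ge0}$ (with the usual limiting conventions at $f=0$), where $\mathrm{Ent}_\mu[f]=\mathbb{E}_\mu[f\log f]-\mathbb{E}_\mu[f]\log\mathbb{E}_\mu[f]$. "Satisfies the inequality with constant $\rho$" means the inequality holds with that $\rho$. Mixing time: $\tau_{\mathrm{mix}}(\epsilon)=\max_{x\in\Omega}\min\{t\ge0: d_{TV}(\mathbf{1}_xP^t,\mu)\le\epsilon\}$,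 where $\mathbf 1_x$ is the point mass at $x$. Homogenization: $\mu^{\mathrm{hom}}$ is the distribution on $n$-element subsets of the $2n$-element set $\{\pm1\}\times[n]$ obtained by identifying $\sigma\in\{\pm1\}^n$ with $\{(\sigma_1,1),\dots,(\sigma_n,n)\}$. Fractional log-concavity: for a distribution $\pi$ on $k$-subsets of $[m]$ with generating polynomial $g_\pi(z_1,\dots,z_m)=\sum_S\pi(S)\prod_{i\in S}z_i$ and $\alpha\in[0,1]$, $\pi$ is $\alpha$-fractionally log-concave if $\log g_\pi(z_1^\alpha,\dots,z_m^\alpha)$ is concave as a function on $\mathbb{R}_{\ge0}^m$. Approximate tensorization of entropy with constant $C$: for every $f:\{\pm1\}^n\to(0,\infty)$, $\mathrm{Ent}_\mu[f]\le C\sum_{v=1}^n\mathbb{E}_\mu[\mathrm{Ent}_v[f]]$, where $\mathrm{Ent}_v[f]$ is the entropy of $f$ with respect to the conditional law of $\sigma_v$ under $\mu$ given $(\sigma_j)_{j\ne v}$. Equivalently, $D_{KL}(\nu D\,\|\,\mu^{\mathrm{hom}}D)\le(1-\frac1{Cn})D_{KL}(\nu\,\|\,\mu^{\mathrm{hom}})$ for every distribution $\nu$ on $n$-subsets of $\{\pm1\}\times[n]$, where $D=D_{n\to n-1}$ removes a uniformly random element of the set. *)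

theory Defs
  imports "HOL-Probability.Probability"
begin

text \<open>The index set \<open>[n]\<close> is \<open>{..<n}\<close>, and vectors of length \<open>n\<close> are functions
  \<open>nat \<Rightarrow> real\<close> of which only the values on \<open>{..<n}\<close> matter, so that \<open>n\<close> can be
  quantified inside a formula.\<close>

definition cube :: "nat \<Rightarrow> (nat \<Rightarrow> real) set" where
  "cube n = ({..<n} \<rightarrow>\<^sub>E {-1, 1})"


subsection \<open>Multilinear extension and its Hessian\<close>

definition fourier_coeff :: "nat \<Rightarrow> ((nat \<Rightarrow> real) \<Rightarrow> real) \<Rightarrow> nat set \<Rightarrow> real" where
  "fourier_coeff n H S = (\<Sum>\<sigma>\<in>cube n. H \<sigma> * (\<Prod>i\<in>S. \<sigma> i)) / 2 ^ n"

definition multilinear_ext :: "nat \<Rightarrow> ((nat \<Rightarrow> real) \<Rightarrow> real) \<Rightarrow> (nat \<Rightarrow> real) \<Rightarrow> real" where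
  "multilinear_ext n H x = (\<Sum>S\<in>Pow {..<n}. fourier_coeff n H S * (\<Prod>i\<in>S. x i))"

definition partial_deriv :: "nat \<Rightarrow> ((nat \<Rightarrow> real) \<Rightarrow> real) \<Rightarrow> (nat \<Rightarrow> real) \<Rightarrow> real" where
  "partial_deriv i F x = deriv (\<lambda>t. F (x(i := t))) (x i)"

definition hessian :: "((nat \<Rightarrow> real) \<Rightarrow> real) \<Rightarrow> (nat \<Rightarrow> real) \<Rightarrow> nat \<Rightarrow> nat \<Rightarrow> real" where
  "hessian F x i j = partial_deriv i (partial_deriv j F) x"

text \<open>Euclidean operator norm of the \<open>n \<times> n\<close> matrix \<open>M\<close>.\<close>

definition op_norm :: "nat \<Rightarrow> (nat \<Rightarrow> nat \<Rightarrow> real) \<Rightarrow> real" where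
  "op_norm n M = (SUP x\<in>{x. L2_set x {..<n} \<le> 1}. L2_set (\<lambda>i. \<Sum>j<n. M i j * x j) {..<n})"

definition max_hessian_norm :: "nat \<Rightarrow> ((nat \<Rightarrow> real) \<Rightarrow> real) \<Rightarrow> real" where
  "max_hessian_norm n H = Max ((\<lambda>\<sigma>. op_norm n (hessian (multilinear_ext n H) \<sigma>)) ` cube n)"


subsection \<open>Glauber dynamics\<close>

text \<open>The law of a sample from \<open>\<mu>\<close> conditioned to agree with \<open>\<sigma>\<close> off coordinate \<open>i\<close>; for
  \<open>\<mu>\<close> of full support on \<open>cube n\<close> and \<open>\<sigma> \<in> cube n\<close> the conditioning event has positive
  probability.\<close>

definition resample :: "nat \<Rightarrow> (nat \<Rightarrow> real) pmf \<Rightarrow> nat \<Rightarrow> (nat \<Rightarrow> real) \<Rightarrow> (nat \<Rightarrow> real) pmf" where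
  "resample n \<mu> i \<sigma> = cond_pmf \<mu> {\<tau>. \<forall>j<n. j \<noteq> i \<longrightarrow> \<tau> j = \<sigma> j}"

definition glauber :: "nat \<Rightarrow> (nat \<Rightarrow> real) pmf \<Rightarrow> (nat \<Rightarrow> real) \<Rightarrow> (nat \<Rightarrow> real) pmf" where
  "glauber n \<mu> \<sigma> = bind_pmf (pmf_of_set {..<n}) (\<lambda>i. resample n \<mu> i \<sigma>)"

definition glauber_steps :: "nat \<Rightarrow> (nat \<Rightarrow> real) pmf \<Rightarrow> nat \<Rightarrow> (nat \<Rightarrow> real) \<Rightarrow> (nat \<Rightarrow> real) pmf" where
  "glauber_steps n \<mu> t \<sigma> = ((\<lambda>p. bind_pmf p (glauber n \<mu>)) ^^ t) (return_pmf \<sigma>)"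

definition dirichlet_form ::
    "nat \<Rightarrow> (nat \<Rightarrow> real) pmf \<Rightarrow> ((nat \<Rightarrow> real) \<Rightarrow> real) \<Rightarrow> ((nat \<Rightarrow> real) \<Rightarrow> real) \<Rightarrow> real" where
  "dirichlet_form n \<mu> f g =
    1 / 2 * (\<Sum>x\<in>cube n. \<Sum>y\<in>cube n. pmf \<mu> x * pmf (glauber n \<mu> x) y * (f x - f y) * (g x - g y))"

definition spectral_gap :: "nat \<Rightarrow> (nat \<Rightarrow> real) pmf \<Rightarrow> real" where
  "spectral_gap n \<mu> =
    (GREATEST \<gamma>. \<forall>f. \<gamma> * measure_pmf.variance \<mu> f \<le> dirichlet_form n \<mu> f f)"

definition tv_dist :: "'a pmf \<Rightarrow> 'a pmf \<Rightarrow> real" where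
  "tv_dist p q = (SUP E. \<bar>measure_pmf.prob p E - measure_pmf.prob q E\<bar>)"

text \<open>Valued in \<open>enat\<close>, so that a chain that does not mix has mixing time \<open>\<infinity>\<close>.\<close>

definition mixing_time :: "nat \<Rightarrow> (nat \<Rightarrow> real) pmf \<Rightarrow> real \<Rightarrow> enat" where
  "mixing_time n \<mu> \<epsilon> =
    Max ((\<lambda>\<sigma>. INF t\<in>{t. tv_dist (glauber_steps n \<mu> t \<sigma>) \<mu> \<le> \<epsilon>}. enat t) ` cube n)"


subsection \<open>Entropy inequalities\<close>

text \<open>\<open>0 log 0 = 0\<close> holds because \<open>ln 0 = 0\<close>.\<close>

definition Ent :: "'a pmf \<Rightarrow> ('a \<Rightarrow> real) \<Rightarrow> real" where
  "Ent p f = measure_pmf.expectation p (\<lambda>x. f x * ln (f x))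
    - measure_pmf.expectation p f * ln (measure_pmf.expectation p f)"

definition approx_tensorization :: "nat \<Rightarrow> (nat \<Rightarrow> real) pmf \<Rightarrow> real \<Rightarrow> bool" where
  "approx_tensorization n \<mu> C \<longleftrightarrow>
    (\<forall>f. (\<forall>\<sigma>\<in>cube n. f \<sigma> > 0) \<longrightarrow>
      Ent \<mu> f \<le> C * (\<Sum>v<n. measure_pmf.expectation \<mu> (\<lambda>\<sigma>. Ent (resample n \<mu> v \<sigma>) f)))"

text \<open>The logarithm on \<open>[0,\<infinity>)\<close> with \<open>log 0 = -\<infinity>\<close>.\<close>

definition elog :: "real \<Rightarrow> ereal" where
  "elog x = (if x = 0 then -\<infinity> else ereal (ln x))"

text \<open>The Dirichlet form at \<open>(f, log f)\<close> for \<open>f \<ge> 0\<close>. The conventions of \<open>ereal\<close> give the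
  limiting values of the summands: \<open>0\<close> if the transition probability vanishes or
  \<open>f x = f y = 0\<close>, and \<open>\<infinity>\<close> if the transition probability is positive and exactly one of \<open>f x\<close>,
  \<open>f y\<close> vanishes.\<close>

definition dirichlet_form_log ::
    "nat \<Rightarrow> (nat \<Rightarrow> real) pmf \<Rightarrow> ((nat \<Rightarrow> real) \<Rightarrow> real) \<Rightarrow> ereal" where
  "dirichlet_form_log n \<mu> f =
    ereal (1 / 2) * (\<Sum>x\<in>cube n. \<Sum>y\<in>cube n.
      ereal (pmf \<mu> x * pmf (glauber n \<mu> x) y * (f x - f y)) * (elog (f x) - elog (f y)))"

definition modified_log_sobolev :: "nat \<Rightarrow> (nat \<Rightarrow> real) pmf \<Rightarrow> real \<Rightarrow> bool" where
  "modified_log_sobolev n \<mu> \<rho> \<longleftrightarrow>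
    (\<forall>f. (\<forall>\<sigma>\<in>cube n. f \<sigma> \<ge> 0) \<longrightarrow> ereal (\<rho> * Ent \<mu> f) \<le> dirichlet_form_log n \<mu> f)"


subsection \<open>Homogenization and fractional log-concavity\<close>

definition homogenization :: "nat \<Rightarrow> (nat \<Rightarrow> real) pmf \<Rightarrow> (real \<times> nat) set pmf" where
  "homogenization n \<mu> = map_pmf (\<lambda>\<sigma>. (\<lambda>i. (\<sigma> i, i)) ` {..<n}) \<mu>"

definition gen_poly :: "'a set \<Rightarrow> nat \<Rightarrow> 'a set pmf \<Rightarrow> ('a \<Rightarrow> real) \<Rightarrow> real" where
  "gen_poly U k \<pi> z = (\<Sum>S | S \<subseteq> U \<and> card S = k. pmf \<pi> S * (\<Prod>i\<in>S. z i))"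

text \<open>\<open>\<pi>\<close> is a distribution on the \<open>k\<close>-subsets of the finite ground set \<open>U\<close>. Concavity on the
  closed orthant is that of a function with values in \<open>[-\<infinity>,\<infinity>)\<close>.\<close>

definition fractionally_log_concave :: "'a set \<Rightarrow> nat \<Rightarrow> 'a set pmf \<Rightarrow> real \<Rightarrow> bool" where
  "fractionally_log_concave U k \<pi> \<alpha> \<longleftrightarrow>
    finite U \<and> set_pmf \<pi> \<subseteq> {S. S \<subseteq> U \<and> card S = k} \<and> 0 \<le> \<alpha> \<and> \<alpha> \<le> 1 \<and>
    (let F = (\<lambda>z. elog (gen_poly U k \<pi> (\<lambda>i. z i powr \<alpha>)))
     in \<forall>z w t. (\<forall>i\<in>U. z i \<ge> 0) \<longrightarrow> (\<forall>i\<in>U. w i \<ge> 0) \<longrightarrow> 0 \<le> t \<longrightarrow> t \<le> 1 \<longrightarrow>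
       ereal (1 - t) * F z + ereal t * F w \<le> F (\<lambda>i. (1 - t) * z i + t * w i))"

end

theory Submission imports Defs
begin

text \<open>Everything follows from one Poincare inequality that loses no factor of the dimension. Let
  \<open>Q\<^sub>i f\<close> be \<open>f\<close> minus its conditional expectation given the spins other than \<open>i\<close>, and let
  \<open>L = \<Sum>\<^sub>i Q\<^sub>i\<close>. The \<open>Q\<^sub>i\<close> are orthogonal projections, and \<open>\<langle>f, L f\<rangle> = \<Sum>\<^sub>i \<parallel>Q\<^sub>i f\<parallel>\<^sup>2\<close> is \<open>n\<close> times the
  Dirichlet form of the Glauber dynamics. As in the method of Bochner and Bakry--Emery, the
  inequality \<open>\<kappa> Var f \<le> \<langle>f, L f\<rangle>\<close> follows from \<open>\<kappa> \<langle>f, L f\<rangle> \<le> \<parallel>L f\<parallel>\<^sup>2\<close> for all \<open>f\<close>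
  (\<open>poincare_from_bochner\<close>). The diagonal terms of \<open>\<parallel>L f\<parallel>\<^sup>2\<close> add up to \<open>\<langle>f, L f\<rangle>\<close>. If the spins \<open>i\<close>
  and \<open>j\<close> did not interact, \<open>Q\<^sub>i\<close> and \<open>Q\<^sub>j\<close> would commute and \<open>\<langle>Q\<^sub>i f, Q\<^sub>j f\<rangle>\<close> would be nonnegative. In
  general this is a question about two spins with the others frozen, and \<open>four_point_inequality\<close>
  bounds the product, in the mean, below by \<open>-T\<^sub>i\<^sub>j Q\<^sub>i f Q\<^sub>j f\<close>, where \<open>T\<^sub>i\<^sub>j\<close> is the entry of the Hessian up to the signs
  of the spins, with an error quadratic in \<open>T\<^sub>i\<^sub>j\<close>. Summed over the pairs, the first part is a quadratic
  form of the Hessian at a single configuration, hence at most \<open>\<beta> \<langle>f, L f\<rangle>\<close>. The errors add up to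
  \<open>O(\<beta>\<^sup>2) \<langle>f, L f\<rangle>\<close> because the rows of the Hessian have Euclidean norm at most \<open>\<beta>\<close>. So
  \<open>\<kappa> = 1 - 2 \<beta>\<close> for small \<open>\<beta>\<close> (\<open>bochner_inequality\<close>), which is the spectral gap with \<open>B = 4\<close>.

  The argument sees the measure only through mixed second differences of its logarithm. An external
  field does not change them, so the Poincare inequality holds for all tilts of \<open>\<mu>\<close>. For functions
  that are sums of functions of one spin it is a bound on the covariance matrix of every tilt by the
  diagonal of the variances, and this is exactly the bound on the second derivative that makes
  \<open>log g(z\<^sup>\<alpha>)\<close> concave for \<open>\<alpha> = 1 / (1 + 4 \<beta>)\<close> (\<open>spin_poly_log_concave\<close>).

  A concave function lies below its tangents. Combined with the variational principle for the relative
  entropy, the tangent at the point of all ones says that the relative entropies of the marginals of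
  the single spins add up to at most \<open>1 + 4 \<beta>\<close> times the relative entropy. At boundary points of the
  orthant, with coordinates \<open>0\<close> and \<open>1\<close> for some of the spins, it says the same for the measure in which
  these spins are pinned (\<open>entropic_independence\<close>). Induction on the number of free spins turns this
  into tensorization of entropy with constant \<open>\<Prod>\<^sub>j j / (j - 4 \<beta>)\<close>, which is of order \<open>n\<close> to the power
  \<open>4 \<beta>\<close> (\<open>rel_ent_tensorization\<close>). The modified log-Sobolev inequality follows by Jensen's inequality.
  Convexity of the relative entropy turns tensorization into its contraction under one step of the
  dynamics, and with an inequality of Pinsker's type this bounds the mixing time.\<close>

section \<open>The hypercube and its flips\<close>

definition flip :: "nat \<Rightarrow> (nat \<Rightarrow> real) \<Rightarrow> nat \<Rightarrow> real" where
  "flip i x = x(i := - x i)"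

lemma flip_flip [simp]: "flip i (flip i x) = x"
  by (auto simp: flip_def)

lemma flip_commute: "flip i (flip j x) = flip j (flip i x)"
  by (auto simp: flip_def fun_eq_iff)

lemma flip_same [simp]: "flip i x i = - x i"
  by (simp add: flip_def)

lemma flip_other: "j \<noteq> i \<Longrightarrow> flip i x j = x j"
  by (simp add: flip_def)

lemma finite_cube [simp, intro]: "finite (cube n)"
  unfolding cube_def by (intro finite_PiE) auto

lemma cube_values: "x \<in> cube n \<Longrightarrow> i < n \<Longrightarrow> x i = -1 \<or> x i = 1"
  unfolding cube_def by (auto simp: PiE_iff)

lemma cube_square: "x \<in> cube n \<Longrightarrow> i < n \<Longrightarrow> x i * x i = 1"
  using cube_values by force

lemma cube_eqI:
  assumes "x \<in> cube n" "\<tau> \<in> cube n" "\<And>i. i < n \<Longrightarrow> x i = \<tau> i"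
  shows "x = \<tau>"
  using assms unfolding cube_def by (auto intro: PiE_ext)

lemma cube_update:
  assumes "x \<in> cube n" "i < n" "s = -1 \<or> s = 1"
  shows "x(i := s) \<in> cube n"
  using assms unfolding cube_def by (auto simp: PiE_iff extensional_def)

lemma flip_cube [simp]: "x \<in> cube n \<Longrightarrow> i < n \<Longrightarrow> flip i x \<in> cube n"
  unfolding flip_def using cube_values by (intro cube_update) auto

lemma flip_neq: "x \<in> cube n \<Longrightarrow> i < n \<Longrightarrow> flip i x \<noteq> x"
  using cube_values[of x n i] by (metis flip_same neg_equal_zero zero_neq_neg_one zero_neq_one)

lemma cube_nonempty: "cube n \<noteq> {}"
  unfolding cube_def by (auto simp: PiE_eq_empty_iff)

lemma eq_or_flip:
  assumes y: "y \<in> cube n" and s: "x \<in> cube n" and i: "i < n" and eq: "\<forall>j<n. j \<noteq> i \<longrightarrow> y j = x j"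
  shows "y = x \<or> y = flip i x"
proof (cases "y i = x i")
  case True
  then have "y = x" using eq by (intro cube_eqI[OF y s]) metis
  then show ?thesis ..
next
  case False
  then have xi: "y i = - x i" using cube_values[OF s i] cube_values[OF y i] by auto
  have "y = flip i x"
  proof (rule cube_eqI[OF y flip_cube[OF s i]])
    fix j assume "j < n"
    then show "y j = flip i x j" using xi eq by (cases "j = i") (auto simp: flip_other)
  qed
  then show ?thesis ..
qed

text \<open>Replacing the spins of one point by those of another one at a time.\<close>

lemma cube_path:
  assumes s: "x \<in> cube n" and t: "\<tau> \<in> cube n"
  obtains h where "h 0 = x" "h n = \<tau>" "\<And>k. h k \<in> cube n"
    "\<And>k. k < n \<Longrightarrow> h (Suc k) = h k \<or> h (Suc k) = flip k (h k)"
proof -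
  define h where "h k = (\<lambda>j. if j < k then \<tau> j else x j)" for k :: nat
  have hc: "h k \<in> cube n" for k
    using s t unfolding cube_def h_def by (auto simp: PiE_iff extensional_def)
  have "h 0 = x" by (simp add: h_def)
  moreover have "h n = \<tau>" using s t hc by (intro cube_eqI[of _ n]) (auto simp: h_def)
  moreover have "h (Suc k) = h k \<or> h (Suc k) = flip k (h k)" if "k < n" for k
  proof (cases "\<tau> k = x k")
    case True
    then show ?thesis by (auto simp: h_def fun_eq_iff less_Suc_eq)
  next
    case False
    then have "\<tau> k = - x k" using cube_values[OF s that] cube_values[OF t that] by auto
    then show ?thesis by (auto simp: h_def flip_def fun_eq_iff less_Suc_eq)
  qed
  ultimately show thesis using hc that by blast
qed

lemma cube_connected:
  assumes s: "x \<in> cube n" and t: "\<tau> \<in> cube n" and P: "P x"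
    and step: "\<And>y i. y \<in> cube n \<Longrightarrow> i < n \<Longrightarrow> P y \<Longrightarrow> P (flip i y)"
  shows "P \<tau>"
proof -
  obtain h where h: "h 0 = x" "h n = \<tau>" "\<And>k. h k \<in> cube n"
    "\<And>k. k < n \<Longrightarrow> h (Suc k) = h k \<or> h (Suc k) = flip k (h k)"
    using cube_path[OF s t] by blast
  have "k \<le> n \<Longrightarrow> P (h k)" for k
  proof (induction k)
    case 0
    then show ?case using P h(1) by simp
  next
    case (Suc k)
    then show ?case using h(4)[of k] step[OF h(3), of k k] by auto
  qed
  then show ?thesis using h(2) by (metis order_refl)
qed

lemma sum_flip:
  assumes "i < n"
  shows "(\<Sum>x\<in>cube n. F (flip i x)) = (\<Sum>x\<in>cube n. F x)"
  by (rule sum.reindex_bij_witness[of _ "flip i" "flip i"]) (use assms in auto)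

lemma sum_flip_average:
  fixes F :: "(nat \<Rightarrow> real) \<Rightarrow> real"
  assumes "i < n"
  shows "(\<Sum>x\<in>cube n. F x) = (\<Sum>x\<in>cube n. F x + F (flip i x)) / 2"
  by (simp add: sum.distrib sum_flip[OF assms])

section \<open>Two interacting spins\<close>

text \<open>The unperturbed form, at \<open>T = e2 = e3 = e4 = 0\<close>, is the square \<open>(x1 - x2)\<^sup>2\<close>: its part
  proportional to \<open>x2 y2\<close> cancels. The perturbation \<open>e4 - e2 - e3\<close> is \<open>-4 T\<close> to first order by the
  assumption on \<open>1 + e4\<close>, and the added multiple of \<open>T\<close> cancels this as well. What remains is
  quadratic in \<open>T\<close>, or linear in \<open>T\<close> but proportional to \<open>x1 - x2\<close>.\<close>

lemma two_site_perturbation: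
  fixes T e2 e3 e4 x1 x2 y1 y2 :: real
  assumes T: "\<bar>T\<bar> \<le> 1/32"
    and e2: "\<bar>e2\<bar> \<le> 16 * \<bar>T\<bar>" and e3: "\<bar>e3\<bar> \<le> 16 * \<bar>T\<bar>" and e4: "\<bar>e4\<bar> \<le> 16 * \<bar>T\<bar>"
    and rel: "1 + e4 = exp (-4 * T) * ((1 + e2) * (1 + e3))"
    and D: "x1 - x2 = y1 - y2"
  shows "x1 * y1 - (1 + e2) * (x2 * y1) - (1 + e3) * (x1 * y2) + (1 + e4) * (x2 * y2)
    + T * (x1 * y1 + (1 + e2) * (x2 * y1) + (1 + e3) * (x1 * y2) + (1 + e4) * (x2 * y2))
    \<ge> - 750 * T\<^sup>2 * (x2\<^sup>2 + y2\<^sup>2)"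
proof -
  define d where "d = x1 - x2"
  have x1: "x1 = x2 + d" and y1: "y1 = y2 + d" using D by (auto simp: d_def)
  define E where "E = exp (-4 * T) - 1"
  define u2 u3 s where "u2 = -e2 + 2 * T + T * e2" and "u3 = -e3 + 2 * T + T * e3"
    and "s = e4 - e2 - e3 + 4 * T + T * (e2 + e3 + e4)"
  have sq: "\<bar>a * b\<bar> \<le> k * l * T\<^sup>2" if "\<bar>a\<bar> \<le> k * \<bar>T\<bar>" "\<bar>b\<bar> \<le> l * \<bar>T\<bar>" for a b k l
    using mult_mono[OF that] that by (simp add: abs_mult power2_eq_square algebra_simps)
  have Ebd: "\<bar>E - (-4 * T)\<bar> \<le> 16 * T\<^sup>2"
  proof -
    have "exp (-4*T) \<le> 1 + (-4*T) + (-4*T)\<^sup>2"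
    proof (cases "0 \<le> -4 * T")
      case True then show ?thesis using T by (intro exp_bound) auto
    next
      case False
      define v where "v = 4 * T"
      have v: "0 \<le> v" "v \<le> 1" using False T by (auto simp: v_def)
      have "1 \<le> (1 - v + v\<^sup>2) * (1 + v)"
        using v by (simp add: algebra_simps power2_eq_square)
      also have "\<dots> \<le> (1 - v + v\<^sup>2) * exp v"
        using v exp_ge_add_one_self[of v] by (intro mult_left_mono) (auto simp: power2_eq_square)
      finally have "exp (-v) \<le> 1 - v + v\<^sup>2" by (simp add: exp_minus field_simps)
      then show ?thesis by (simp add: v_def)
    qed
    moreover have "exp (-4*T) \<ge> 1 + (-4*T)" by (rule exp_ge_add_one_self)
    ultimately show ?thesis by (simp add: E_def power2_eq_square)
  qed
  have T2: "T\<^sup>2 \<le> \<bar>T\<bar> / 32"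
    using mult_left_mono[OF T, of "\<bar>T\<bar>"] by (simp add: power2_eq_square)
  have E1: "\<bar>E\<bar> \<le> 5 * \<bar>T\<bar>" using Ebd T2 by linarith
  have m23: "\<bar>e2 * e3\<bar> \<le> 16 * 16 * T\<^sup>2" by (intro sq e2 e3)
  have "\<bar>e2 + e3 + e2 * e3\<bar> \<le> 40 * \<bar>T\<bar>" using m23 e2 e3 T2 by linarith
  then have m: "\<bar>E * (e2 + e3 + e2 * e3)\<bar> \<le> 5 * 40 * T\<^sup>2" by (intro sq E1)
  have e234: "\<bar>e2 + e3 + e4\<bar> \<le> 48 * \<bar>T\<bar>" using e2 e3 e4 by linarith
  have m': "\<bar>T * (e2 + e3 + e4)\<bar> \<le> 1 * 48 * T\<^sup>2" by (intro sq e234) auto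
  have "e4 - e2 - e3 + 4 * T = (E - (-4 * T)) + E * (e2 + e3 + e2 * e3) + e2 * e3"
    using rel by (simp add: E_def algebra_simps)
  then have s: "\<bar>s\<bar> \<le> 600 * T\<^sup>2" unfolding s_def using Ebd m m' m23 by linarith
  have u2: "\<bar>u2\<bar> \<le> 19 * \<bar>T\<bar>" 
  proof -
    have "\<bar>T * e2\<bar> \<le> 1 * 16 * T\<^sup>2" by (intro sq e2) auto
    then show ?thesis unfolding u2_def using e2 T2 by linarith
  qed
  have u3: "\<bar>u3\<bar> \<le> 19 * \<bar>T\<bar>" 
  proof -
    have "\<bar>T * e3\<bar> \<le> 1 * 16 * T\<^sup>2" by (intro sq e3) auto
    then show ?thesis unfolding u3_def using e3 T2 by linarith
  qed
  have cross: "d\<^sup>2 / 4 + d * (u * x) \<ge> - 361 * T\<^sup>2 * x\<^sup>2" if "\<bar>u\<bar> \<le> 19 * \<bar>T\<bar>" for u x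
  proof -
    have "u\<^sup>2 \<le> 361 * T\<^sup>2" using sq[OF that that] by (simp add: power2_eq_square)
    then have "u\<^sup>2 * x\<^sup>2 \<le> 361 * T\<^sup>2 * x\<^sup>2" by (intro mult_right_mono) auto
    moreover have "0 \<le> (d / 2 + u * x)\<^sup>2" by simp
    then have "d\<^sup>2 / 4 + d * (u * x) \<ge> - (u\<^sup>2 * x\<^sup>2)" 
      by (simp add: power2_eq_square algebra_simps)
    ultimately show ?thesis by linarith
  qed
  have "\<bar>s * (x2 * y2)\<bar> \<le> (600 * T\<^sup>2) * ((x2\<^sup>2 + y2\<^sup>2) / 2)"
  proof -
    have "\<bar>x2 * y2\<bar> \<le> (x2\<^sup>2 + y2\<^sup>2) / 2" 
      using sum_squares_bound[of "\<bar>x2\<bar>" "\<bar>y2\<bar>"] by (simp add: abs_mult)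
    then show ?thesis unfolding abs_mult[of s] by (intro mult_mono s) auto
  qed
  then have sxy: "s * (x2 * y2) \<ge> - 300 * T\<^sup>2 * (x2\<^sup>2 + y2\<^sup>2)"
    by (simp add: algebra_simps abs_le_iff)
  have dT: "d\<^sup>2 * (1/2 + T) \<ge> 0" using T by (intro mult_nonneg_nonneg) auto
  (* Expanded around x2 and y2, the terms of first order in T are multiples of d; half of the
     square d^2 left over from the unperturbed part absorbs them. *)
  have "x1 * y1 - (1 + e2) * (x2 * y1) - (1 + e3) * (x1 * y2) + (1 + e4) * (x2 * y2)
    + T * (x1 * y1 + (1 + e2) * (x2 * y1) + (1 + e3) * (x1 * y2) + (1 + e4) * (x2 * y2))
    = d\<^sup>2 * (1/2 + T) + s * (x2 * y2) + (d\<^sup>2 / 4 + d * (u2 * x2)) + (d\<^sup>2 / 4 + d * (u3 * y2))"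
    unfolding x1 y1 s_def u2_def u3_def by (simp add: field_simps power2_eq_square)
  moreover have "0 \<le> T\<^sup>2 * x2\<^sup>2" "0 \<le> T\<^sup>2 * y2\<^sup>2" by auto
  moreover have "- 750 * T\<^sup>2 * (x2\<^sup>2 + y2\<^sup>2) = - 300 * T\<^sup>2 * (x2\<^sup>2 + y2\<^sup>2) - 361 * T\<^sup>2 * x2\<^sup>2
    - 361 * T\<^sup>2 * y2\<^sup>2 - 89 * (T\<^sup>2 * x2\<^sup>2) - 89 * (T\<^sup>2 * y2\<^sup>2)"
    by (simp add: algebra_simps)
  ultimately show ?thesis using dT sxy cross[OF u2, of x2] cross[OF u3, of y2] by linarith
qed

text \<open>The cross term \<open>\<langle>Q\<^sub>i f, Q\<^sub>j f\<rangle>\<close> for two spins. The weights of the four configurations are \<open>a\<close>, \<open>c\<close>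
  (flip \<open>i\<close>), \<open>b\<close> (flip \<open>j\<close>) and \<open>d\<close> (flip both); \<open>f0\<close>, \<open>fi\<close>, \<open>fj\<close>, \<open>fij\<close> are the values of \<open>f\<close>, and
  \<open>qi0\<close>, \<open>qii\<close>, \<open>qij\<close>, \<open>qiij\<close> those of \<open>Q\<^sub>i f\<close> in the same order, likewise for \<open>j\<close>. The products
  \<open>w Q\<^sub>i f Q\<^sub>j f\<close> carry weights whose ratios lie between \<open>exp (- 8 \<bar>T\<bar>)\<close> and \<open>exp (8 \<bar>T\<bar>)\<close> whatever \<open>a\<close>, \<open>b\<close>, \<open>c\<close>, \<open>d\<close>
  are, so external fields do not enter the estimate.\<close>

lemma four_point_inequality:
  fixes a b c d f0 fi fj fij :: real
  assumes pos: "a > 0" "b > 0" "c > 0" "d > 0"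
    and T: "T = ln (a * d / (b * c)) / 4" and T1: "\<bar>T\<bar> \<le> 1/32"
  defines "qi0 \<equiv> c * (f0 - fi) / (a + c)" and "qii \<equiv> a * (fi - f0) / (c + a)"
    and "qij \<equiv> d * (fj - fij) / (b + d)" and "qiij \<equiv> b * (fij - fj) / (d + b)"
    and "qj0 \<equiv> b * (f0 - fj) / (a + b)" and "qjj \<equiv> a * (fj - f0) / (b + a)"
    and "qji \<equiv> d * (fi - fij) / (c + d)" and "qjij \<equiv> c * (fij - fi) / (d + c)"
  shows "a * (qi0 * qj0) + c * (qii * qji) + b * (qij * qjj) + d * (qiij * qjij)
    + (T * (a * (qi0 * qj0)) - T * (c * (qii * qji)) - T * (b * (qij * qjj)) + T * (d * (qiij * qjij)))
    \<ge> - 1500 * (T\<^sup>2 * (a * (qi0\<^sup>2 + qj0\<^sup>2)) + T\<^sup>2 * (c * (qii\<^sup>2 + qji\<^sup>2))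
        + T\<^sup>2 * (b * (qij\<^sup>2 + qjj\<^sup>2)) + T\<^sup>2 * (d * (qiij\<^sup>2 + qjij\<^sup>2)))"
proof -
  (* Each of the four products is one of these weights, up to sign, times a difference of f in
     direction i and one in direction j. All four coincide if the two spins are independent. *)
  define P1 P2 P3 P4 where "P1 = a * b * c / ((a + c) * (a + b))"
    and "P2 = a * b * d / ((b + d) * (a + b))"
    and "P3 = a * c * d / ((a + c) * (c + d))"
    and "P4 = b * c * d / ((b + d) * (c + d))"
  define x1 x2 y1 y2 where "x1 = f0 - fi" and "x2 = fj - fij" and "y1 = f0 - fj" and "y2 = fi - fij"
  have P: "P1 > 0" "P2 > 0" "P3 > 0" "P4 > 0"
    using pos by (auto simp: P1_def P2_def P3_def P4_def)
  have X1: "a * (qi0 * qj0) = P1 * (x1 * y1)"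
    unfolding qi0_def qj0_def P1_def x1_def y1_def using pos by (simp add: field_simps)
  have X3: "c * (qii * qji) = - (P3 * (x1 * y2))"
  proof -
    have "qii = - (a * x1 / (a + c))" "qji = d * y2 / (c + d)"
      using pos by (simp_all add: qii_def qji_def x1_def y2_def field_simps)
    then show ?thesis by (simp add: P3_def)
  qed
  have X2: "b * (qij * qjj) = - (P2 * (x2 * y1))"
  proof -
    have "qij = d * x2 / (b + d)" "qjj = - (a * y1 / (a + b))"
      using pos by (simp_all add: qij_def qjj_def x2_def y1_def field_simps)
    then show ?thesis by (simp add: P2_def)
  qed
  have X4: "d * (qiij * qjij) = P4 * (x2 * y2)"
  proof -
    have "qiij = - (b * x2 / (b + d))" "qjij = - (c * y2 / (c + d))"
      using pos by (simp_all add: qiij_def qjij_def x2_def y2_def field_simps)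
    then show ?thesis by (simp add: P4_def)
  qed
  have YI: "b * qij\<^sup>2 + d * qiij\<^sup>2 = b * d / (b + d) * x2\<^sup>2"
  proof -
    have "qij = d * x2 / (b + d)" "qiij = - (b * x2 / (b + d))"
      using pos by (simp_all add: qij_def qiij_def x2_def field_simps)
    then have "b * qij\<^sup>2 + d * qiij\<^sup>2 = b * d * (b + d) * x2\<^sup>2 / (b + d)\<^sup>2"
      by (simp add: power_divide power_mult_distrib add_divide_distrib[symmetric]
          algebra_simps power2_eq_square)
    then show ?thesis using pos by (simp add: power2_eq_square)
  qed
  have YJ: "c * qji\<^sup>2 + d * qjij\<^sup>2 = c * d / (c + d) * y2\<^sup>2"
  proof -
    have "qji = d * y2 / (c + d)" "qjij = - (c * y2 / (c + d))"
      using pos by (simp_all add: qji_def qjij_def y2_def field_simps)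
    then have "c * qji\<^sup>2 + d * qjij\<^sup>2 = c * d * (c + d) * y2\<^sup>2 / (c + d)\<^sup>2"
      by (simp add: power_divide power_mult_distrib add_divide_distrib[symmetric]
          algebra_simps power2_eq_square)
    then show ?thesis using pos by (simp add: power2_eq_square)
  qed
  define E where "E = exp (4 * \<bar>T\<bar>)"
  have E1: "E \<ge> 1" by (simp add: E_def)
  have eT: "exp (4 * T) = a * d / (b * c)" using pos by (simp add: T)
  have adE: "a * d \<le> E * (b * c)"
  proof -
    have "a * d / (b * c) \<le> E" unfolding eT[symmetric] E_def by simp
    then show ?thesis using pos by (simp add: field_simps)
  qed
  have bcE: "b * c \<le> E * (a * d)"
  proof -
    have "exp (- (4 * T)) = b * c / (a * d)" unfolding exp_minus eT using pos by simp
    moreover have "exp (- (4 * T)) \<le> E" unfolding E_def exp_le_cancel_iff by linarith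
    ultimately have "b * c / (a * d) \<le> E" by simp
    then show ?thesis using pos by (simp add: pos_divide_le_eq)
  qed
  have ratio: "(u + z) / (v + z) \<le> E" "(v + z) / (u + z) \<le> E"
    if "u \<le> E * v" "v \<le> E * u" "u > 0" "v > 0" "z > 0" for u v z
  proof -
    have "z \<le> E * z" using E1 that by simp
    then have "u + z \<le> E * (v + z)" "v + z \<le> E * (u + z)"
      using that(1,2) unfolding distrib_left by linarith+
    then show "(u + z) / (v + z) \<le> E" "(v + z) / (u + z) \<le> E"
      using that by (simp_all add: pos_divide_le_eq)
  qed
  have nz: "a + b \<noteq> 0" "a + c \<noteq> 0" "b + d \<noteq> 0" "c + d \<noteq> 0" using pos by auto
  have cr: "u / v = w / z" if "u * z = k" "v * w = k" "v > 0" "z > 0" for u v w z k :: real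
    using that by (simp add: frac_eq_eq mult.commute)
  have R21: "P2 / P1 = (a * d + c * d) / (b * c + c * d)"
  proof (rule cr)
    have "P2 * (c * (b + d)) = a * b * c * d / (a + b)" using nz by (simp add: P2_def divide_simps)
    then show "P2 * (b * c + c * d) = a * b * c * d / (a + b)" by (simp add: algebra_simps)
    have "P1 * (d * (a + c)) = a * b * c * d / (a + b)" using nz by (simp add: P1_def divide_simps)
    then show "P1 * (a * d + c * d) = a * b * c * d / (a + b)" by (simp add: algebra_simps)
  qed (use pos P in \<open>auto intro!: add_pos_pos\<close>)
  have R31: "P3 / P1 = (a * d + b * d) / (b * c + b * d)"
  proof (rule cr)
    have "P3 * (b * (c + d)) = a * b * c * d / (a + c)" using nz by (simp add: P3_def divide_simps)
    then show "P3 * (b * c + b * d) = a * b * c * d / (a + c)" by (simp add: algebra_simps)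
    have "P1 * (d * (a + b)) = a * b * c * d / (a + c)" using nz by (simp add: P1_def divide_simps)
    then show "P1 * (a * d + b * d) = a * b * c * d / (a + c)" by (simp add: algebra_simps)
  qed (use pos P in \<open>auto intro!: add_pos_pos\<close>)
  have R43: "P4 / P3 = (b * c + a * b) / (a * d + a * b)"
  proof (rule cr)
    have "P4 * (a * (b + d)) = a * b * c * d / (c + d)" using nz by (simp add: P4_def divide_simps)
    then show "P4 * (a * d + a * b) = a * b * c * d / (c + d)" by (simp add: algebra_simps)
    have "P3 * (b * (a + c)) = a * b * c * d / (c + d)" using nz by (simp add: P3_def divide_simps)
    then show "P3 * (b * c + a * b) = a * b * c * d / (c + d)" by (simp add: algebra_simps)
  qed (use pos P in \<open>auto intro!: add_pos_pos\<close>)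
  have inv: "v / u = y / x" if "u / v = x / y" for u v x y :: real
    using arg_cong[OF that, of inverse] by simp
  have b21: "P2 / P1 \<le> E" "P1 / P2 \<le> E"
    unfolding R21 inv[OF R21] using ratio[OF adE bcE, of "c * d"] pos by auto
  have b31: "P3 / P1 \<le> E" "P1 / P3 \<le> E"
    unfolding R31 inv[OF R31] using ratio[OF adE bcE, of "b * d"] pos by auto
  have b43: "P4 / P3 \<le> E" "P3 / P4 \<le> E"
    unfolding R43 inv[OF R43] using ratio[OF bcE adE, of "a * b"] pos by auto
  have E2: "E * E \<le> 1 + 16 * \<bar>T\<bar>"
  proof -
    have "E * E = exp (8 * \<bar>T\<bar>)" by (simp add: E_def flip: exp_add)
    also have "\<dots> \<le> 1 + 8 * \<bar>T\<bar> + (8 * \<bar>T\<bar>)\<^sup>2" using T1 by (intro exp_bound) auto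
    also have "(8 * \<bar>T\<bar>)\<^sup>2 \<le> 8 * \<bar>T\<bar>" 
      using T1 mult_left_le[of "8 * \<bar>T\<bar>" "8 * \<bar>T\<bar>"] by (simp add: power2_eq_square)
    finally show ?thesis by simp
  qed
  have EE: "E \<le> E * E" using E1 by simp
  have small: "\<bar>p / P1 - 1\<bar> \<le> 16 * \<bar>T\<bar>" if "p / P1 \<le> E * E" "P1 / p \<le> E * E" "p > 0" for p
  proof -
    have "1 - 16 * \<bar>T\<bar> \<le> p / P1"
    proof -
      have "1 / (1 + 16 * \<bar>T\<bar>) \<le> p / P1"
      proof -
        have "P1 / p \<le> 1 + 16 * \<bar>T\<bar>" using that E2 by linarith
        then have "1 / (1 + 16 * \<bar>T\<bar>) \<le> 1 / (P1 / p)" using P that by (intro divide_left_mono) auto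
        then show ?thesis by simp
      qed
      moreover have "1 - 16 * \<bar>T\<bar> \<le> 1 / (1 + 16 * \<bar>T\<bar>)"
      proof -
        have "(1 - 16 * \<bar>T\<bar>) * (1 + 16 * \<bar>T\<bar>) \<le> 1" by (simp add: algebra_simps)
        then show ?thesis by (subst pos_le_divide_eq) auto
      qed
      ultimately show ?thesis by linarith
    qed
    moreover have "p / P1 \<le> 1 + 16 * \<bar>T\<bar>" using that E2 by linarith
    ultimately show ?thesis by linarith
  qed
  have b41: "P4 / P1 \<le> E * E" "P1 / P4 \<le> E * E"
  proof -
    have "P4 / P1 = (P4 / P3) * (P3 / P1)" using P by simp
    also have "\<dots> \<le> E * E" using b43 b31 P E1 by (intro mult_mono) auto
    finally show "P4 / P1 \<le> E * E" .
    have "P1 / P4 = (P1 / P3) * (P3 / P4)" using P by simp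
    also have "\<dots> \<le> E * E" using b43 b31 P E1 by (intro mult_mono) auto
    finally show "P1 / P4 \<le> E * E" .
  qed
  define e2 e3 e4 where "e2 = P2 / P1 - 1" and "e3 = P3 / P1 - 1" and "e4 = P4 / P1 - 1"
  have e: "\<bar>e2\<bar> \<le> 16 * \<bar>T\<bar>" "\<bar>e3\<bar> \<le> 16 * \<bar>T\<bar>" "\<bar>e4\<bar> \<le> 16 * \<bar>T\<bar>"
    unfolding e2_def e3_def e4_def using b21 b31 b41 EE P by (auto intro!: small)
  have rel: "1 + e4 = exp (-4 * T) * ((1 + e2) * (1 + e3))"
  proof -
    have "exp (-4 * T) = b * c / (a * d)" using eT pos by (simp add: exp_minus)
    moreover have "P1 * P4 * (a * d) = P2 * P3 * (b * c)"
      unfolding P1_def P2_def P3_def P4_def by (simp add: algebra_simps)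
    moreover have "P4 / P1 = P1 * P4 * (a * d) / (P1 * P1 * (a * d))" using P pos by simp
    ultimately show ?thesis unfolding e2_def e3_def e4_def by (simp add: mult_ac)
  qed
  have D: "x1 - x2 = y1 - y2" by (simp add: x1_def x2_def y1_def y2_def)
  have Pe: "P2 = P1 * (1 + e2)" "P3 = P1 * (1 + e3)" "P4 = P1 * (1 + e4)"
    using P by (simp_all add: e2_def e3_def e4_def)
  have "P1 * (x1 * y1 - (1 + e2) * (x2 * y1) - (1 + e3) * (x1 * y2) + (1 + e4) * (x2 * y2)
    + T * (x1 * y1 + (1 + e2) * (x2 * y1) + (1 + e3) * (x1 * y2) + (1 + e4) * (x2 * y2)))
    \<ge> P1 * (- 750 * T\<^sup>2 * (x2\<^sup>2 + y2\<^sup>2))"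
    using two_site_perturbation[OF T1 e rel D] P by (intro mult_left_mono) auto
  then have main: "P1 * (x1 * y1) - P2 * (x2 * y1) - P3 * (x1 * y2) + P4 * (x2 * y2)
     + T * (P1 * (x1 * y1) + P2 * (x2 * y1) + P3 * (x1 * y2) + P4 * (x2 * y2))
     \<ge> - 750 * T\<^sup>2 * (P1 * x2\<^sup>2 + P1 * y2\<^sup>2)"
    unfolding Pe by (simp add: algebra_simps)
  have "E * E \<le> 2" using E2 T1 by linarith
  then have P14: "P1 \<le> 2 * P4"
    using order_trans[OF b41(2)] P by (simp add: pos_divide_le_eq)
  have "P4 \<le> b * d / (b + d)" "P4 \<le> c * d / (c + d)"
  proof -
    have "P4 = b * d / (b + d) * (c / (c + d))" "P4 = c * d / (c + d) * (b / (b + d))"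
      by (simp_all add: P4_def mult_ac)
    moreover have "b * d / (b + d) * (c / (c + d)) \<le> b * d / (b + d)"
      "c * d / (c + d) * (b / (b + d)) \<le> c * d / (c + d)"
      using pos by (intro mult_left_le; simp)+
    ultimately show "P4 \<le> b * d / (b + d)" "P4 \<le> c * d / (c + d)" by simp_all
  qed
  then have "P1 * x2\<^sup>2 \<le> 2 * (b * d / (b + d)) * x2\<^sup>2" "P1 * y2\<^sup>2 \<le> 2 * (c * d / (c + d)) * y2\<^sup>2"
    using P14 by (intro mult_right_mono; linarith?; simp)+
  then have "P1 * x2\<^sup>2 + P1 * y2\<^sup>2 \<le> 2 * ((b * qij\<^sup>2 + d * qiij\<^sup>2) + (c * qji\<^sup>2 + d * qjij\<^sup>2))"
    unfolding YI YJ by simp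
  also have "\<dots> \<le> 2 * (a * (qi0\<^sup>2 + qj0\<^sup>2) + c * (qii\<^sup>2 + qji\<^sup>2) + b * (qij\<^sup>2 + qjj\<^sup>2) + d * (qiij\<^sup>2 + qjij\<^sup>2))"
    using pos by (simp add: algebra_simps)
  finally have "T\<^sup>2 * (P1 * x2\<^sup>2 + P1 * y2\<^sup>2) 
    \<le> T\<^sup>2 * (2 * (a * (qi0\<^sup>2 + qj0\<^sup>2) + c * (qii\<^sup>2 + qji\<^sup>2) + b * (qij\<^sup>2 + qjj\<^sup>2) + d * (qiij\<^sup>2 + qjij\<^sup>2)))"
    by (intro mult_left_mono) auto
  then show ?thesis using main unfolding X1 X2 X3 X4 by (simp add: algebra_simps)
qed

section \<open>Weak interaction and a Bochner inequality\<close>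

text \<open>The deviation of \<open>f\<close> from its conditional expectation given the spins other than \<open>i\<close>, under the
  measure proportional to \<open>w\<close>.\<close>

definition cond_dev :: "((nat \<Rightarrow> real) \<Rightarrow> real) \<Rightarrow> nat \<Rightarrow> ((nat \<Rightarrow> real) \<Rightarrow> real) \<Rightarrow> (nat \<Rightarrow> real) \<Rightarrow> real" where
  "cond_dev w i f x = w (flip i x) * (f x - f (flip i x)) / (w x + w (flip i x))"

text \<open>For \<open>w = exp H\<close> this is the Hessian of \<open>H\<close> at \<open>x\<close> multiplied by the signs \<open>x i * x j\<close>
  (\<open>hessian_eq_interaction\<close>), which does not change the operator norm. It is the quantity that
  appears in the two-spin computation, and it makes sense without choosing a logarithm \<open>H\<close>.\<close>

definition interaction :: "((nat \<Rightarrow> real) \<Rightarrow> real) \<Rightarrow> (nat \<Rightarrow> real) \<Rightarrow> nat \<Rightarrow> nat \<Rightarrow> real" where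
  "interaction w x i j = (if i = j then 0
     else ln (w x * w (flip i (flip j x)) / (w (flip j x) * w (flip i x))) / 4)"

text \<open>The last clause bounds the operator norm of the interaction matrix at every configuration by \<open>\<beta>\<close>.\<close>

definition weakly_interacting :: "nat \<Rightarrow> ((nat \<Rightarrow> real) \<Rightarrow> real) \<Rightarrow> real \<Rightarrow> bool" where
  "weakly_interacting n w \<beta> \<longleftrightarrow> 0 \<le> \<beta> \<and> (\<forall>x\<in>cube n. 0 < w x) \<and>
     (\<forall>x\<in>cube n. \<forall>q. (\<Sum>i<n. (\<Sum>j<n. interaction w x i j * q j)\<^sup>2) \<le> \<beta>\<^sup>2 * (\<Sum>j<n. (q j)\<^sup>2))"

lemma weakly_interacting_nonneg: "weakly_interacting n w \<beta> \<Longrightarrow> 0 \<le> \<beta>"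
  by (simp add: weakly_interacting_def)

lemma weakly_interacting_pos: "weakly_interacting n w \<beta> \<Longrightarrow> x \<in> cube n \<Longrightarrow> 0 < w x"
  by (simp add: weakly_interacting_def)

lemma weakly_interacting_norm:
  "weakly_interacting n w \<beta> \<Longrightarrow> x \<in> cube n \<Longrightarrow>
    (\<Sum>i<n. (\<Sum>j<n. interaction w x i j * q j)\<^sup>2) \<le> \<beta>\<^sup>2 * (\<Sum>j<n. (q j)\<^sup>2)"
  by (simp add: weakly_interacting_def)

lemma weakly_interacting_mono:
  assumes "weakly_interacting n w \<beta>" "\<beta> \<le> \<beta>'"
  shows "weakly_interacting n w \<beta>'"
  unfolding weakly_interacting_def
proof (intro conjI ballI allI)
  note b = weakly_interacting_nonneg[OF assms(1)]
  then show "0 \<le> \<beta>'" using assms(2) by simp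
  fix x assume s: "x \<in> cube n"
  show "0 < w x" by (rule weakly_interacting_pos[OF assms(1) s])
  fix q :: "nat \<Rightarrow> real"
  have "(\<Sum>i<n. (\<Sum>j<n. interaction w x i j * q j)\<^sup>2) \<le> \<beta>\<^sup>2 * (\<Sum>j<n. (q j)\<^sup>2)"
    by (rule weakly_interacting_norm[OF assms(1) s])
  also have "\<dots> \<le> \<beta>'\<^sup>2 * (\<Sum>j<n. (q j)\<^sup>2)"
    using b assms(2) by (intro mult_right_mono power_mono sum_nonneg) auto
  finally show "(\<Sum>i<n. (\<Sum>j<n. interaction w x i j * q j)\<^sup>2) \<le> \<beta>'\<^sup>2 * (\<Sum>j<n. (q j)\<^sup>2)" .
qed

lemma interaction_sym: "interaction w x i j = interaction w x j i"
  by (simp add: interaction_def flip_commute[of i j] mult.commute)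

text \<open>The columns of a matrix are the images of unit vectors. This is how the operator norm controls
  the sum of squared interactions of one spin with all others.\<close>

lemma interaction_column:
  assumes "weakly_interacting n w \<beta>" "x \<in> cube n" "j < n"
  shows "(\<Sum>i<n. (interaction w x i j)\<^sup>2) \<le> \<beta>\<^sup>2"
proof -
  have "(\<Sum>i<n. (\<Sum>k<n. interaction w x i k * (if k = j then 1 else 0))\<^sup>2)
      \<le> \<beta>\<^sup>2 * (\<Sum>k<n. (if k = j then 1 else 0)\<^sup>2)"
    by (rule weakly_interacting_norm[OF assms(1,2)])
  moreover have "(\<Sum>k<n. interaction w x i k * (if k = j then 1 else 0)) = interaction w x i j" for i
    using assms(3) by (simp add: if_distrib cong: if_cong)
  moreover have "(\<Sum>k<n. (if k = j then 1 else 0 :: real)\<^sup>2) = 1"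
    using assms(3) by (simp add: if_distrib[of "\<lambda>x. x\<^sup>2"] cong: if_cong)
  ultimately show ?thesis by simp
qed

lemma interaction_entry:
  assumes "weakly_interacting n w \<beta>" "x \<in> cube n" "i < n" "j < n"
  shows "\<bar>interaction w x i j\<bar> \<le> \<beta>"
proof -
  have "(interaction w x i j)\<^sup>2 \<le> (\<Sum>i<n. (interaction w x i j)\<^sup>2)"
    using assms(3) by (intro member_le_sum) auto
  also have "\<dots> \<le> \<beta>\<^sup>2" using interaction_column[OF assms(1,2,4)] .
  finally show ?thesis using assms(1) abs_le_square_iff[of "interaction w x i j" \<beta>]
    by (simp add: weakly_interacting_def)
qed

lemma interaction_form:
  assumes "weakly_interacting n w \<beta>" "x \<in> cube n"
  shows "(\<Sum>i<n. \<Sum>j<n. interaction w x i j * (q i * q j)) \<le> \<beta> * (\<Sum>i<n. (q i)\<^sup>2)"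
proof -
  let ?S = "\<Sum>i<n. (q i)\<^sup>2" and ?r = "\<lambda>i. \<Sum>j<n. interaction w x i j * q j"
  have "(\<Sum>i<n. q i * ?r i)\<^sup>2 \<le> ?S * (\<Sum>i<n. (?r i)\<^sup>2)" by (rule Cauchy_Schwarz_ineq_sum)
  also have "\<dots> \<le> ?S * (\<beta>\<^sup>2 * ?S)"
    by (intro mult_left_mono weakly_interacting_norm[OF assms]) (auto intro: sum_nonneg)
  also have "\<dots> = (\<beta> * ?S)\<^sup>2" by (simp add: power2_eq_square)
  finally have "(\<Sum>i<n. q i * ?r i) \<le> \<beta> * ?S"
  proof (rule power2_le_imp_le)
    show "0 \<le> \<beta> * ?S"
      using assms(1) unfolding weakly_interacting_def by (intro mult_nonneg_nonneg sum_nonneg) auto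
  qed
  moreover have "(\<Sum>i<n. q i * ?r i) = (\<Sum>i<n. \<Sum>j<n. interaction w x i j * (q i * q j))"
    by (simp add: sum_distrib_left mult_ac)
  ultimately show ?thesis by simp
qed

text \<open>The terms of first order keep their signs here. Bounding them by absolute values would replace
  the operator norm of the Hessian by that of its entrywise absolute value.\<close>

lemma two_site_correlation:
  fixes f :: "(nat \<Rightarrow> real) \<Rightarrow> real"
  assumes pos: "\<And>x. x \<in> cube n \<Longrightarrow> 0 < w x"
    and small: "\<And>x. x \<in> cube n \<Longrightarrow> \<bar>interaction w x i j\<bar> \<le> 1/32"
    and ij: "i < n" "j < n" "i \<noteq> j"
  defines "Q \<equiv> \<lambda>i. cond_dev w i f"
  shows "(\<Sum>x\<in>cube n. w x * (Q i x * Q j x))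
    \<ge> - (\<Sum>x\<in>cube n. w x * (interaction w x i j * (Q i x * Q j x)))
      - 1500 * (\<Sum>x\<in>cube n. w x * ((interaction w x i j)\<^sup>2 * ((Q i x)\<^sup>2 + (Q j x)\<^sup>2)))"
proof -
  define T where "T = (\<lambda>x. interaction w x i j)"
  define \<Phi> where "\<Phi> x = w x * (Q i x * Q j x) + T x * (w x * (Q i x * Q j x))
     + 1500 * ((T x)\<^sup>2 * (w x * ((Q i x)\<^sup>2 + (Q j x)\<^sup>2)))" for x
  (* The orbit of a point under the two flips is the two-spin system with the others frozen; the
     interaction changes sign under each flip. *)
  have orbit: "\<Phi> x + \<Phi> (flip i x) + (\<Phi> (flip j x) + \<Phi> (flip i (flip j x))) \<ge> 0" if s: "x \<in> cube n" for x
  proof -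
    have c1: "flip j (flip i x) = flip i (flip j x)" by (rule flip_commute)
    have c2: "flip j (flip i (flip j x)) = flip i x" by (simp add: flip_commute[of j i])
    define a b c d where "a = w x" and "b = w (flip j x)" and "c = w (flip i x)"
      and "d = w (flip i (flip j x))"
    define f0 fi fj fij where "f0 = f x" and "fi = f (flip i x)" and "fj = f (flip j x)"
      and "fij = f (flip i (flip j x))"
    have p: "a > 0" "b > 0" "c > 0" "d > 0"
      unfolding a_def b_def c_def d_def using pos s ij by auto
    have T0: "T x = ln (a * d / (b * c)) / 4"
      using ij by (simp add: T_def interaction_def a_def b_def c_def d_def)
    have Ti: "T (flip i x) = - T x"
    proof -
      have "T (flip i x) = ln (c * b / (d * a)) / 4"
        using ij by (simp add: T_def interaction_def a_def b_def c_def d_def c1)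
      then show ?thesis unfolding T0 using p by (simp add: ln_div ln_mult field_simps)
    qed
    have Tj: "T (flip j x) = - T x"
    proof -
      have "T (flip j x) = ln (b * c / (a * d)) / 4"
        using ij by (simp add: T_def interaction_def a_def b_def c_def d_def)
      then show ?thesis unfolding T0 using p by (simp add: ln_div ln_mult field_simps)
    qed
    have Tij: "T (flip i (flip j x)) = T x"
    proof -
      have "T (flip i (flip j x)) = ln (d * a / (c * b)) / 4"
        using ij by (simp add: T_def interaction_def a_def b_def c_def d_def c2)
      then show ?thesis unfolding T0 by (simp add: mult.commute)
    qed
    have qs: "Q i x = c * (f0 - fi) / (a + c)" "Q i (flip i x) = a * (fi - f0) / (c + a)"
      "Q i (flip j x) = d * (fj - fij) / (b + d)" "Q i (flip i (flip j x)) = b * (fij - fj) / (d + b)"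
      "Q j x = b * (f0 - fj) / (a + b)" "Q j (flip j x) = a * (fj - f0) / (b + a)"
      "Q j (flip i x) = d * (fi - fij) / (c + d)" "Q j (flip i (flip j x)) = c * (fij - fi) / (d + c)"
      by (simp_all add: Q_def cond_dev_def a_def b_def c_def d_def f0_def fi_def fj_def fij_def c1 c2)
    have T1: "\<bar>T x\<bar> \<le> 1/32" using small s by (simp add: T_def)
    show ?thesis
      using four_point_inequality[OF p T0 T1, of f0 fi fj fij]
      unfolding qs[symmetric]
      unfolding \<Phi>_def Ti Tj Tij a_def[symmetric] b_def[symmetric] c_def[symmetric] d_def[symmetric]
      by (simp add: algebra_simps)
  qed
  have "0 \<le> (\<Sum>x\<in>cube n. \<Phi> x + \<Phi> (flip i x) + (\<Phi> (flip j x) + \<Phi> (flip i (flip j x))))"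
    by (intro sum_nonneg orbit)
  also have "\<dots> = (\<Sum>x\<in>cube n. \<Phi> x) + (\<Sum>x\<in>cube n. \<Phi> (flip i x))
      + ((\<Sum>x\<in>cube n. \<Phi> (flip j x)) + (\<Sum>x\<in>cube n. \<Phi> (flip i (flip j x))))"
    by (simp add: sum.distrib)
  also have "\<dots> = 4 * (\<Sum>x\<in>cube n. \<Phi> x)"
    using sum_flip[OF ij(1), of \<Phi>] sum_flip[OF ij(2), of \<Phi>] sum_flip[OF ij(2), of "\<lambda>x. \<Phi> (flip i x)"]
    by simp
  finally have "0 \<le> (\<Sum>x\<in>cube n. \<Phi> x)" by simp
  also have "\<dots> = (\<Sum>x\<in>cube n. w x * (Q i x * Q j x)) + (\<Sum>x\<in>cube n. w x * (T x * (Q i x * Q j x)))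
    + 1500 * (\<Sum>x\<in>cube n. w x * ((T x)\<^sup>2 * ((Q i x)\<^sup>2 + (Q j x)\<^sup>2)))"
    unfolding \<Phi>_def by (simp add: sum.distrib sum_distrib_left mult_ac)
  finally show ?thesis unfolding T_def by simp
qed

text \<open>This is \<open>n\<close> times the Dirichlet form of the Glauber dynamics if \<open>w\<close> is a probability
  (\<open>dirichlet_form_eq\<close>). The weight is not normalised because tilts of a probability are used.\<close>

definition dirichlet :: "nat \<Rightarrow> ((nat \<Rightarrow> real) \<Rightarrow> real) \<Rightarrow> ((nat \<Rightarrow> real) \<Rightarrow> real) \<Rightarrow> real" where
  "dirichlet n w f = (\<Sum>x\<in>cube n. w x * (\<Sum>i<n. (cond_dev w i f x)\<^sup>2))"

text \<open>The generator of the dynamics in which each spin is resampled at rate one, with the sign that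
  makes it positive.\<close>

definition generator :: "nat \<Rightarrow> ((nat \<Rightarrow> real) \<Rightarrow> real) \<Rightarrow> ((nat \<Rightarrow> real) \<Rightarrow> real) \<Rightarrow> (nat \<Rightarrow> real) \<Rightarrow> real" where
  "generator n w f x = (\<Sum>i<n. cond_dev w i f x)"

lemma bochner_inequality:
  assumes wi: "weakly_interacting n w \<beta>" and b: "\<beta> \<le> 1/3000"
  shows "(1 - 2 * \<beta>) * dirichlet n w f \<le> (\<Sum>x\<in>cube n. w x * (generator n w f x)\<^sup>2)"
proof -
  define Q where "Q = (\<lambda>i. cond_dev w i f)"
  define T where "T = interaction w"
  define s where "s x = (\<Sum>i<n. (Q i x)\<^sup>2)" for x
  note pos = weakly_interacting_pos[OF wi]
  note b0 = weakly_interacting_nonneg[OF wi]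
  have D: "dirichlet n w f = (\<Sum>x\<in>cube n. w x * s x)"
    by (simp add: dirichlet_def Q_def s_def)
  have D0: "0 \<le> (\<Sum>x\<in>cube n. w x * s x)"
    using pos by (auto intro!: sum_nonneg mult_nonneg_nonneg simp: s_def less_imp_le)
  have pair: "(\<Sum>x\<in>cube n. w x * (if i = j then 0 else Q i x * Q j x))
    \<ge> (\<Sum>x\<in>cube n. w x * (- (T x i j * (Q i x * Q j x))
          - 1500 * ((T x i j)\<^sup>2 * ((Q i x)\<^sup>2 + (Q j x)\<^sup>2))))" if "i < n" "j < n" for i j
  proof (cases "i = j")
    case True
    then show ?thesis by (simp add: T_def interaction_def)
  next
    case False
    have "\<bar>interaction w x i j\<bar> \<le> 1/32" if "x \<in> cube n" for x
      using interaction_entry[OF wi that \<open>i < n\<close> \<open>j < n\<close>] b by linarith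
    from two_site_correlation[OF pos this \<open>i < n\<close> \<open>j < n\<close> False, of f]
    moreover have "(\<Sum>x\<in>cube n. w x * (- A x - 1500 * B x))
        = - (\<Sum>x\<in>cube n. w x * A x) - 1500 * (\<Sum>x\<in>cube n. w x * B x)" for A B
      unfolding sum_negf[symmetric] sum_distrib_left sum_subtractf[symmetric]
      by (intro sum.cong) (simp_all add: algebra_simps)
    ultimately show ?thesis using False unfolding Q_def T_def by simp
  qed
  (* The quadratic errors of all pairs are summed by rows and by columns, which gives 3000 beta^2;
     the bound on beta makes this at most beta. *)
  have point: "(\<Sum>i<n. \<Sum>j<n. - (T x i j * (Q i x * Q j x))
          - 1500 * ((T x i j)\<^sup>2 * ((Q i x)\<^sup>2 + (Q j x)\<^sup>2))) \<ge> - 2 * \<beta> * s x" 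
    if "x \<in> cube n" for x
  proof -
    have rows: "(\<Sum>i<n. \<Sum>j<n. (T x i j)\<^sup>2 * (Q j x)\<^sup>2) \<le> \<beta>\<^sup>2 * s x"
    proof -
      have "(\<Sum>i<n. \<Sum>j<n. (T x i j)\<^sup>2 * (Q j x)\<^sup>2) = (\<Sum>j<n. (\<Sum>i<n. (T x i j)\<^sup>2) * (Q j x)\<^sup>2)"
        by (subst sum.swap) (simp add: sum_distrib_right)
      also have "\<dots> \<le> (\<Sum>j<n. \<beta>\<^sup>2 * (Q j x)\<^sup>2)"
        using interaction_column[OF wi that] by (auto intro!: sum_mono mult_right_mono simp: T_def)
      finally show ?thesis by (simp add: s_def sum_distrib_left)
    qed
    have cols: "(\<Sum>i<n. \<Sum>j<n. (T x i j)\<^sup>2 * (Q i x)\<^sup>2) \<le> \<beta>\<^sup>2 * s x"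
    proof -
      have "T x i j = T x j i" for i j by (simp add: T_def interaction_sym)
      then have "(\<Sum>i<n. \<Sum>j<n. (T x i j)\<^sup>2 * (Q i x)\<^sup>2) = (\<Sum>i<n. \<Sum>j<n. (T x i j)\<^sup>2 * (Q j x)\<^sup>2)"
        by (subst sum.swap) simp
      then show ?thesis using rows by simp
    qed
    have form: "(\<Sum>i<n. \<Sum>j<n. T x i j * (Q i x * Q j x)) \<le> \<beta> * s x"
      unfolding T_def s_def by (rule interaction_form[OF wi that])
    have "\<beta>\<^sup>2 \<le> \<beta> / 3000" using mult_left_mono[OF b b0] by (simp add: power2_eq_square)
    moreover have "0 \<le> s x" by (simp add: s_def sum_nonneg)
    ultimately have "\<beta>\<^sup>2 * s x \<le> \<beta> / 3000 * s x" by (rule mult_right_mono)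
    then show ?thesis using rows cols form
      by (simp add: sum_subtractf sum_negf sum.distrib distrib_left flip: sum_distrib_left)
  qed
  have "(\<Sum>x\<in>cube n. w x * (generator n w f x)\<^sup>2)
     = (\<Sum>x\<in>cube n. w x * (\<Sum>i<n. \<Sum>j<n. Q i x * Q j x))"
    by (simp add: generator_def Q_def power2_eq_square sum_product)
  also have "\<dots> = (\<Sum>x\<in>cube n. w x * (s x + (\<Sum>i<n. \<Sum>j<n. if i = j then 0 else Q i x * Q j x)))"
  proof (intro sum.cong refl arg_cong2[of _ _ _ _ "(*)"])
    fix x
    have "(\<Sum>i<n. \<Sum>j<n. Q i x * Q j x) = (\<Sum>i<n. \<Sum>j<n. (if i = j then (Q i x)\<^sup>2 else 0) 
         + (if i = j then 0 else Q i x * Q j x))"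
      by (intro sum.cong refl) (auto simp: power2_eq_square)
    then show "(\<Sum>i<n. \<Sum>j<n. Q i x * Q j x) = s x + (\<Sum>i<n. \<Sum>j<n. if i = j then 0 else Q i x * Q j x)"
      by (simp add: sum.distrib s_def)
  qed
  also have "\<dots> = (\<Sum>x\<in>cube n. w x * s x)
      + (\<Sum>i<n. \<Sum>j<n. \<Sum>x\<in>cube n. w x * (if i = j then 0 else Q i x * Q j x))"
    apply (simp only: distrib_left sum.distrib sum_distrib_left)
    apply (subst sum.swap[of _ "{..<n}" "cube n"])
    apply (subst sum.swap[of _ "{..<n}" "cube n"])
    apply simp
    done
  also have "\<dots> \<ge> (\<Sum>x\<in>cube n. w x * s x)
      + (\<Sum>i<n. \<Sum>j<n. \<Sum>x\<in>cube n. w x * (- (T x i j * (Q i x * Q j x))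
          - 1500 * ((T x i j)\<^sup>2 * ((Q i x)\<^sup>2 + (Q j x)\<^sup>2))))" (is "_ \<ge> ?R")
    by (intro add_left_mono sum_mono pair) auto
  also have "?R = (\<Sum>x\<in>cube n. w x * s x)
      + (\<Sum>x\<in>cube n. w x * (\<Sum>i<n. \<Sum>j<n. (- (T x i j * (Q i x * Q j x))
          - 1500 * ((T x i j)\<^sup>2 * ((Q i x)\<^sup>2 + (Q j x)\<^sup>2)))))"
    apply (simp only: sum_distrib_left)
    apply (subst sum.swap[of _ "{..<n}" "cube n"])
    apply (subst sum.swap[of _ "{..<n}" "cube n"])
    apply simp
    done
  also have "\<dots> \<ge> (\<Sum>x\<in>cube n. w x * s x) + (\<Sum>x\<in>cube n. w x * (- 2 * \<beta> * s x))" (is "_ \<ge> ?R'")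
    by (intro add_left_mono sum_mono mult_left_mono point) (auto simp: pos less_imp_le)
  also have "?R' = (1 - 2 * \<beta>) * (\<Sum>x\<in>cube n. w x * s x)"
    unfolding sum.distrib[symmetric] sum_distrib_left by (intro sum.cong) (simp_all add: algebra_simps)
  finally show ?thesis unfolding D by simp
qed

section \<open>The Poincare inequality\<close>

lemma cond_dev_diff: "cond_dev w i (\<lambda>x. f x - e * g x) x = cond_dev w i f x - e * cond_dev w i g x"
proof -
  have "w (flip i x) * (f x - e * g x - (f (flip i x) - e * g (flip i x)))
      = w (flip i x) * (f x - f (flip i x)) - e * (w (flip i x) * (g x - g (flip i x)))"
    by (simp add: algebra_simps)
  then show ?thesis by (simp add: cond_dev_def diff_divide_distrib)
qed

lemma cond_dev_flip:
  "cond_dev w i f (flip i x) = - (w x * (f x - f (flip i x)) / (w x + w (flip i x)))"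
proof -
  have "w x * (f (flip i x) - f x) = - (w x * (f x - f (flip i x)))" by (simp add: algebra_simps)
  then show ?thesis by (simp add: cond_dev_def add.commute)
qed

text \<open>The map \<open>f \<mapsto> Q\<^sub>i f\<close> is an orthogonal projection in the space weighted by \<open>w\<close>.\<close>

lemma cond_dev_selfadjoint:
  assumes pos: "\<forall>x\<in>cube n. 0 < w x" and i: "i < n"
  shows "(\<Sum>x\<in>cube n. w x * (g x * cond_dev w i f x))
    = (\<Sum>x\<in>cube n. w x * (cond_dev w i g x * cond_dev w i f x))"
proof -
  let ?L = "\<lambda>x. w x * (g x * cond_dev w i f x)"
  let ?R = "\<lambda>x. w x * (cond_dev w i g x * cond_dev w i f x)"
  have "?L x + ?L (flip i x) = ?R x + ?R (flip i x)" if "x \<in> cube n" for x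
  proof -
    define a b where "a = w x" and "b = w (flip i x)"
    define u v where "u = f x - f (flip i x)" and "v = g x - g (flip i x)"
    have p: "a > 0" "b > 0" using pos that i by (auto simp: a_def b_def)
    have f: "cond_dev w i f x = b * u / (a + b)" "cond_dev w i f (flip i x) = - (a * u / (a + b))"
      by (simp_all add: cond_dev_flip a_def b_def u_def) (simp add: cond_dev_def)
    have g: "cond_dev w i g x = b * v / (a + b)" "cond_dev w i g (flip i x) = - (a * v / (a + b))"
      by (simp_all add: cond_dev_flip a_def b_def v_def) (simp add: cond_dev_def)
    have "?L x + ?L (flip i x) = a * b * u * v / (a + b)"
      unfolding f a_def[symmetric] b_def[symmetric] v_def
      by (simp add: diff_divide_distrib right_diff_distrib mult_ac)
    moreover have "?R x + ?R (flip i x) = a * b * u * v * (a + b) / ((a + b) * (a + b))"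
      unfolding f g a_def[symmetric] b_def[symmetric]
      by (simp add: add_divide_distrib distrib_left mult_ac)
    moreover have "a * b * u * v * (a + b) / ((a + b) * (a + b)) = a * b * u * v / (a + b)"
      using p by simp
    ultimately show ?thesis by simp
  qed
  then show ?thesis
    unfolding sum_flip_average[OF i, of ?L] sum_flip_average[OF i, of ?R] by simp
qed

lemma cond_dev_contraction:
  assumes pos: "\<forall>x\<in>cube n. 0 < w x" and i: "i < n"
  shows "(\<Sum>x\<in>cube n. w x * (cond_dev w i f x)\<^sup>2) \<le> (\<Sum>x\<in>cube n. w x * (f x)\<^sup>2)"
proof -
  have "0 \<le> (\<Sum>x\<in>cube n. w x * (f x - cond_dev w i f x)\<^sup>2)"
    using pos by (intro sum_nonneg mult_nonneg_nonneg) (auto simp: less_imp_le)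
  also have "\<dots> = (\<Sum>x\<in>cube n. w x * (f x)\<^sup>2) - 2 * (\<Sum>x\<in>cube n. w x * (f x * cond_dev w i f x))
      + (\<Sum>x\<in>cube n. w x * (cond_dev w i f x * cond_dev w i f x))"
    unfolding sum_distrib_left sum_subtractf[symmetric] sum.distrib[symmetric]
    by (intro sum.cong) (simp_all add: power2_eq_square algebra_simps)
  also have "(\<Sum>x\<in>cube n. w x * (f x * cond_dev w i f x)) 
     = (\<Sum>x\<in>cube n. w x * (cond_dev w i f x * cond_dev w i f x))"
    by (rule cond_dev_selfadjoint[OF pos i])
  finally show ?thesis by (simp add: power2_eq_square)
qed

lemma dirichlet_eq_sum:
  "dirichlet n w f = (\<Sum>i<n. \<Sum>x\<in>cube n. w x * (cond_dev w i f x)\<^sup>2)"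
  unfolding dirichlet_def sum_distrib_left by (rule sum.swap)

lemma dirichlet_nonneg:
  assumes pos: "\<forall>x\<in>cube n. 0 < w x"
  shows "0 \<le> dirichlet n w f"
  unfolding dirichlet_def using pos by (intro sum_nonneg mult_nonneg_nonneg) (auto simp: less_imp_le)

lemma dirichlet_le:
  assumes pos: "\<forall>x\<in>cube n. 0 < w x"
  shows "dirichlet n w f \<le> real n * (\<Sum>x\<in>cube n. w x * (f x)\<^sup>2)"
proof -
  have "dirichlet n w f \<le> (\<Sum>i<n. \<Sum>x\<in>cube n. w x * (f x)\<^sup>2)"
    unfolding dirichlet_eq_sum by (intro sum_mono cond_dev_contraction pos) auto
  then show ?thesis by simp
qed

lemma dirichlet_generator:
  assumes pos: "\<forall>x\<in>cube n. 0 < w x"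
  shows "(\<Sum>x\<in>cube n. w x * (g x * generator n w f x))
    = (\<Sum>i<n. \<Sum>x\<in>cube n. w x * (cond_dev w i g x * cond_dev w i f x))"
proof -
  have "(\<Sum>x\<in>cube n. w x * (g x * generator n w f x))
    = (\<Sum>i<n. \<Sum>x\<in>cube n. w x * (g x * cond_dev w i f x))"
    unfolding generator_def sum_distrib_left by (rule sum.swap)
  also have "\<dots> = (\<Sum>i<n. \<Sum>x\<in>cube n. w x * (cond_dev w i g x * cond_dev w i f x))"
    by (intro sum.cong refl cond_dev_selfadjoint pos) auto
  finally show ?thesis .
qed

definition wvar :: "nat \<Rightarrow> ((nat \<Rightarrow> real) \<Rightarrow> real) \<Rightarrow> ((nat \<Rightarrow> real) \<Rightarrow> real) \<Rightarrow> real" where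
  "wvar n w f = (\<Sum>x\<in>cube n. w x * (f x)\<^sup>2) - (\<Sum>x\<in>cube n. w x * f x)\<^sup>2 / (\<Sum>x\<in>cube n. w x)"

lemma weight_total_pos:
  assumes pos: "\<forall>x\<in>cube n. 0 < w x"
  shows "0 < (\<Sum>x\<in>cube n. w x :: real)"
  using pos cube_nonempty by (intro sum_pos) auto

lemma wvar_le_centered:
  assumes pos: "\<forall>x\<in>cube n. 0 < w x"
  shows "wvar n w f \<le> (\<Sum>x\<in>cube n. w x * (f x - c)\<^sup>2)"
proof -
  define W S where "W = (\<Sum>x\<in>cube n. w x)" and "S = (\<Sum>x\<in>cube n. w x * f x)"
  have W: "W > 0" unfolding W_def by (rule weight_total_pos[OF pos])
  have "(\<Sum>x\<in>cube n. w x * (f x - c)\<^sup>2) = (\<Sum>x\<in>cube n. w x * (f x)\<^sup>2) - 2 * c * S + c\<^sup>2 * W"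
    unfolding S_def W_def sum_distrib_left sum_subtractf[symmetric] sum.distrib[symmetric]
    by (intro sum.cong) (simp_all add: power2_eq_square algebra_simps)
  moreover have "0 \<le> (S - c * W)\<^sup>2 / W" using W by simp
  moreover have "(S - c * W)\<^sup>2 / W = S\<^sup>2 / W - 2 * c * S + c\<^sup>2 * W"
    using W by (simp add: power2_eq_square field_simps)
  ultimately show ?thesis unfolding wvar_def W_def[symmetric] S_def[symmetric] by linarith
qed

text \<open>Any finite constant serves as the starting point for the improvement that follows.\<close>

lemma crude_poincare:
  assumes pos: "\<forall>x\<in>cube n. 0 < w x"
  shows "\<exists>C\<ge>0. \<forall>f. wvar n w f \<le> C * dirichlet n w f"
proof -
  define r where "r = (\<lambda>(x, i). w x * (w (flip i x) / (w x + w (flip i x)))\<^sup>2)"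
  define c where "c = Min (insert 1 (r ` (cube n \<times> {..<n})))"
  have rpos: "r p > 0" if "p \<in> cube n \<times> {..<n}" for p
  proof -
    obtain x i where p: "p = (x, i)" "x \<in> cube n" "i < n" using \<open>p \<in> _\<close> by auto
    then have "w x > 0" "w (flip i x) > 0" using pos by auto
    then show ?thesis by (simp add: p r_def)
  qed
  have c: "c > 0" unfolding c_def using rpos by (subst Min_gr_iff) auto
  have cle: "c \<le> r (x, i)" if "x \<in> cube n" "i < n" for x i
    unfolding c_def using that by (intro Min_le) auto
  obtain \<tau> where \<tau>: "\<tau> \<in> cube n" using cube_nonempty by blast
  define W where "W = (\<Sum>x\<in>cube n. w x)"
  have W: "W > 0" unfolding W_def by (rule weight_total_pos[OF pos])
  (* Any two points are joined by at most n flips, and each flip moves f by at most M. *)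
  have "wvar n w f \<le> (W * (real n)\<^sup>2 / c) * dirichlet n w f" for f
  proof -
    define M where "M = sqrt (dirichlet n w f / c)"
    have D0: "0 \<le> dirichlet n w f" by (rule dirichlet_nonneg[OF pos])
    have M0: "0 \<le> M" using D0 c by (simp add: M_def)
    have edge: "\<bar>f x - f (flip i x)\<bar> \<le> M" if s: "x \<in> cube n" "i < n" for x i
    proof -
      have "c * (f x - f (flip i x))\<^sup>2 \<le> r (x, i) * (f x - f (flip i x))\<^sup>2"
        using cle s by (intro mult_right_mono) auto
      also have "\<dots> = w x * (cond_dev w i f x)\<^sup>2"
        by (simp add: r_def cond_dev_def power_divide power_mult_distrib)
      also have "\<dots> \<le> (\<Sum>x\<in>cube n. w x * (cond_dev w i f x)\<^sup>2)"
        using s pos by (intro member_le_sum) (auto simp: less_imp_le)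
      also have "\<dots> \<le> dirichlet n w f" unfolding dirichlet_eq_sum
        using s pos by (intro member_le_sum[of i]) (auto intro!: sum_nonneg mult_nonneg_nonneg simp: less_imp_le)
      finally have "(f x - f (flip i x))\<^sup>2 \<le> dirichlet n w f / c"
        using c by (simp add: pos_le_divide_eq mult.commute)
      then show ?thesis unfolding M_def by (rule real_le_rsqrt[of "\<bar>_\<bar>", simplified])
    qed
    have diff: "\<bar>f x - f \<tau>\<bar> \<le> real n * M" if s: "x \<in> cube n" for x
    proof -
      obtain h where h: "h 0 = x" "h n = \<tau>" "\<And>k. h k \<in> cube n"
        "\<And>k. k < n \<Longrightarrow> h (Suc k) = h k \<or> h (Suc k) = flip k (h k)"
        using cube_path[OF s \<tau>] by blast
      have step: "\<bar>f (h k) - f (h (Suc k))\<bar> \<le> M" if "k < n" for k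
        using h(4)[OF that] edge[OF h(3) that, of k] M0 by auto
      have "\<bar>f x - f (h k)\<bar> \<le> real k * M" if "k \<le> n" for k
        using that
      proof (induction k)
        case 0
        then show ?case by (simp add: h(1))
      next
        case (Suc k)
        then have "\<bar>f x - f (h k)\<bar> \<le> real k * M" "\<bar>f (h k) - f (h (Suc k))\<bar> \<le> M"
          using step by auto
        then show ?case by (simp add: algebra_simps)
      qed
      from this[of n] show ?thesis by (simp add: h(2))
    qed
    have "wvar n w f \<le> (\<Sum>x\<in>cube n. w x * (f x - f \<tau>)\<^sup>2)" by (rule wvar_le_centered[OF pos])
    also have "\<dots> \<le> (\<Sum>x\<in>cube n. w x * (real n * M)\<^sup>2)"
      using diff M0 pos by (intro sum_mono mult_left_mono) (auto simp: less_imp_le abs_le_square_iff[symmetric])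
    also have "\<dots> = W * (real n)\<^sup>2 * M\<^sup>2" by (simp add: W_def sum_distrib_right[symmetric] power_mult_distrib)
    also have "M\<^sup>2 = dirichlet n w f / c" using D0 c by (simp add: M_def)
    finally show ?thesis by simp
  qed
  then show ?thesis using W c by (intro exI[of _ "W * (real n)\<^sup>2 / c"]) auto
qed

text \<open>One step \<open>f - e L f\<close> of the heat flow of the generator. The variance drops by at most \<open>2 e \<langle>f, L f\<rangle>\<close>,
  while the Dirichlet form drops by almost \<open>2 e \<parallel>L f\<parallel>\<^sup>2\<close>; a Poincare inequality after the step thus
  gives another one before it, with a new constant.\<close>

lemma poincare_step:
  assumes pos: "\<forall>x\<in>cube n. 0 < w x"
    and bochner: "\<And>f. k * dirichlet n w f \<le> (\<Sum>x\<in>cube n. w x * (generator n w f x)\<^sup>2)"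
    and C: "0 \<le> C" "\<And>f. wvar n w f \<le> C * dirichlet n w f"
    and e: "0 \<le> e" "real n * e \<le> 2"
  shows "wvar n w f \<le> (C + 2 * e - C * (2 * e - real n * e\<^sup>2) * k) * dirichlet n w f"
proof -
  define g where "g = generator n w f"
  define f1 where "f1 = (\<lambda>x. f x - e * g x)"
  define G where "G = (\<Sum>x\<in>cube n. w x * (g x)\<^sup>2)"
  have G0: "0 \<le> G" unfolding G_def using pos by (auto intro!: sum_nonneg mult_nonneg_nonneg simp: less_imp_le)
  have fg: "(\<Sum>x\<in>cube n. w x * (f x * g x)) = dirichlet n w f"
    unfolding g_def dirichlet_generator[OF pos] dirichlet_eq_sum by (simp add: power2_eq_square)
  have gg: "(\<Sum>i<n. \<Sum>x\<in>cube n. w x * (cond_dev w i g x * cond_dev w i f x)) = G"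
    unfolding G_def using dirichlet_generator[OF pos, of g f] by (simp add: g_def power2_eq_square)
  have mean0: "(\<Sum>x\<in>cube n. w x * g x) = 0"
    using dirichlet_generator[OF pos, of "\<lambda>_. 1" f] by (simp add: g_def cond_dev_def)
  have "(\<Sum>x\<in>cube n. w x * (f1 x)\<^sup>2) = (\<Sum>x\<in>cube n. w x * (f x)\<^sup>2) - 2 * e * dirichlet n w f + e\<^sup>2 * G"
    unfolding fg[symmetric] G_def sum_distrib_left sum_subtractf[symmetric] sum.distrib[symmetric] f1_def
    by (intro sum.cong) (simp_all add: power2_eq_square algebra_simps)
  moreover have "(\<Sum>x\<in>cube n. w x * f1 x) = (\<Sum>x\<in>cube n. w x * f x)"
  proof -
    have "(\<Sum>x\<in>cube n. w x * f1 x) = (\<Sum>x\<in>cube n. w x * f x) - e * (\<Sum>x\<in>cube n. w x * g x)"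
      unfolding sum_distrib_left sum_subtractf[symmetric] f1_def
      by (intro sum.cong) (simp_all add: algebra_simps)
    then show ?thesis by (simp add: mean0)
  qed
  ultimately have V: "wvar n w f1 = wvar n w f - 2 * e * dirichlet n w f + e\<^sup>2 * G"
    by (simp add: wvar_def)
  have "dirichlet n w f1 = (\<Sum>i<n. \<Sum>x\<in>cube n. w x * (cond_dev w i f x - e * cond_dev w i g x)\<^sup>2)"
    unfolding dirichlet_eq_sum f1_def cond_dev_diff ..
  also have "\<dots> = dirichlet n w f - 2 * e * G + e\<^sup>2 * dirichlet n w g"
    unfolding gg[symmetric] dirichlet_eq_sum sum_distrib_left sum_subtractf[symmetric] sum.distrib[symmetric]
    by (intro sum.cong) (simp_all add: power2_eq_square algebra_simps)
  also have "\<dots> \<le> dirichlet n w f - 2 * e * G + e\<^sup>2 * (real n * G)"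
    unfolding G_def by (intro add_left_mono mult_left_mono dirichlet_le[OF pos]) auto
  also have "\<dots> = dirichlet n w f - (2 * e - real n * e\<^sup>2) * G" by (simp add: algebra_simps)
  also have "\<dots> \<le> dirichlet n w f - (2 * e - real n * e\<^sup>2) * (k * dirichlet n w f)"
  proof -
    have "0 \<le> e * (2 - real n * e)" using e by (intro mult_nonneg_nonneg) auto
    then have "0 \<le> 2 * e - real n * e\<^sup>2" by (simp add: algebra_simps power2_eq_square)
    then have "(2 * e - real n * e\<^sup>2) * (k * dirichlet n w f) \<le> (2 * e - real n * e\<^sup>2) * G"
      unfolding G_def g_def by (intro mult_left_mono bochner)
    then show ?thesis by simp
  qed
  finally have D: "dirichlet n w f1 \<le> dirichlet n w f - (2 * e - real n * e\<^sup>2) * (k * dirichlet n w f)" .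
  have "0 \<le> e\<^sup>2 * G" using G0 by simp
  then have "wvar n w f \<le> 2 * e * dirichlet n w f + wvar n w f1" unfolding V by linarith
  also have "\<dots> \<le> 2 * e * dirichlet n w f + C * dirichlet n w f1" using C(2) by simp
  also have "\<dots> \<le> 2 * e * dirichlet n w f + C * (dirichlet n w f - (2 * e - real n * e\<^sup>2) * (k * dirichlet n w f))"
    using D C(1) by (intro add_left_mono mult_left_mono)
  finally show ?thesis by (simp add: algebra_simps)
qed

text \<open>The best constant \<open>C\<close> cannot be improved by a step of the flow, which forces \<open>C k \<le> 1\<close>. This
  replaces the spectral theorem, in which \<open>k \<lambda> \<le> \<lambda>\<^sup>2\<close> holds for each eigenvalue \<open>\<lambda>\<close>.\<close>

theorem poincare_from_bochner:
  assumes pos: "\<forall>x\<in>cube n. 0 < w x" and k: "0 < k" and n: "0 < n"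
    and bochner: "\<And>f. k * dirichlet n w f \<le> (\<Sum>x\<in>cube n. w x * (generator n w f x)\<^sup>2)"
  shows "k * wvar n w f \<le> dirichlet n w f"
proof -
  define \<C> where "\<C> = {C. 0 \<le> C \<and> (\<forall>f. wvar n w f \<le> C * dirichlet n w f)}"
  define C where "C = Inf \<C>"
  note D0 = dirichlet_nonneg[OF pos]
  have ne: "\<C> \<noteq> {}" using crude_poincare[OF pos] by (auto simp: \<C>_def)
  have bdd: "bdd_below \<C>" by (intro bdd_belowI[of _ 0]) (auto simp: \<C>_def)
  have C0: "0 \<le> C" unfolding C_def using ne by (intro cInf_greatest) (auto simp: \<C>_def)
  have CD: "wvar n w g \<le> C * dirichlet n w g" for g
  proof (cases "dirichlet n w g = 0")
    case True
    obtain K where "K \<in> \<C>" using ne by blast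
    then show ?thesis using True by (auto simp: \<C>_def dest: spec[of _ g])
  next
    case False
    then have p: "dirichlet n w g > 0" using D0[of g] by simp
    have "wvar n w g / dirichlet n w g \<le> C"
      unfolding C_def using ne p by (intro cInf_greatest) (auto simp: \<C>_def pos_divide_le_eq)
    then show ?thesis using p by (simp add: pos_divide_le_eq)
  qed
  have "C * k \<le> 1"
  proof (rule ccontr)
    assume "\<not> C * k \<le> 1"
    then have Ck: "C * k > 1" by simp
    define r where "r = 1 / (C * k)"
    (* This step is short enough for the second-order loss n e^2 to stay below the gain. *)
    define e where "e = (1 - r) / real n"
    define C' where "C' = C + 2 * e - C * (2 * e - real n * e\<^sup>2) * k"
    have r: "0 < r" "r < 1" "C * k * r = 1" using Ck by (auto simp: r_def)
    have e: "0 < e" "real n * e = 1 - r" using r n by (auto simp: e_def)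
    have "max C' 0 \<in> \<C>"
    proof -
      have "wvar n w g \<le> max C' 0 * dirichlet n w g" for g
      proof -
        have "wvar n w g \<le> C' * dirichlet n w g"
          unfolding C'_def using e r by (intro poincare_step[OF pos bochner C0 CD]) auto
        also have "\<dots> \<le> max C' 0 * dirichlet n w g" using D0 by (intro mult_right_mono) auto
        finally show ?thesis .
      qed
      then show ?thesis by (auto simp: \<C>_def)
    qed
    then have "C \<le> max C' 0" unfolding C_def using bdd by (intro cInf_lower)
    moreover have "C > 0" using C0 Ck by (cases "C = 0") auto
    ultimately have "C \<le> C'" by (auto simp: max_def split: if_splits)
    moreover have "C' = C + e * (2 - C * k * (2 - real n * e))"
      by (simp add: C'_def algebra_simps power2_eq_square)
    ultimately have "0 \<le> e * (2 - C * k * (2 - real n * e))" by simp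
    then have "C * k * (1 + r) \<le> 2" using e by (simp add: zero_le_mult_iff)
    then show False using Ck r(3) by (simp add: distrib_left)
  qed
  then have "k * wvar n w f \<le> k * (C * dirichlet n w f)" using CD k by (intro mult_left_mono) auto
  also have "\<dots> = (C * k) * dirichlet n w f" by simp
  also have "\<dots> \<le> 1 * dirichlet n w f" using \<open>C * k \<le> 1\<close> D0 by (intro mult_right_mono)
  finally show ?thesis by simp
qed

theorem weakly_interacting_poincare:
  assumes "weakly_interacting n w \<beta>" "\<beta> \<le> 1/3000" "0 < n"
  shows "wvar n w f \<le> (1 + 4 * \<beta>) * dirichlet n w f"
proof -
  have pos: "\<forall>x\<in>cube n. 0 < w x" using weakly_interacting_pos[OF assms(1)] by blast
  note b = weakly_interacting_nonneg[OF assms(1)]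
  have k: "(1 - 2 * \<beta>) * wvar n w f \<le> dirichlet n w f"
    using assms by (intro poincare_from_bochner pos bochner_inequality) auto
  have "(1 + 4 * \<beta>) * (1 - 2 * \<beta>) \<ge> 1"
  proof -
    have "\<beta> * \<beta> \<le> \<beta> * (1/4)" using assms b by (intro mult_left_mono) auto
    then show ?thesis by (simp add: algebra_simps)
  qed
  moreover have "0 \<le> wvar n w f"
  proof -
    let ?W = "\<Sum>x\<in>cube n. w x"
    have W: "0 < ?W" by (rule weight_total_pos[OF pos])
    have "(\<Sum>x\<in>cube n. sqrt (w x) * (sqrt (w x) * f x))\<^sup>2
      \<le> (\<Sum>x\<in>cube n. (sqrt (w x))\<^sup>2) * (\<Sum>x\<in>cube n. (sqrt (w x) * f x)\<^sup>2)"
      by (rule Cauchy_Schwarz_ineq_sum)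
    then have "(\<Sum>x\<in>cube n. w x * f x)\<^sup>2 \<le> ?W * (\<Sum>x\<in>cube n. w x * (f x)\<^sup>2)"
      using pos by (simp add: power_mult_distrib less_imp_le mult.assoc[symmetric] cong: sum.cong)
    then show ?thesis using W by (simp add: wvar_def pos_divide_le_eq mult.commute)
  qed
  ultimately have "1 * wvar n w f \<le> (1 + 4 * \<beta>) * (1 - 2 * \<beta>) * wvar n w f" by (intro mult_right_mono)
  also have "\<dots> = (1 + 4 * \<beta>) * ((1 - 2 * \<beta>) * wvar n w f)" by simp
  also have "\<dots> \<le> (1 + 4 * \<beta>) * dirichlet n w f" using k b by (intro mult_left_mono) auto
  finally show ?thesis by simp
qed

section \<open>The Hessian of the multilinear extension\<close>

lemma fourier_inversion:
  assumes "x \<in> cube n"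
  shows "multilinear_ext n H x = H x"
proof -
  (* The sum over S factorises over the coordinates, and a factor vanishes where the points differ. *)
  have kernel: "(\<Sum>S\<in>Pow {..<n}. (\<Prod>i\<in>S. \<tau> i) * (\<Prod>i\<in>S. x i)) = (if \<tau> = x then 2 ^ n else 0)"
    if tc: "\<tau> \<in> cube n" for \<tau>
  proof -
    have "(\<Sum>S\<in>Pow {..<n}. (\<Prod>i\<in>S. \<tau> i) * (\<Prod>i\<in>S. x i)) = (\<Prod>i<n. \<tau> i * x i + 1)"
      by (subst prod_add) (simp_all add: prod.distrib)
    also have "\<dots> = (if \<tau> = x then 2 ^ n else 0)"
    proof (cases "\<tau> = x")
      case True
      then have "(\<Prod>i<n. \<tau> i * x i + 1) = (\<Prod>i<n. 2)"
        using cube_square[OF assms] by (intro prod.cong) auto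
      then show ?thesis using True by simp
    next
      case False
      then obtain i where i: "i < n" "\<tau> i \<noteq> x i" using cube_eqI[OF tc assms] by blast
      then have "\<tau> i * x i + 1 = 0" using cube_values[OF tc i(1)] cube_values[OF assms i(1)] by auto
      then show ?thesis using i False by (auto simp: prod_zero_iff)
    qed
    finally show ?thesis .
  qed
  have "multilinear_ext n H x
      = (\<Sum>S\<in>Pow {..<n}. \<Sum>\<tau>\<in>cube n. H \<tau> / 2 ^ n * ((\<Prod>i\<in>S. \<tau> i) * (\<Prod>i\<in>S. x i)))"
    unfolding multilinear_ext_def fourier_coeff_def
    by (intro sum.cong) (simp_all add: sum_divide_distrib sum_distrib_right mult.assoc)
  also have "\<dots> = (\<Sum>\<tau>\<in>cube n. H \<tau> / 2 ^ n * (\<Sum>S\<in>Pow {..<n}. (\<Prod>i\<in>S. \<tau> i) * (\<Prod>i\<in>S. x i)))"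
    unfolding sum_distrib_left by (rule sum.swap)
  also have "\<dots> = (\<Sum>\<tau>\<in>cube n. if \<tau> = x then H x else 0)"
    by (intro sum.cong) (auto simp: kernel)
  also have "\<dots> = H x" using assms by simp
  finally show ?thesis .
qed

text \<open>A multilinear polynomial is determined along each axis by its values at \<open>1\<close> and \<open>-1\<close>, so its
  partial derivatives are difference quotients between these points.\<close>

definition affine_in :: "nat \<Rightarrow> ((nat \<Rightarrow> real) \<Rightarrow> real) \<Rightarrow> bool" where
  "affine_in i F \<longleftrightarrow> (\<forall>x t. F (x(i := t)) = (1 + t) / 2 * F (x(i := 1)) + (1 - t) / 2 * F (x(i := -1)))"

lemma affine_inD:
  "affine_in i F \<Longrightarrow> F (x(i := t)) = (1 + t) / 2 * F (x(i := 1)) + (1 - t) / 2 * F (x(i := -1))"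
  unfolding affine_in_def by blast

lemma affine_in_multilinear_ext: "affine_in i (multilinear_ext n H)"
  unfolding affine_in_def
proof (intro allI)
  fix x :: "nat \<Rightarrow> real" and t :: real
  have "(\<Prod>k\<in>S. (x(i := t)) k) = (1 + t) / 2 * (\<Prod>k\<in>S. (x(i := 1)) k) + (1 - t) / 2 * (\<Prod>k\<in>S. (x(i := -1)) k)"
    if "finite S" for S
  proof (cases "i \<in> S")
    case True
    have "(\<Prod>k\<in>S. (x(i := t)) k) = t * (\<Prod>k\<in>S - {i}. x k)" for t
    proof -
      have "(\<Prod>k\<in>S - {i}. (x(i := t)) k) = (\<Prod>k\<in>S - {i}. x k)" by (intro prod.cong) auto
      then show ?thesis using prod.remove[OF that True, of "x(i := t)"] by simp
    qed
    then show ?thesis by (simp only:) (simp add: field_simps)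
  next
    case False
    then have "(\<Prod>k\<in>S. (x(i := t)) k) = (\<Prod>k\<in>S. x k)" for t by (intro prod.cong) auto
    then show ?thesis by (simp only:) (simp add: field_simps)
  qed
  note key = this
  have "multilinear_ext n H (x(i := t)) = (\<Sum>S\<in>Pow {..<n}. fourier_coeff n H S *
     ((1 + t) / 2 * (\<Prod>k\<in>S. (x(i := 1)) k) + (1 - t) / 2 * (\<Prod>k\<in>S. (x(i := -1)) k)))"
    unfolding multilinear_ext_def
    by (intro sum.cong refl arg_cong2[of _ _ _ _ "(*)"] key) (auto intro: finite_subset)
  also have "\<dots> = (1 + t) / 2 * multilinear_ext n H (x(i := 1)) + (1 - t) / 2 * multilinear_ext n H (x(i := -1))"
    unfolding multilinear_ext_def sum_distrib_left sum.distrib[symmetric]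
    by (intro sum.cong) (simp_all add: algebra_simps)
  finally show "multilinear_ext n H (x(i := t)) = (1 + t) / 2 * multilinear_ext n H (x(i := 1))
     + (1 - t) / 2 * multilinear_ext n H (x(i := -1))" .
qed

lemma partial_deriv_affine:
  assumes "affine_in i F"
  shows "partial_deriv i F x = (F (x(i := 1)) - F (x(i := -1))) / 2"
proof -
  have "(\<lambda>t. F (x(i := t))) = (\<lambda>t. (1 + t) / 2 * F (x(i := 1)) + (1 - t) / 2 * F (x(i := -1)))"
    using affine_inD[OF assms] by blast
  moreover have "((\<lambda>t. (1 + t) / 2 * F (x(i := 1)) + (1 - t) / 2 * F (x(i := -1)))
    has_real_derivative (F (x(i := 1)) - F (x(i := -1))) / 2) (at (x i))"
    by (auto intro!: derivative_eq_intros simp: field_simps)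
  ultimately show ?thesis unfolding partial_deriv_def by (simp add: DERIV_imp_deriv)
qed

lemma affine_in_partial_deriv:
  assumes "affine_in i F" "affine_in j F" "i \<noteq> j"
  shows "affine_in i (partial_deriv j F)"
  unfolding affine_in_def partial_deriv_affine[OF assms(2)]
proof (intro allI)
  fix x :: "nat \<Rightarrow> real" and t :: real
  have c: "x(i := s, j := u) = x(j := u, i := s)" for s u using assms(3) by (rule fun_upd_twist)
  show "(F (x(i := t, j := 1)) - F (x(i := t, j := - 1))) / 2 =
    (1 + t) / 2 * ((F (x(i := 1, j := 1)) - F (x(i := 1, j := - 1))) / 2)
     + (1 - t) / 2 * ((F (x(i := - 1, j := 1)) - F (x(i := - 1, j := - 1))) / 2)"
    unfolding c affine_inD[OF assms(1), of _ t] by (simp add: field_simps)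
qed

lemma partial_deriv_flip:
  assumes "affine_in i F" "x \<in> cube n" "i < n"
  shows "partial_deriv i F x = x i * (F x - F (flip i x)) / 2"
  using cube_values[OF assms(2,3)]
proof
  assume s: "x i = - 1"
  then have "x(i := -1) = x" "flip i x = x(i := 1)" by (auto simp: flip_def)
  then show ?thesis using s by (simp add: partial_deriv_affine[OF assms(1)])
next
  assume s: "x i = 1"
  then have "x(i := 1) = x" "flip i x = x(i := -1)" by (auto simp: flip_def)
  then show ?thesis using s by (simp add: partial_deriv_affine[OF assms(1)])
qed

lemma hessian_eq_interaction:
  assumes w: "\<And>x. x \<in> cube n \<Longrightarrow> w x = exp (H x) / Z" and Z: "Z > 0"
    and s: "x \<in> cube n" and ij: "i < n" "j < n"
  shows "hessian (multilinear_ext n H) x i j = x i * x j * interaction w x i j"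
proof (cases "i = j")
  case True
  have "(\<lambda>t. partial_deriv j (multilinear_ext n H) (x(j := t)))
    = (\<lambda>t. (multilinear_ext n H (x(j := 1)) - multilinear_ext n H (x(j := -1))) / 2)"
    by (simp add: partial_deriv_affine[OF affine_in_multilinear_ext])
  then show ?thesis using True by (simp add: hessian_def partial_deriv_def[of j "partial_deriv j _"] interaction_def)
next
  case False
  let ?F = "multilinear_ext n H"
  have aff: "affine_in k ?F" for k by (rule affine_in_multilinear_ext)
  have "hessian ?F x i j = x i * (partial_deriv j ?F x - partial_deriv j ?F (flip i x)) / 2"
    unfolding hessian_def by (rule partial_deriv_flip[OF affine_in_partial_deriv[OF aff aff False] s ij(1)])
  also have "\<dots> = x i * x j * ((H x - H (flip j x) - H (flip i x) + H (flip i (flip j x))) / 4)"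
  proof -
    have "partial_deriv j ?F x = x j * (H x - H (flip j x)) / 2"
      using s ij partial_deriv_flip[OF aff s ij(2)] by (simp add: fourier_inversion)
    moreover have "partial_deriv j ?F (flip i x) = x j * (H (flip i x) - H (flip i (flip j x))) / 2"
      using s ij False partial_deriv_flip[OF aff flip_cube[OF s ij(1)] ij(2)]
      by (simp add: fourier_inversion flip_other flip_commute[of j i])
    ultimately show ?thesis by (simp only:) (simp add: field_simps)
  qed
  also have "(H x - H (flip j x) - H (flip i x) + H (flip i (flip j x))) / 4 = interaction w x i j"
  proof -
    have pos: "w x > 0" "w (flip i x) > 0" "w (flip j x) > 0" "w (flip i (flip j x)) > 0"
      using s ij Z by (auto simp: w)
    have lw: "ln (w \<tau>) = H \<tau> - ln Z" if "\<tau> \<in> cube n" for \<tau>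
      using w[OF that] Z by (simp add: ln_div)
    have "interaction w x i j = ((ln (w x) + ln (w (flip i (flip j x)))) - (ln (w (flip j x)) + ln (w (flip i x)))) / 4"
      using pos False by (simp add: interaction_def ln_div ln_mult)
    then show ?thesis using s ij by (simp add: lw)
  qed
  finally show ?thesis .
qed

lemma op_norm_bound:
  fixes M :: "nat \<Rightarrow> nat \<Rightarrow> real"
  shows "0 \<le> op_norm n M"
    and "L2_set (\<lambda>i. \<Sum>j<n. M i j * x j) {..<n} \<le> op_norm n M * L2_set x {..<n}"
proof -
  let ?N = "\<lambda>x. L2_set (\<lambda>i. \<Sum>j<n. M i j * x j) {..<n}"
  let ?B = "{x. L2_set x {..<n} \<le> 1}"
  have L2_set_abs: "L2_set (\<lambda>i. \<bar>f i\<bar>) A = L2_set f A" for f :: "nat \<Rightarrow> real" and A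
    by (simp add: L2_set_def)
  have bdd: "bdd_above (?N ` ?B)"
  proof (rule bdd_aboveI2)
    fix x :: "nat \<Rightarrow> real" assume x: "x \<in> ?B"
    have "\<bar>x j\<bar> \<le> 1" if "j < n" for j
      using member_le_L2_set[of "{..<n}" j "\<lambda>j. \<bar>x j\<bar>"] that x by (simp add: L2_set_abs)
    then have "\<bar>\<Sum>j<n. M i j * x j\<bar> \<le> (\<Sum>j<n. \<bar>M i j\<bar>)" for i
      by (intro order_trans[OF sum_abs] sum_mono) (auto simp: abs_mult intro!: mult_left_le)
    then have "L2_set (\<lambda>i. \<bar>\<Sum>j<n. M i j * x j\<bar>) {..<n} \<le> L2_set (\<lambda>i. \<Sum>j<n. \<bar>M i j\<bar>) {..<n}"
      by (intro L2_set_mono) auto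
    then show "?N x \<le> L2_set (\<lambda>i. \<Sum>j<n. \<bar>M i j\<bar>) {..<n}" by (simp add: L2_set_abs)
  qed
  have le: "?N x \<le> op_norm n M" if "x \<in> ?B" for x
    unfolding op_norm_def by (rule cSUP_upper[OF that bdd])
  show nn: "0 \<le> op_norm n M"
    using le[of "\<lambda>_. 0"] L2_set_nonneg order_trans by (fastforce simp: L2_set_def)
  show "?N x \<le> op_norm n M * L2_set x {..<n}"
  proof (cases "L2_set x {..<n} = 0")
    case True
    then have "\<forall>j<n. x j = 0" by (simp add: L2_set_eq_0_iff)
    then show ?thesis by (simp add: L2_set_def)
  next
    case False
    define r where "r = L2_set x {..<n}"
    have r: "r > 0" using False L2_set_nonneg[of x "{..<n}"] unfolding r_def by linarith
    have "L2_set (\<lambda>j. (1 / r) * x j) {..<n} = (1 / r) * r"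
      unfolding r_def by (rule L2_set_right_distrib[symmetric]) simp
    then have "(\<lambda>j. (1 / r) * x j) \<in> ?B" using r by simp
    from le[OF this] have "L2_set (\<lambda>i. (1 / r) * (\<Sum>j<n. M i j * x j)) {..<n} \<le> op_norm n M"
      by (simp add: sum_divide_distrib)
    then have "(1 / r) * ?N x \<le> op_norm n M"
      using r by (subst L2_set_right_distrib) auto
    then show ?thesis using r by (simp add: pos_divide_le_eq r_def[symmetric])
  qed
qed

lemma gibbs_weakly_interacting:
  assumes w: "\<And>x. x \<in> cube n \<Longrightarrow> w x = exp (H x) / Z" and Z: "Z > 0"
  shows "weakly_interacting n w (max_hessian_norm n H)"
  unfolding weakly_interacting_def
proof (intro conjI ballI allI)
  let ?M = "\<lambda>x. hessian (multilinear_ext n H) x"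
  have le: "op_norm n (?M x) \<le> max_hessian_norm n H" if "x \<in> cube n" for x
    unfolding max_hessian_norm_def using that by (intro Max_ge) auto
  show b0: "0 \<le> max_hessian_norm n H"
    using cube_nonempty le op_norm_bound(1) order_trans by (metis ex_in_conv)
  fix x assume s: "x \<in> cube n"
  show "0 < w x" using w[OF s] Z by simp
  fix q :: "nat \<Rightarrow> real"
  (* The interaction matrix is the Hessian conjugated by the signs of the configuration. *)
  define v where "v j = x j * q j" for j
  have sq: "(x i)\<^sup>2 = 1" if "i < n" for i using cube_square[OF s that] by (simp add: power2_eq_square)
  have row: "(\<Sum>j<n. ?M x i j * v j) = x i * (\<Sum>j<n. interaction w x i j * q j)" if "i < n" for i
    unfolding sum_distrib_left
  proof (intro sum.cong refl)
    fix j assume "j \<in> {..<n}"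
    then have "j < n" by simp
    have "?M x i j * v j = x i * (interaction w x i j * q j) * (x j * x j)"
      using hessian_eq_interaction[OF w Z s that \<open>j < n\<close>] by (simp add: v_def)
    then show "?M x i j * v j = x i * (interaction w x i j * q j)"
      using cube_square[OF s \<open>j < n\<close>] by simp
  qed
  have "(\<Sum>i<n. (\<Sum>j<n. interaction w x i j * q j)\<^sup>2) = (\<Sum>i<n. (\<Sum>j<n. ?M x i j * v j)\<^sup>2)"
    by (intro sum.cong refl) (simp add: row power_mult_distrib sq)
  also have "\<dots> = (L2_set (\<lambda>i. \<Sum>j<n. ?M x i j * v j) {..<n})\<^sup>2"
    by (simp add: L2_set_def sum_nonneg)
  also have "\<dots> \<le> (max_hessian_norm n H * L2_set v {..<n})\<^sup>2"
  proof (rule power_mono)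
    have "L2_set (\<lambda>i. \<Sum>j<n. ?M x i j * v j) {..<n} \<le> op_norm n (?M x) * L2_set v {..<n}"
      by (rule op_norm_bound(2))
    also have "\<dots> \<le> max_hessian_norm n H * L2_set v {..<n}"
      by (intro mult_right_mono le s L2_set_nonneg)
    finally show "L2_set (\<lambda>i. \<Sum>j<n. ?M x i j * v j) {..<n} \<le> max_hessian_norm n H * L2_set v {..<n}" .
  qed (rule L2_set_nonneg)
  also have "\<dots> = (max_hessian_norm n H)\<^sup>2 * (\<Sum>j<n. (q j)\<^sup>2)"
    by (simp add: power_mult_distrib L2_set_def sum_nonneg v_def sq)
  finally show "(\<Sum>i<n. (\<Sum>j<n. interaction w x i j * q j)\<^sup>2) \<le> (max_hessian_norm n H)\<^sup>2 * (\<Sum>j<n. (q j)\<^sup>2)" .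
qed

section \<open>External fields and fractional log-concavity\<close>

lemma sum_site_flip:
  fixes a :: "nat \<Rightarrow> real \<Rightarrow> real"
  assumes "i < n"
  shows "(\<Sum>k<n. a k (flip i x k)) = (\<Sum>k<n. a k (x k)) - a i (x i) + a i (- x i)"
proof -
  have "(\<Sum>k<n. a k (\<tau> k)) = a i (\<tau> i) + (\<Sum>k\<in>{..<n} - {i}. a k (\<tau> k))" for \<tau>
    using assms by (intro sum.remove) auto
  moreover have "(\<Sum>k\<in>{..<n} - {i}. a k (flip i x k)) = (\<Sum>k\<in>{..<n} - {i}. a k (x k))"
    by (intro sum.cong) (auto simp: flip_other)
  ultimately show ?thesis by simp
qed

text \<open>An external field multiplies both products in the definition of \<open>interaction\<close> by the same
  factor.\<close>

lemma weakly_interacting_tilt: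
  assumes wi: "weakly_interacting n w \<beta>"
  shows "weakly_interacting n (\<lambda>x. w x * exp (\<Sum>k<n. a k (x k))) \<beta>"
proof -
  define c where "c x = (\<Sum>k<n. a k (x k))" for x :: "nat \<Rightarrow> real"
  have "interaction (\<lambda>x. w x * exp (c x)) x i j = interaction w x i j"
    if "x \<in> cube n" "i < n" "j < n" for x i j
  proof (cases "i = j")
    case False
    have "c x + c (flip i (flip j x)) = c (flip j x) + c (flip i x)"
      unfolding c_def sum_site_flip[OF that(2)] sum_site_flip[OF that(3)] using False by (simp add: flip_other)
    then have "exp (c x) * exp (c (flip i (flip j x))) = exp (c (flip j x)) * exp (c (flip i x))"
      by (simp flip: exp_add)
    then have "w x * exp (c x) * (w (flip i (flip j x)) * exp (c (flip i (flip j x))))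
        = w x * w (flip i (flip j x)) * (exp (c (flip j x)) * exp (c (flip i x)))"
      by (simp add: mult_ac)
    moreover have "w (flip j x) * exp (c (flip j x)) * (w (flip i x) * exp (c (flip i x)))
        = w (flip j x) * w (flip i x) * (exp (c (flip j x)) * exp (c (flip i x)))"
      by (simp add: mult_ac)
    moreover have "exp (c (flip j x)) * exp (c (flip i x)) \<noteq> 0" by simp
    ultimately show ?thesis by (simp only: interaction_def) simp
  qed (simp add: interaction_def)
  note same = this
  show ?thesis unfolding weakly_interacting_def c_def[symmetric]
  proof (intro conjI ballI allI)
    show "0 \<le> \<beta>" using wi by (simp add: weakly_interacting_def)
    fix x assume s: "x \<in> cube n"
    show "0 < w x * exp (c x)" using weakly_interacting_pos[OF wi s] by simp
    fix q :: "nat \<Rightarrow> real"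
    have "(\<Sum>i<n. (\<Sum>j<n. interaction (\<lambda>x. w x * exp (c x)) x i j * q j)\<^sup>2)
        = (\<Sum>i<n. (\<Sum>j<n. interaction w x i j * q j)\<^sup>2)"
      by (intro sum.cong refl arg_cong[where f = "\<lambda>x. x\<^sup>2"]) (simp add: same[OF s])
    then show "(\<Sum>i<n. (\<Sum>j<n. interaction (\<lambda>x. w x * exp (c x)) x i j * q j)\<^sup>2)
        \<le> \<beta>\<^sup>2 * (\<Sum>j<n. (q j)\<^sup>2)"
      using weakly_interacting_norm[OF wi s] by simp
  qed
qed

text \<open>Only the summand that depends on the spin \<open>i\<close> contributes to the deviation at \<open>i\<close>, and conditional
  deviations contract the norm.\<close>

lemma dirichlet_additive_le:
  assumes pos: "\<forall>x\<in>cube n. 0 < w x"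
  shows "dirichlet n w (\<lambda>x. \<Sum>k<n. u k (x k)) \<le> (\<Sum>x\<in>cube n. w x * (\<Sum>i<n. (u i (x i))\<^sup>2))"
proof -
  have "cond_dev w i (\<lambda>x. \<Sum>k<n. u k (x k)) = cond_dev w i (\<lambda>x. u i (x i))" if "i < n" for i
    unfolding cond_dev_def sum_site_flip[OF that] by auto
  then have "dirichlet n w (\<lambda>x. \<Sum>k<n. u k (x k))
     = (\<Sum>i<n. \<Sum>x\<in>cube n. w x * (cond_dev w i (\<lambda>x. u i (x i)) x)\<^sup>2)"
    unfolding dirichlet_eq_sum by (intro sum.cong refl) simp
  also have "\<dots> \<le> (\<Sum>i<n. \<Sum>x\<in>cube n. w x * (u i (x i))\<^sup>2)"
    by (intro sum_mono cond_dev_contraction[OF pos]) auto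
  also have "\<dots> = (\<Sum>x\<in>cube n. w x * (\<Sum>i<n. (u i (x i))\<^sup>2))"
    unfolding sum_distrib_left by (rule sum.swap)
  finally show ?thesis .
qed

text \<open>The generating polynomial of the homogenization at \<open>z\<^sup>\<alpha>\<close> (\<open>gen_poly_homogenization\<close>).\<close>

definition spin_poly :: "nat \<Rightarrow> ((nat \<Rightarrow> real) \<Rightarrow> real) \<Rightarrow> real \<Rightarrow> (real \<times> nat \<Rightarrow> real) \<Rightarrow> real" where
  "spin_poly n w \<alpha> z = (\<Sum>x\<in>cube n. w x * (\<Prod>i<n. z (x i, i) powr \<alpha>))"

lemma cube_site: "x \<in> cube n \<Longrightarrow> i < n \<Longrightarrow> (x i, i) \<in> {-1, 1} \<times> {..<n}"
  using cube_values by auto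

text \<open>Along a segment the polynomial is a sum of exponentials, and the summands at time \<open>r\<close> form a tilt
  of \<open>w\<close>. The derivative of the exponent is a sum of functions of one spin, so its variance under
  the tilt is bounded by the Poincare inequality. The factor \<open>\<alpha>\<close> makes this bound equal to the
  mean of the negative second derivative of the exponent.\<close>

lemma spin_poly_log_concave_pos:
  assumes wi: "weakly_interacting n w \<beta>" and b: "\<beta> \<le> 1/3000" and n: "0 < n"
    and z: "\<And>p. p \<in> {-1, 1} \<times> {..<n} \<Longrightarrow> 0 < z p" and y: "\<And>p. p \<in> {-1, 1} \<times> {..<n} \<Longrightarrow> 0 < y p"
    and t: "0 < t" "t < 1"
  defines "\<alpha> \<equiv> 1 / (1 + 4 * \<beta>)"
  shows "spin_poly n w \<alpha> z powr (1 - t) * spin_poly n w \<alpha> y powr t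
    \<le> spin_poly n w \<alpha> (\<lambda>p. (1 - t) * z p + t * y p)"
proof -
  have pos: "\<forall>x\<in>cube n. 0 < w x" using weakly_interacting_pos[OF wi] by blast
  note b0 = weakly_interacting_nonneg[OF wi]
  have \<alpha>: "\<alpha> > 0" "(1 + 4 * \<beta>) * \<alpha> = 1" using b0 by (auto simp: \<alpha>_def)
  define c where "c p r = (1 - r) * z p + r * y p" for p and r :: real
  define d where "d p = y p - z p" for p
  have cpos: "0 < c p r" if "p \<in> {-1, 1} \<times> {..<n}" "0 \<le> r" "r \<le> 1" for p r
  proof (cases "r = 1")
    case True
    then show ?thesis using y[OF that(1)] by (simp add: c_def)
  next
    case False
    then have "0 < (1 - r) * z p" "0 \<le> r * y p" using that z[OF that(1)] y[OF that(1)] by auto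
    then show ?thesis by (simp add: c_def)
  qed
  define L L1 L2 where "L x r = (\<Sum>k<n. \<alpha> * ln (c (x k, k) r))"
    and "L1 x r = (\<Sum>k<n. \<alpha> * (d (x k, k) / c (x k, k) r))"
    and "L2 x r = - (\<Sum>k<n. \<alpha> * (d (x k, k) / c (x k, k) r)\<^sup>2)" for x :: "nat \<Rightarrow> real" and r
  define v where "v r x = w x * exp (L x r)" for r x
  define N0 N1 N2 where "N0 r = (\<Sum>x\<in>cube n. v r x)"
    and "N1 r = (\<Sum>x\<in>cube n. v r x * L1 x r)"
    and "N2 r = (\<Sum>x\<in>cube n. v r x * ((L1 x r)\<^sup>2 + L2 x r))" for r
  have dc: "((\<lambda>r. c p r) has_real_derivative d p) (at r)" for p r
    unfolding c_def d_def by (auto intro!: derivative_eq_intros)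
  have dL: "((\<lambda>r. L x r) has_real_derivative L1 x r) (at r)"
    if "x \<in> cube n" "0 \<le> r" "r \<le> 1" for x r
    unfolding L_def L1_def
  proof (intro DERIV_sum DERIV_cmult)
    fix k assume "k \<in> {..<n}"
    then have "0 < c (x k, k) r" using cpos cube_site that by auto
    then show "((\<lambda>r. ln (c (x k, k) r)) has_real_derivative d (x k, k) / c (x k, k) r) (at r)"
      by (auto intro!: derivative_eq_intros dc simp: divide_inverse mult.commute)
  qed
  have dL1: "((\<lambda>r. L1 x r) has_real_derivative L2 x r) (at r)"
    if "x \<in> cube n" "0 \<le> r" "r \<le> 1" for x r
    unfolding L2_def L1_def sum_negf[symmetric] mult_minus_right[symmetric]
  proof (intro DERIV_sum DERIV_cmult)
    fix k assume "k \<in> {..<n}"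
    then have "c (x k, k) r \<noteq> 0" using cpos[of "(x k, k)" r] cube_site that by force
    then show "((\<lambda>r. d (x k, k) / c (x k, k) r) has_real_derivative - (d (x k, k) / c (x k, k) r)\<^sup>2) (at r)"
      by (auto intro!: derivative_eq_intros dc simp: power2_eq_square)
  qed
  have dv: "((\<lambda>r. v r x) has_real_derivative v r x * L1 x r) (at r)"
    if "x \<in> cube n" "0 \<le> r" "r \<le> 1" for x r
    unfolding v_def by (auto intro!: derivative_eq_intros dL[OF that])
  have dN0: "(N0 has_real_derivative N1 r) (at r)" if "0 \<le> r" "r \<le> 1" for r
    unfolding N0_def N1_def using dv that by (intro DERIV_sum) auto
  have dN1: "(N1 has_real_derivative N2 r) (at r)" if "0 \<le> r" "r \<le> 1" for r
    unfolding N1_def N2_def 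
  proof (rule DERIV_sum)
    fix x assume s: "x \<in> cube n"
    show "((\<lambda>r. v r x * L1 x r) has_real_derivative v r x * ((L1 x r)\<^sup>2 + L2 x r)) (at r)"
      by (auto intro!: derivative_eq_intros dv[OF s that] dL1[OF s that] simp: power2_eq_square algebra_simps)
  qed
  have vpos: "\<forall>x\<in>cube n. 0 < v r x" for r using pos by (auto simp: v_def)
  have N0pos: "0 < N0 r" for r unfolding N0_def by (rule weight_total_pos[OF vpos])
  (* Up to the factor N0 r ^ 2 this is the second derivative of ln N0: the variance of the first
     derivative of the exponent plus the mean of the second. *)
  have key: "N2 r * N0 r - N1 r * N1 r \<le> 0" if "0 \<le> r" "r \<le> 1" for r
  proof -
    define u where "u k s = \<alpha> * (d (s, k) / c (s, k) r)" for k s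
    have vwi: "weakly_interacting n (v r) \<beta>"
      using weakly_interacting_tilt[OF wi, of "\<lambda>k s. \<alpha> * ln (c (s, k) r)"]
      by (simp add: v_def[abs_def] L_def)
    have L1u: "(\<lambda>x. L1 x r) = (\<lambda>x. \<Sum>k<n. u k (x k))" by (simp add: L1_def u_def)
    have "wvar n (v r) (\<lambda>x. L1 x r) \<le> (1 + 4 * \<beta>) * dirichlet n (v r) (\<lambda>x. L1 x r)"
      by (rule weakly_interacting_poincare[OF vwi b n])
    also have "\<dots> \<le> (1 + 4 * \<beta>) * (\<Sum>x\<in>cube n. v r x * (\<Sum>i<n. (u i (x i))\<^sup>2))"
      unfolding L1u using b0 by (intro mult_left_mono dirichlet_additive_le[OF vpos]) auto
    also have "\<dots> = (\<Sum>x\<in>cube n. v r x * (- L2 x r))"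
      unfolding sum_distrib_left
    proof (intro sum.cong refl)
      fix x
      have "(1 + 4 * \<beta>) * (u i (x i))\<^sup>2 = \<alpha> * (d (x i, i) / c (x i, i) r)\<^sup>2" for i
      proof -
        have "(1 + 4 * \<beta>) * (u i (x i))\<^sup>2 = ((1 + 4 * \<beta>) * \<alpha>) * (\<alpha> * (d (x i, i) / c (x i, i) r)\<^sup>2)"
          unfolding u_def power2_eq_square by (simp only: mult_ac)
        then show ?thesis by (simp only: \<alpha>(2) mult_1)
      qed
      then have "- L2 x r = (\<Sum>i<n. (1 + 4 * \<beta>) * (u i (x i))\<^sup>2)" by (simp add: L2_def)
      then show "(\<Sum>i<n. (1 + 4 * \<beta>) * (v r x * (u i (x i))\<^sup>2)) = v r x * - L2 x r"
        by (simp add: sum_distrib_left mult_ac)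
    qed
    finally have "N2 r - (N1 r)\<^sup>2 / N0 r \<le> 0"
      unfolding wvar_def N0_def[symmetric] N1_def[symmetric]
      by (simp add: N2_def distrib_left sum.distrib sum_negf)
    then have "(N2 r - (N1 r)\<^sup>2 / N0 r) * N0 r \<le> 0 * N0 r"
      using N0pos[of r] by (intro mult_right_mono) auto
    then show ?thesis using N0pos[of r] by (simp add: left_diff_distrib power2_eq_square)
  qed
  have "concave_on {0..1} (\<lambda>r. ln (N0 r))"
  proof (rule f''_le0_imp_concave)
    fix r :: real assume "r \<in> {0..1}"
    then have r: "0 \<le> r" "r \<le> 1" by auto
    show "((\<lambda>r. ln (N0 r)) has_real_derivative N1 r / N0 r) (at r)"
      using N0pos[of r] by (auto intro!: derivative_eq_intros dN0[OF r] simp: divide_inverse mult.commute)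
    show "((\<lambda>r. N1 r / N0 r) has_real_derivative (N2 r * N0 r - N1 r * N1 r) / (N0 r * N0 r)) (at r)"
      using DERIV_divide[OF dN1[OF r] dN0[OF r]] N0pos[of r] by simp
    show "(N2 r * N0 r - N1 r * N1 r) / (N0 r * N0 r) \<le> 0"
      using key[OF r] N0pos[of r] by (intro divide_nonpos_pos) auto
  qed simp
  from concave_onD[OF this, of t 0 1] t
  have "(1 - t) * ln (N0 0) + t * ln (N0 1) \<le> ln (N0 t)" by simp
  then have "exp ((1 - t) * ln (N0 0) + t * ln (N0 1)) \<le> N0 t"
    using N0pos[of t] by (metis exp_le_cancel_iff exp_ln)
  then have ineq: "N0 0 powr (1 - t) * N0 1 powr t \<le> N0 t"
    using N0pos[of 0] N0pos[of 1] by (simp add: powr_def exp_add)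
  have N0: "N0 r = spin_poly n w \<alpha> (\<lambda>p. c p r)" if "0 \<le> r" "r \<le> 1" for r
    unfolding N0_def spin_poly_def v_def
  proof (intro sum.cong refl arg_cong2[of _ _ _ _ "(*)"])
    fix x assume s: "x \<in> cube n"
    have "c (x k, k) r \<noteq> 0" if "k < n" for k
      using cpos[OF cube_site[OF s that] \<open>0 \<le> r\<close> \<open>r \<le> 1\<close>] by simp
    then show "exp (L x r) = (\<Prod>i<n. c (x i, i) r powr \<alpha>)"
      by (simp add: L_def exp_sum powr_def)
  qed
  have "(\<lambda>p. c p 0) = z" "(\<lambda>p. c p 1) = y" by (auto simp: c_def)
  then show ?thesis using ineq N0[of 0] N0[of 1] N0[of t] t by (simp add: c_def)
qed

text \<open>The closed orthant is reached by adding \<open>e\<close> to all variables. The multiplicative form of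
  concavity survives the limit where the polynomial vanishes.\<close>

lemma spin_poly_log_concave:
  assumes wi: "weakly_interacting n w \<beta>" and b: "\<beta> \<le> 1/3000" and n: "0 < n"
    and z: "\<And>p. p \<in> {-1, 1} \<times> {..<n} \<Longrightarrow> 0 \<le> z p" and y: "\<And>p. p \<in> {-1, 1} \<times> {..<n} \<Longrightarrow> 0 \<le> y p"
    and t: "0 < t" "t < 1"
  defines "\<alpha> \<equiv> 1 / (1 + 4 * \<beta>)"
  shows "spin_poly n w \<alpha> z powr (1 - t) * spin_poly n w \<alpha> y powr t
    \<le> spin_poly n w \<alpha> (\<lambda>p. (1 - t) * z p + t * y p)"
proof -
  let ?G = "spin_poly n w \<alpha>"
  have pos: "\<forall>x\<in>cube n. 0 < w x" using weakly_interacting_pos[OF wi] by blast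
  note b0 = weakly_interacting_nonneg[OF wi]
  have \<alpha>: "\<alpha> > 0" using b0 by (auto simp: \<alpha>_def)
  have ev: "\<forall>\<^sub>F e in at_right 0. 0 < (e::real)" by (simp add: eventually_at_right_less)
  have lim: "((\<lambda>e. ?G (\<lambda>p. u p + e)) \<longlongrightarrow> ?G u) (at_right 0)"
    if u: "\<And>p. p \<in> {-1, 1} \<times> {..<n} \<Longrightarrow> 0 \<le> u p" for u
    unfolding spin_poly_def
  proof (intro tendsto_sum tendsto_mult tendsto_const tendsto_prod tendsto_powr2)
    fix x i assume "x \<in> cube n" "i \<in> {..<n}"
    then have x0: "0 \<le> u (x i, i)" using u cube_site by auto
    show "((\<lambda>e. u (x i, i) + e) \<longlongrightarrow> u (x i, i)) (at_right 0)"
      by (auto intro!: tendsto_eq_intros)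
    show "\<forall>\<^sub>F e in at_right 0. 0 \<le> u (x i, i) + e"
      using ev by eventually_elim (use x0 in auto)
  qed (rule \<alpha>)
  have nn: "0 \<le> ?G u" for u
    unfolding spin_poly_def using pos by (intro sum_nonneg mult_nonneg_nonneg prod_nonneg) (auto simp: less_imp_le)
  have limp: "((\<lambda>e. ?G (\<lambda>p. u p + e) powr s) \<longlongrightarrow> ?G u powr s) (at_right 0)"
    if u: "\<And>p. p \<in> {-1, 1} \<times> {..<n} \<Longrightarrow> 0 \<le> u p" and s: "0 < s" for u s
    using nn by (intro tendsto_powr2 lim u tendsto_const s) auto
  show ?thesis
  proof (rule tendsto_le)
    show "((\<lambda>e. ?G (\<lambda>p. z p + e) powr (1 - t) * ?G (\<lambda>p. y p + e) powr t)
      \<longlongrightarrow> ?G z powr (1 - t) * ?G y powr t) (at_right 0)"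
      using t by (intro tendsto_mult limp z y) auto
    show "((\<lambda>e. ?G (\<lambda>p. ((1 - t) * z p + t * y p) + e))
      \<longlongrightarrow> ?G (\<lambda>p. (1 - t) * z p + t * y p)) (at_right 0)"
      using t z y by (intro lim add_nonneg_nonneg mult_nonneg_nonneg) auto
    show "\<forall>\<^sub>F e in at_right 0. ?G (\<lambda>p. z p + e) powr (1 - t) * ?G (\<lambda>p. y p + e) powr t
      \<le> ?G (\<lambda>p. ((1 - t) * z p + t * y p) + e)"
      using ev
    proof eventually_elim
      fix e :: real assume e: "0 < e"
      have "?G (\<lambda>p. z p + e) powr (1 - t) * ?G (\<lambda>p. y p + e) powr t
        \<le> ?G (\<lambda>p. (1 - t) * (z p + e) + t * (y p + e))"
        unfolding \<alpha>_def
        using spin_poly_log_concave_pos[OF wi b n _ _ t, of "\<lambda>p. z p + e" "\<lambda>p. y p + e"] z y e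
        by (simp add: add_nonneg_pos)
      also have "(\<lambda>p. (1 - t) * (z p + e) + t * (y p + e)) = (\<lambda>p. ((1 - t) * z p + t * y p) + e)"
        by (auto simp: algebra_simps)
      finally show "?G (\<lambda>p. z p + e) powr (1 - t) * ?G (\<lambda>p. y p + e) powr t
        \<le> ?G (\<lambda>p. ((1 - t) * z p + t * y p) + e)" .
    qed
  qed simp
qed

section \<open>Entropic independence and tensorization\<close>

definition fibre :: "nat \<Rightarrow> nat set \<Rightarrow> (nat \<Rightarrow> real) \<Rightarrow> (nat \<Rightarrow> real) set" where
  "fibre n T x = {y \<in> cube n. \<forall>i\<in>T. y i = x i}"

definition marg :: "nat \<Rightarrow> nat set \<Rightarrow> ((nat \<Rightarrow> real) \<Rightarrow> real) \<Rightarrow> (nat \<Rightarrow> real) \<Rightarrow> real" where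
  "marg n T h x = (\<Sum>y\<in>fibre n T x. h y)"

lemma finite_fibre [simp, intro]: "finite (fibre n T x)"
  by (simp add: fibre_def)

lemma fibre_self: "x \<in> cube n \<Longrightarrow> x \<in> fibre n T x"
  by (simp add: fibre_def)

lemma fibre_cube: "y \<in> fibre n T x \<Longrightarrow> y \<in> cube n"
  by (simp add: fibre_def)

lemma marg_cong: "(\<And>i. i \<in> T \<Longrightarrow> x i = \<tau> i) \<Longrightarrow> marg n T h x = marg n T h \<tau>"
  unfolding marg_def fibre_def by (intro sum.cong) auto

lemma marg_fibre: "y \<in> fibre n T x \<Longrightarrow> marg n T h y = marg n T h x"
  by (intro marg_cong) (auto simp: fibre_def)

lemma marg_ge:
  assumes "\<forall>x\<in>cube n. 0 \<le> h x" "x \<in> cube n"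
  shows "h x \<le> marg n T h x"
  unfolding marg_def using assms by (intro member_le_sum fibre_self) (auto dest: fibre_cube)

lemma marg_nonneg: "\<forall>x\<in>cube n. 0 \<le> h x \<Longrightarrow> 0 \<le> marg n T h x"
  unfolding marg_def by (intro sum_nonneg) (auto dest: fibre_cube)

lemma marg_pos: "\<forall>x\<in>cube n. 0 < w x \<Longrightarrow> x \<in> cube n \<Longrightarrow> 0 < marg n T w x"
  unfolding marg_def using fibre_self[of x n T] by (intro sum_pos) (auto dest: fibre_cube)

lemma marg_full: "x \<in> cube n \<Longrightarrow> marg n {..<n} h x = h x"
proof -
  assume s: "x \<in> cube n"
  then have "fibre n {..<n} x = {x}" by (auto simp: fibre_def intro: cube_eqI)
  then show ?thesis by (simp add: marg_def)
qed

lemma marg_empty: "marg n {} h x = (\<Sum>y\<in>cube n. h y)"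
  by (simp add: marg_def fibre_def)

lemma fibre_all_but_one:
  assumes "x \<in> cube n" "v < n"
  shows "marg n ({..<n} - {v}) h x = h x + h (flip v x)"
proof -
  have "fibre n ({..<n} - {v}) x = {x, flip v x}"
    using eq_or_flip[OF _ assms] assms by (auto simp: fibre_def) (metis flip_other)
  then show ?thesis unfolding marg_def using flip_neq[OF assms] by simp
qed

text \<open>Both sides sum over the pairs of configurations that agree on \<open>T\<close>, on which \<open>k\<close> takes equal values.
  It plays the role of the defining property of conditional expectations.\<close>

lemma marg_exchange:
  assumes k: "\<And>x y. x \<in> cube n \<Longrightarrow> y \<in> fibre n T x \<Longrightarrow> k y = k x"
  shows "(\<Sum>x\<in>cube n. k x * g x * marg n T u x) = (\<Sum>x\<in>cube n. k x * u x * marg n T g x :: real)"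
proof -
  have e: "(\<Sum>x\<in>cube n. k x * a x * marg n T b x)
    = (\<Sum>x\<in>cube n. \<Sum>y\<in>cube n. if \<forall>i\<in>T. y i = x i then k x * a x * b y else 0)" for a b
    unfolding marg_def fibre_def sum_distrib_left by (simp add: sum.inter_filter)
  have "(\<Sum>x\<in>cube n. \<Sum>y\<in>cube n. if \<forall>i\<in>T. y i = x i then k x * g x * u y else 0)
    = (\<Sum>y\<in>cube n. \<Sum>x\<in>cube n. if \<forall>i\<in>T. y i = x i then k x * g x * u y else 0)"
    by (rule sum.swap)
  also have "\<dots> = (\<Sum>y\<in>cube n. \<Sum>x\<in>cube n. if \<forall>i\<in>T. x i = y i then k y * u y * g x else 0)"
  proof (intro sum.cong refl)
    fix y x assume s: "y \<in> cube n" "x \<in> cube n"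
    show "(if \<forall>i\<in>T. y i = x i then k x * g x * u y else 0) = (if \<forall>i\<in>T. x i = y i then k y * u y * g x else 0)"
      using k[OF s(2), of y] s by (auto simp: fibre_def)
  qed
  finally show ?thesis unfolding e .
qed

text \<open>Variables that are \<open>1\<close> at the spin \<open>\<tau> i\<close> and \<open>0\<close> at its opposite condition on agreement with \<open>\<tau>\<close>.\<close>

lemma spin_poly_pinned:
  assumes "T \<subseteq> {..<n}" "\<tau> \<in> cube n"
  shows "spin_poly n w \<alpha> (\<lambda>(s, i). if i \<in> T then of_bool (s = \<tau> i) else q s i)
    = (\<Sum>x\<in>fibre n T \<tau>. w x * (\<Prod>i\<in>{..<n} - T. q (x i) i powr \<alpha>))"
proof -
  have "spin_poly n w \<alpha> (\<lambda>(s, i). if i \<in> T then of_bool (s = \<tau> i) else q s i)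
    = (\<Sum>x\<in>cube n. if \<forall>i\<in>T. x i = \<tau> i then w x * (\<Prod>i\<in>{..<n} - T. q (x i) i powr \<alpha>) else 0)"
    unfolding spin_poly_def
  proof (intro sum.cong refl)
    fix x assume "x \<in> cube n"
    have fin: "finite T" using assms(1) by (rule finite_subset) simp
    have "(\<Prod>i<n. (case (x i, i) of (s, i) \<Rightarrow> if i \<in> T then of_bool (s = \<tau> i) else q s i) powr \<alpha>)
       = (\<Prod>i\<in>T. of_bool (x i = \<tau> i) powr \<alpha>) * (\<Prod>i\<in>{..<n} - T. q (x i) i powr \<alpha>)"
      by (subst prod.subset_diff[OF assms(1)]) (auto simp: mult.commute intro!: arg_cong2[of _ _ _ _ "(*)"] prod.cong)
    also have "(\<Prod>i\<in>T. of_bool (x i = \<tau> i) powr \<alpha>) = of_bool (\<forall>i\<in>T. x i = \<tau> i)"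
      using fin by (auto simp: prod_zero_iff)
    finally show "w x * (\<Prod>i<n. (case (x i, i) of (s, i) \<Rightarrow> if i \<in> T then of_bool (s = \<tau> i) else q s i) powr \<alpha>)
       = (if \<forall>i\<in>T. x i = \<tau> i then w x * (\<Prod>i\<in>{..<n} - T. q (x i) i powr \<alpha>) else 0)"
      by simp
  qed
  also have "\<dots> = (\<Sum>x\<in>fibre n T \<tau>. w x * (\<Prod>i\<in>{..<n} - T. q (x i) i powr \<alpha>))"
    unfolding fibre_def by (simp add: sum.inter_filter)
  finally show ?thesis .
qed

text \<open>The logarithm of the polynomial lies below its tangent at the point of the closed orthant that
  pins the spins in \<open>T\<close> and is \<open>1\<close> elsewhere. Along directions \<open>r - 1\<close> with \<open>r\<close> of conditional mean one
  at each free spin the tangent is constant.\<close>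

lemma spin_poly_tangent:
  assumes wi: "weakly_interacting n w \<beta>" and b: "\<beta> \<le> 1/3000" and n: "0 < n"
    and T: "T \<subseteq> {..<n}" and \<tau>: "\<tau> \<in> cube n"
    and r0: "\<And>s i. i < n \<Longrightarrow> s \<in> {-1, 1} \<Longrightarrow> 0 \<le> r s i"
    and r1: "\<And>i. i \<in> {..<n} - T \<Longrightarrow> (\<Sum>x\<in>fibre n T \<tau>. w x * r (x i) i) = marg n T w \<tau>"
  defines "\<alpha> \<equiv> 1 / (1 + 4 * \<beta>)"
  shows "(\<Sum>x\<in>fibre n T \<tau>. w x * (\<Prod>i\<in>{..<n} - T. r (x i) i powr \<alpha>)) \<le> marg n T w \<tau>"
proof (rule ccontr)
  define G where "G = (\<Sum>x\<in>fibre n T \<tau>. w x * (\<Prod>i\<in>{..<n} - T. r (x i) i powr \<alpha>))"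
  define m where "m = marg n T w \<tau>"
  have pos: "\<forall>x\<in>cube n. 0 < w x" using weakly_interacting_pos[OF wi] by blast
  have m: "0 < m" unfolding m_def by (rule marg_pos[OF pos \<tau>])
  assume "\<not> G \<le> m"
  then have Gm: "G > m" by simp
  define l where "l = ln (G / m)"
  have l: "l > 0" using Gm m by (simp add: l_def)
  define pin where "pin q = (\<lambda>(s, i). if i \<in> T then of_bool (s = \<tau> i) else q s i :: real)" for q
  define \<phi> where "\<phi> t = (\<Sum>x\<in>fibre n T \<tau>. w x * (\<Prod>i\<in>{..<n} - T. (1 + t * (r (x i) i - 1)) powr \<alpha>))" for t
  have sp: "spin_poly n w \<alpha> (pin q) = (\<Sum>x\<in>fibre n T \<tau>. w x * (\<Prod>i\<in>{..<n} - T. q (x i) i powr \<alpha>))" for q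
    unfolding pin_def by (rule spin_poly_pinned[OF T \<tau>])
  (* Concavity on the segment from the pinned base point to the point r. *)
  have lower: "m + m * l * t \<le> \<phi> t" if t: "0 < t" "t < 1" for t
  proof -
    have "spin_poly n w \<alpha> (pin (\<lambda>_ _. 1)) powr (1 - t) * spin_poly n w \<alpha> (pin r) powr t
      \<le> spin_poly n w \<alpha> (\<lambda>p. (1 - t) * pin (\<lambda>_ _. 1) p + t * pin r p)"
      unfolding \<alpha>_def
      by (rule spin_poly_log_concave[OF wi b n _ _ t]) (auto simp: pin_def r0)
    also have "(\<lambda>p. (1 - t) * pin (\<lambda>_ _. 1) p + t * pin r p) = pin (\<lambda>s i. 1 + t * (r s i - 1))"
      by (auto simp: pin_def fun_eq_iff algebra_simps)
    also have "spin_poly n w \<alpha> (pin (\<lambda>_ _. 1)) = m" unfolding sp by (simp add: m_def marg_def)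
    finally have "m powr (1 - t) * G powr t \<le> \<phi> t" unfolding sp G_def[symmetric] \<phi>_def .
    moreover have "m powr (1 - t) * G powr t = m * (G / m) powr t"
      using m Gm by (simp add: powr_diff powr_divide)
    moreover have "(G / m) powr t \<ge> 1 + t * l"
      using m Gm exp_ge_add_one_self[of "t * l"] by (simp add: powr_def l_def)
    then have "m * (G / m) powr t \<ge> m * (1 + t * l)" using m by (intro mult_left_mono) auto
    ultimately show ?thesis by (simp add: algebra_simps)
  qed
  have \<phi>0: "\<phi> 0 = m" by (simp add: \<phi>_def m_def marg_def)
  have "(\<phi> has_real_derivative (\<Sum>x\<in>fibre n T \<tau>. w x * (\<Sum>i\<in>{..<n} - T. \<alpha> * (r (x i) i - 1)))) (at 0)"
    unfolding \<phi>_def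
  proof (intro DERIV_sum DERIV_cmult)
    fix x
    have d: "((\<lambda>t. (1 + t * (r (x i) i - 1)) powr \<alpha>) has_real_derivative \<alpha> * (r (x i) i - 1)) (at 0)" for i
      by (rule has_real_derivative_powr'[THEN DERIV_cong]) (auto intro!: derivative_eq_intros)
    show "((\<lambda>t. \<Prod>i\<in>{..<n} - T. (1 + t * (r (x i) i - 1)) powr \<alpha>) has_real_derivative
        (\<Sum>i\<in>{..<n} - T. \<alpha> * (r (x i) i - 1))) (at 0)"
      by (rule has_field_derivative_prod'[THEN DERIV_cong, OF _ d]) auto
  qed
  moreover have "(\<Sum>x\<in>fibre n T \<tau>. w x * (\<Sum>i\<in>{..<n} - T. \<alpha> * (r (x i) i - 1))) = 0"
  proof -
    have "(\<Sum>x\<in>fibre n T \<tau>. w x * (\<Sum>i\<in>{..<n} - T. \<alpha> * (r (x i) i - 1)))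
      = (\<Sum>i\<in>{..<n} - T. \<Sum>x\<in>fibre n T \<tau>. w x * (\<alpha> * (r (x i) i - 1)))"
      unfolding sum_distrib_left by (rule sum.swap)
    also have "\<dots> = (\<Sum>i\<in>{..<n} - T. \<alpha> * ((\<Sum>x\<in>fibre n T \<tau>. w x * r (x i) i) - (\<Sum>x\<in>fibre n T \<tau>. w x)))"
      unfolding sum_subtractf[symmetric] sum_distrib_left by (intro sum.cong) (simp_all add: algebra_simps)
    also have "\<dots> = 0" using r1 by (intro sum.neutral) (simp add: marg_def)
    finally show ?thesis .
  qed
  (* The derivative vanishes by the normalisation of r, against the linear growth found above. *)
  ultimately have "(\<phi> has_real_derivative 0) (at 0)" by simp
  then have "((\<lambda>t. (\<phi> t - m) / t) \<longlongrightarrow> 0) (at 0)"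
    using DERIV_D[of \<phi> 0 0] by (simp add: \<phi>0)
  then have lim: "((\<lambda>t. (\<phi> t - m) / t) \<longlongrightarrow> 0) (at_right 0)" by (rule tendsto_within_subset) auto
  have "\<forall>\<^sub>F t in at_right 0. m * l \<le> (\<phi> t - m) / t"
  proof -
    have "\<forall>\<^sub>F t in at_right 0. 0 < (t::real) \<and> t < 1"
      by (intro eventually_conj) (auto simp: eventually_at_right_less eventually_at_right[of 0 1] intro!: exI[of _ 1])
    then show ?thesis
    proof eventually_elim
      case (elim t)
      then show ?case using lower[of t] by (simp add: pos_le_divide_eq)
    qed
  qed
  then have "m * l \<le> 0" using lim by (intro tendsto_lowerbound[OF lim]) auto
  then show False using m l by (simp add: mult_le_0_iff)
qed

text \<open>The relative entropy of the marginals on \<open>T\<close> when \<open>h\<close> and \<open>w\<close> are probabilities. Zeros of \<open>h\<close> are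
  allowed: they contribute \<open>0\<close>, and positive values of \<open>h\<close> have positive marginals.\<close>

definition rel_ent :: "nat \<Rightarrow> nat set \<Rightarrow> ((nat \<Rightarrow> real) \<Rightarrow> real) \<Rightarrow> ((nat \<Rightarrow> real) \<Rightarrow> real) \<Rightarrow> real" where
  "rel_ent n T h w = (\<Sum>x\<in>cube n. h x * (ln (marg n T h x) - ln (marg n T w x)))"

text \<open>The left side is the sum over the free spins of their relative entropies conditional on the spins
  in \<open>T\<close>. By the variational principle the relative entropy of \<open>h\<close> given \<open>T\<close> is at least the
  expectation of \<open>\<Sum>\<^sub>i \<alpha> ln (R i)\<close> minus the logarithm of the mean of \<open>\<Prod>\<^sub>i (R i)\<^sup>\<alpha>\<close> under
  \<open>w\<close> on a fibre, and \<open>spin_poly_tangent\<close> says that this mean is at most one.\<close>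

lemma entropic_independence:
  assumes wi: "weakly_interacting n w \<beta>" and b: "\<beta> \<le> 1/3000" and n: "0 < n"
    and T: "T \<subseteq> {..<n}" and h: "\<forall>x\<in>cube n. 0 \<le> h x"
  shows "(\<Sum>i\<in>{..<n} - T. rel_ent n (insert i T) h w - rel_ent n T h w)
    \<le> (1 + 4 * \<beta>) * (rel_ent n {..<n} h w - rel_ent n T h w)"
proof -
  define \<alpha> where "\<alpha> = 1 / (1 + 4 * \<beta>)"
  have pos: "\<forall>x\<in>cube n. 0 < w x" using weakly_interacting_pos[OF wi] by blast
  note b0 = weakly_interacting_nonneg[OF wi]
  have \<alpha>: "\<alpha> > 0" using b0 by (auto simp: \<alpha>_def)
  define Mh Mw where "Mh = marg n T h" and "Mw = marg n T w"
  (* The conditional law of spin i given the spins in T under h, relative to the one under w. *)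
  define R where "R i x = marg n (insert i T) h x / marg n (insert i T) w x * (Mw x / Mh x)" for i x
  define D where "D = {..<n} - T"
  define e where "e S x = h x * (ln (marg n S h x) - ln (marg n S w x))" for S x
  define g where "g x = w x * (\<Prod>i\<in>D. R i x powr \<alpha>)" for x
  have Mwp: "0 < Mw x" if "x \<in> cube n" for x unfolding Mw_def by (rule marg_pos[OF pos that])
  have Mhn: "0 \<le> Mh x" for x unfolding Mh_def by (rule marg_nonneg[OF h])
  have fibre_bound: "marg n T g \<tau> \<le> Mw \<tau>" if \<tau>: "\<tau> \<in> cube n" and Mh: "Mh \<tau> > 0" for \<tau>
  proof -
    define r where "r s i = R i (\<tau>(i := s))" for s i
    have Rr: "R i y = r (y i) i" if "y \<in> fibre n T \<tau>" "i \<in> D" for y i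
    proof -
      have "marg n S k y = marg n S k (\<tau>(i := y i))" if "S \<subseteq> insert i T" for S k
        using that \<open>y \<in> fibre n T \<tau>\<close> by (intro marg_cong) (auto simp: fibre_def)
      then show ?thesis unfolding R_def r_def Mh_def Mw_def by (auto simp: subset_insertI)
    qed
    have r0: "0 \<le> r s i" if "i < n" "s \<in> {-1, 1}" for s i
      unfolding r_def R_def Mh_def Mw_def 
      using marg_nonneg[OF h] marg_nonneg[of n w] pos
      by (intro mult_nonneg_nonneg divide_nonneg_nonneg) (auto simp: less_imp_le)
    have r1: "(\<Sum>y\<in>fibre n T \<tau>. w y * r (y i) i) = marg n T w \<tau>" if i: "i \<in> {..<n} - T" for i
    proof -
      define k where "k y = of_bool (y \<in> fibre n T \<tau>) / marg n (insert i T) w y" for y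
      have ex: "(\<Sum>x\<in>cube n. k x * w x * marg n (insert i T) h x) = (\<Sum>x\<in>cube n. k x * h x * marg n (insert i T) w x)"
      proof (rule marg_exchange)
        fix x y assume a: "x \<in> cube n" "y \<in> fibre n (insert i T) x"
        then have "(y \<in> fibre n T \<tau>) = (x \<in> fibre n T \<tau>)" by (auto simp: fibre_def)
        then show "k y = k x" unfolding k_def marg_fibre[OF a(2)] by simp
      qed
      have fc: "(\<Sum>x\<in>cube n. of_bool (x \<in> fibre n T \<tau>) * f x) = (\<Sum>x\<in>fibre n T \<tau>. f x :: real)" for f
        by (rule sum.mono_neutral_cong_right) (auto dest: fibre_cube)
      have "(\<Sum>y\<in>fibre n T \<tau>. w y * r (y i) i)
        = (\<Sum>y\<in>fibre n T \<tau>. (w y * marg n (insert i T) h y / marg n (insert i T) w y) * (Mw \<tau> / Mh \<tau>))"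
      proof (intro sum.cong refl)
        fix y assume y: "y \<in> fibre n T \<tau>"
        then show "w y * r (y i) i = (w y * marg n (insert i T) h y / marg n (insert i T) w y) * (Mw \<tau> / Mh \<tau>)"
          using Rr[OF y, of i, symmetric] i by (simp add: D_def R_def Mh_def Mw_def marg_fibre[OF y])
      qed
      also have "\<dots> = (\<Sum>x\<in>cube n. k x * w x * marg n (insert i T) h x) * (Mw \<tau> / Mh \<tau>)"
        unfolding sum_distrib_right[symmetric] fc[symmetric] k_def by (simp add: mult_ac)
      also have "(\<Sum>x\<in>cube n. k x * w x * marg n (insert i T) h x) = Mh \<tau>"
        unfolding ex Mh_def marg_def[of n T] fc[symmetric]
      proof (intro sum.cong refl)
        fix x assume "x \<in> cube n"
        from marg_pos[OF pos this, of "insert i T"]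
        show "k x * h x * marg n (insert i T) w x = of_bool (x \<in> fibre n T \<tau>) * h x"
          by (simp add: k_def)
      qed
      finally show ?thesis using Mh by (simp add: Mw_def)
    qed
    have "marg n T g \<tau> = (\<Sum>y\<in>fibre n T \<tau>. w y * (\<Prod>i\<in>{..<n} - T. r (y i) i powr \<alpha>))"
      unfolding marg_def g_def by (intro sum.cong refl arg_cong2[of _ _ _ _ "(*)"] prod.cong) (auto simp: Rr D_def)
    also have "\<dots> \<le> marg n T w \<tau>"
      unfolding \<alpha>_def by (rule spin_poly_tangent[OF wi b n T \<tau> r0 r1])
    finally show ?thesis by (simp add: Mw_def)
  qed
  have mass: "(\<Sum>x\<in>cube n. Mh x / Mw x * g x) \<le> (\<Sum>x\<in>cube n. h x)"
  proof -
    have inv: "F (Mh y) (Mw y) = F (Mh x) (Mw x)" if "y \<in> fibre n T x" for y x and F :: "real \<Rightarrow> real \<Rightarrow> real"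
      unfolding Mh_def Mw_def using marg_fibre[OF that] by simp
    have "(\<Sum>x\<in>cube n. Mh x / Mw x * g x) = (\<Sum>x\<in>cube n. (Mh x / (Mw x * Mw x)) * g x * marg n T w x)"
      using Mwp by (intro sum.cong) (auto simp: Mw_def[symmetric] less_imp_neq[THEN not_sym])
    also have "\<dots> = (\<Sum>x\<in>cube n. (Mh x / (Mw x * Mw x)) * w x * marg n T g x)"
      by (rule marg_exchange) (rule inv[where F = "\<lambda>a b. a / (b * b)"])
    also have "\<dots> \<le> (\<Sum>x\<in>cube n. 1 / Mw x * w x * marg n T h x)"
    proof (rule sum_mono)
      fix x assume s: "x \<in> cube n"
      show "(Mh x / (Mw x * Mw x)) * w x * marg n T g x \<le> 1 / Mw x * w x * marg n T h x"
      proof (cases "Mh x = 0")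
        case True
        then show ?thesis by (simp add: Mh_def)
      next
        case False
        then have "marg n T g x \<le> Mw x" using fibre_bound[OF s] Mhn[of x] by simp
        then have "(Mh x / (Mw x * Mw x)) * w x * marg n T g x \<le> (Mh x / (Mw x * Mw x)) * w x * Mw x"
          using Mhn[of x] Mwp[OF s] pos s
          by (intro mult_left_mono mult_nonneg_nonneg divide_nonneg_nonneg) (auto simp: less_imp_le)
        also have "\<dots> = 1 / Mw x * w x * marg n T h x"
          using Mwp[OF s] by (simp add: Mh_def)
        finally show ?thesis .
      qed
    qed
    also have "\<dots> = (\<Sum>x\<in>cube n. 1 / Mw x * h x * marg n T w x)"
      by (rule marg_exchange) (rule inv[where F = "\<lambda>a b. 1 / b"])
    also have "\<dots> = (\<Sum>x\<in>cube n. h x)"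
      using Mwp by (intro sum.cong) (auto simp: Mw_def[symmetric] less_imp_neq[THEN not_sym])
    finally show ?thesis .
  qed
  (* ln v <= v - 1 at v = Mh / Mw * g / h, which is Gibbs' variational principle pointwise; at
     h = 0 the left side is at most 0. *)
  have point: "h x - Mh x / Mw x * g x
     \<le> e {..<n} x - e T x - \<alpha> * (\<Sum>i\<in>D. e (insert i T) x - e T x)"
    (is "_ \<le> ?rhs") if s: "x \<in> cube n" for x
  proof (cases "h x = 0")
    case True
    have "0 \<le> Mh x / Mw x * g x"
      unfolding g_def using Mhn[of x] Mwp[OF s] pos s
      by (intro mult_nonneg_nonneg divide_nonneg_nonneg prod_nonneg) (auto simp: less_imp_le)
    then show ?thesis using True by (simp add: e_def)
  next
    case False
    then have hp: "0 < h x" using h s by (simp add: order_less_le)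
    have mp: "0 < marg n S h x" for S using marg_ge[OF h s, of S] hp by linarith
    have wp: "0 < marg n S w x" for S by (rule marg_pos[OF pos s])
    have Rp: "0 < R i x" for i unfolding R_def Mh_def Mw_def using mp wp by simp
    have lnR: "ln (R i x) = (ln (marg n (insert i T) h x) - ln (marg n (insert i T) w x)) - (ln (Mh x) - ln (Mw x))" for i
      unfolding R_def Mh_def Mw_def 
      using mp[of T] wp[of T] mp[of "insert i T"] wp[of "insert i T"] by (simp add: ln_div ln_mult)
    have w: "0 < w x" using pos s by blast
    define P where "P = (\<Prod>i\<in>D. R i x powr \<alpha>)"
    have P: "0 < P" unfolding P_def using Rp by (intro prod_pos) (auto simp: less_imp_neq[THEN not_sym])
    have lnP: "ln P = \<alpha> * (\<Sum>i\<in>D. ln (R i x))"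
      unfolding P_def using Rp by (subst ln_prod) (auto simp: ln_powr sum_distrib_left D_def less_imp_neq[THEN not_sym])
    define v where "v = Mh x / Mw x * g x / h x"
    have Mp: "0 < Mh x" "0 < Mw x" using mp wp by (auto simp: Mh_def Mw_def)
    have vp: "0 < v" using Mp hp w P by (simp add: v_def g_def P_def[symmetric])
    have "ln v \<le> v - 1" using vp by (rule ln_le_minus_one)
    moreover have "ln v = ln (Mh x) - ln (Mw x) + ln (w x) + \<alpha> * (\<Sum>i\<in>D. ln (R i x)) - ln (h x)"
      unfolding lnP[symmetric] using Mp hp w P by (simp add: v_def g_def P_def[symmetric] ln_div ln_mult)
    ultimately have "h x * (1 - v) \<le> h x * (ln (h x) - ln (w x) - (ln (Mh x) - ln (Mw x)) - \<alpha> * (\<Sum>i\<in>D. ln (R i x)))"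
      using hp by (intro mult_left_mono) auto
    also have "\<dots> = ?rhs"
    proof -
      have "(\<Sum>i\<in>D. e (insert i T) x - e T x) = h x * (\<Sum>i\<in>D. ln (R i x))"
        unfolding lnR sum_distrib_left
        by (intro sum.cong) (simp_all add: e_def Mh_def Mw_def right_diff_distrib)
      then show ?thesis
        by (simp only:) (simp add: e_def marg_full[OF s] Mh_def Mw_def algebra_simps)
    qed
    finally show ?thesis using hp by (simp add: v_def right_diff_distrib)
  qed
  have "0 \<le> (\<Sum>x\<in>cube n. h x - Mh x / Mw x * g x)" using mass by (simp add: sum_subtractf)
  also have "\<dots> \<le> (\<Sum>x\<in>cube n. e {..<n} x - e T x - \<alpha> * (\<Sum>i\<in>D. e (insert i T) x - e T x))"
    by (intro sum_mono point)
  also have "\<dots> = rel_ent n {..<n} h w - rel_ent n T h w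
      - \<alpha> * (\<Sum>i\<in>D. rel_ent n (insert i T) h w - rel_ent n T h w)"
  proof -
    have E: "(\<Sum>x\<in>cube n. e S x) = rel_ent n S h w" for S by (simp add: rel_ent_def e_def)
    have "(\<Sum>x\<in>cube n. \<Sum>i\<in>D. e (insert i T) x - e T x)
        = (\<Sum>i\<in>D. rel_ent n (insert i T) h w - rel_ent n T h w)"
      by (subst sum.swap) (simp add: sum_subtractf E)
    then show ?thesis unfolding sum_subtractf[of _ _ "cube n"] sum_distrib_left[symmetric] E by simp
  qed
  finally have "\<alpha> * (\<Sum>i\<in>D. rel_ent n (insert i T) h w - rel_ent n T h w) \<le> rel_ent n {..<n} h w - rel_ent n T h w"
    by simp
  then have "(1 + 4 * \<beta>) * (\<alpha> * (\<Sum>i\<in>D. rel_ent n (insert i T) h w - rel_ent n T h w))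
     \<le> (1 + 4 * \<beta>) * (rel_ent n {..<n} h w - rel_ent n T h w)"
    using b0 by (intro mult_left_mono) auto
  moreover have "(1 + 4 * \<beta>) * (\<alpha> * y) = y" for y using b0 by (simp add: \<alpha>_def)
  ultimately show ?thesis by (simp add: D_def)
qed

lemma tensorization_constant:
  fixes b :: real
  assumes b: "0 \<le> b" "b \<le> 1/2" and r: "2 \<le> r"
  shows "(\<Prod>j\<in>{1..<r}. real j / (real j - b)) \<le> 2 * real (r - 1) powr b"
  using r
proof (induction r rule: dec_induct)
  case base
  have "{1..<2::nat} = {1}" by auto
  then show ?case using b by (simp add: divide_le_eq)
next
  case (step r)
  define x where "x = real r"
  have x: "x \<ge> 2" using step by (simp add: x_def)
  (* Bernoulli's inequality (1 - 1/x)^b <= 1 - b/x. *)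
  have young: "((x - 1) / x) powr b \<le> (x - b) / x"
  proof -
    have "((x - 1) / x) powr b * 1 powr (1 - b) \<le> b * ((x - 1) / x) + (1 - b) * 1"
      using b x by (intro Youngs_inequality_0) auto
    also have "\<dots> = (x - b) / x" using x by (simp add: field_simps)
    finally show ?thesis by simp
  qed
  have "(\<Prod>j\<in>{1..<Suc r}. real j / (real j - b)) = (\<Prod>j\<in>{1..<r}. real j / (real j - b)) * (x / (x - b))"
    using step by (simp add: prod.atLeastLessThan_Suc x_def)
  also have "\<dots> \<le> (2 * (x - 1) powr b) * (x / (x - b))"
    using step x b by (intro mult_right_mono) (auto simp: x_def of_nat_diff)
  also have "(x - 1) powr b = ((x - 1) / x) powr b * x powr b" using x by (simp add: powr_divide)
  also have "(2 * (((x - 1) / x) powr b * x powr b)) * (x / (x - b)) \<le> (2 * ((x - b) / x * x powr b)) * (x / (x - b))"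
    using young x b by (intro mult_right_mono mult_left_mono) auto
  also have "\<dots> = 2 * x powr b" using x b by simp
  finally show ?case by (simp add: x_def)
qed

text \<open>Here \<open>B R\<close> stands for the entropy left in the spins of \<open>R\<close> when the others are known. The assumption
  bounds \<open>(card R - 1 - b) * B R\<close> by the sum of \<open>B\<close> over the sets with one spin less, and the
  factors multiply.\<close>

lemma tensorization_induction:
  fixes B :: "'a set \<Rightarrow> real"
  assumes b: "0 \<le> b" "b \<le> 1/2"
    and step: "\<And>R. R \<subseteq> S \<Longrightarrow> (\<Sum>i\<in>R. B R - B (R - {i})) \<le> (1 + b) * B R"
    and R: "finite R" "R \<subseteq> S" "R \<noteq> {}"
  shows "B R \<le> (\<Prod>j\<in>{1..<card R}. real j / (real j - b)) * (\<Sum>v\<in>R. B {v})"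
  using R
proof (induction "card R" arbitrary: R)
  case 0
  then show ?case by simp
next
  case (Suc r)
  let ?c = "\<lambda>r. \<Prod>j\<in>{1..<r}. real j / (real j - b)"
  show ?case
  proof (cases "r = 0")
    case True
    then obtain v where "R = {v}" using Suc by (metis One_nat_def card_1_singletonE)
    then show ?thesis by simp
  next
    case False
    have card: "card R = Suc r" using Suc by simp
    have ih: "B (R - {i}) \<le> ?c r * (\<Sum>v\<in>R - {i}. B {v})" if "i \<in> R" for i
    proof -
      have "card (R - {i}) = r" using that card by simp
      moreover from this have "R - {i} \<noteq> {}" using False by force
      ultimately show ?thesis using Suc.hyps(1)[of "R - {i}"] Suc.prems by auto
    qed
    have "(\<Sum>i\<in>R. B R - B (R - {i})) = real (Suc r) * B R - (\<Sum>i\<in>R. B (R - {i}))"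
      by (simp add: sum_subtractf card)
    with step[OF Suc.prems(2)] have "(real r - b) * B R \<le> (\<Sum>i\<in>R. B (R - {i}))"
      by (simp add: algebra_simps)
    also have "\<dots> \<le> (\<Sum>i\<in>R. ?c r * (\<Sum>v\<in>R - {i}. B {v}))" by (intro sum_mono ih)
    also have "\<dots> = ?c r * (\<Sum>i\<in>R. (\<Sum>v\<in>R. B {v}) - B {i})"
      unfolding sum_distrib_left
      by (intro sum.cong refl) (simp add: sum_diff1 Suc.prems(1) flip: sum_distrib_left)
    also have "\<dots> = ?c r * (real r * (\<Sum>v\<in>R. B {v}))"
      by (simp add: sum_subtractf card algebra_simps)
    finally have "B R \<le> ?c r * (real r * (\<Sum>v\<in>R. B {v})) / (real r - b)"
      using False b by (subst pos_le_divide_eq) (auto simp: mult.commute)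
    also have "\<dots> = ?c (card R) * (\<Sum>v\<in>R. B {v})"
      using False by (simp add: card prod.atLeastLessThan_Suc)
    finally show ?thesis .
  qed
qed

text \<open>The chain rule is built into \<open>rel_ent\<close>: conditional entropies are differences.\<close>

theorem rel_ent_tensorization:
  assumes wi: "weakly_interacting n w \<beta>" and b: "\<beta> \<le> 1/3000" and n: "2 \<le> n"
    and h: "\<forall>x\<in>cube n. 0 \<le> h x"
  shows "rel_ent n {..<n} h w - rel_ent n {} h w
    \<le> 2 * real n powr (4 * \<beta>) * (\<Sum>v<n. rel_ent n {..<n} h w - rel_ent n ({..<n} - {v}) h w)"
proof -
  define B where "B R = rel_ent n {..<n} h w - rel_ent n ({..<n} - R) h w" for R
  note b0 = weakly_interacting_nonneg[OF wi]
  have step: "(\<Sum>i\<in>R. B R - B (R - {i})) \<le> (1 + 4 * \<beta>) * B R" if "R \<subseteq> {..<n}" for R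
  proof -
    have "{..<n} - ({..<n} - R) = R" using that by auto
    moreover have "{..<n} - (R - {i}) = insert i ({..<n} - R)" if "i \<in> R" for i
      using that \<open>R \<subseteq> _\<close> by auto
    ultimately show ?thesis
      using entropic_independence[OF wi b _ _ h, of "{..<n} - R"] n by (simp add: B_def)
  qed
  have Bv: "0 \<le> (\<Sum>v<n. B {v})"
  proof -
    (* With one free spin the independence inequality reads B {v} <= (1 + 4 beta) B {v}, which
       gives a sign only for positive beta. *)
    have "weakly_interacting n w (1/3000)" using wi b by (rule weakly_interacting_mono)
    note wi' = this
    have "B {v} \<ge> 0" if "v < n" for v
    proof -
      have "{..<n} - ({..<n} - {v}) = {v}" "insert v ({..<n} - {v}) = {..<n}" using that by auto
      then show ?thesis
        using entropic_independence[OF wi' _ _ _ h, of "{..<n} - {v}"] n by (simp add: B_def)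
    qed
    then show ?thesis by (intro sum_nonneg) auto
  qed
  have "B {..<n} \<le> (\<Prod>j\<in>{1..<card {..<n}}. real j / (real j - 4 * \<beta>)) * (\<Sum>v<n. B {v})"
    by (rule tensorization_induction[where S = "{..<n}", OF _ _ step]) (use b b0 n in \<open>auto simp: lessThan_empty_iff\<close>)
  also have "\<dots> \<le> (2 * real n powr (4 * \<beta>)) * (\<Sum>v<n. B {v})"
  proof (rule mult_right_mono[OF _ Bv])
    have "(\<Prod>j\<in>{1..<n}. real j / (real j - 4 * \<beta>)) \<le> 2 * real (n - 1) powr (4 * \<beta>)"
      using b b0 n by (intro tensorization_constant) auto
    also have "\<dots> \<le> 2 * real n powr (4 * \<beta>)" using b0 by (auto intro!: powr_mono2)
    finally show "(\<Prod>j\<in>{1..<card {..<n}}. real j / (real j - 4 * \<beta>)) \<le> 2 * real n powr (4 * \<beta>)" by simp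
  qed
  finally show ?thesis by (simp add: B_def)
qed

section \<open>Glauber dynamics\<close>

lemma expectation_cube:
  fixes f :: "(nat \<Rightarrow> real) \<Rightarrow> real"
  assumes "set_pmf p \<subseteq> cube n"
  shows "measure_pmf.expectation p f = (\<Sum>x\<in>cube n. pmf p x * f x)"
  using assms by (subst integral_measure_pmf[of "cube n"]) auto

lemma pmf_cube_sum: "set_pmf p \<subseteq> cube n \<Longrightarrow> (\<Sum>x\<in>cube n. pmf p x) = 1"
  by (intro sum_pmf_eq_1) auto

lemma pmf_glauber:
  assumes "0 < n"
  shows "pmf (glauber n \<mu> x) y = (\<Sum>i<n. pmf (resample n \<mu> i x) y) / real n"
  unfolding glauber_def using assms by (subst pmf_bind_pmf_of_set) (auto simp: lessThan_empty_iff)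

text \<open>A conditional expectation has the same mean.\<close>

lemma sum_resample_average:
  assumes pos: "\<forall>x\<in>cube n. 0 < w x" and i: "i < n"
  shows "(\<Sum>x\<in>cube n. w x * ((a x + a (flip i x)) / (w x + w (flip i x)))) = (\<Sum>x\<in>cube n. a x :: real)"
proof -
  have "w x * ((a x + a (flip i x)) / (w x + w (flip i x)))
      + w (flip i x) * ((a (flip i x) + a (flip i (flip i x))) / (w (flip i x) + w (flip i (flip i x))))
     = a x + a (flip i x)" if "x \<in> cube n" for x
  proof -
    have "0 < w x + w (flip i x)" using pos that i by (auto intro!: add_pos_pos)
    then have "(w x + w (flip i x)) * ((a x + a (flip i x)) / (w x + w (flip i x))) = a x + a (flip i x)"
      by simp
    then show ?thesis by (simp add: distrib_right add.commute add_divide_distrib)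
  qed
  then show ?thesis
    unfolding sum_flip_average[OF i, of "\<lambda>x. w x * ((a x + a (flip i x)) / (w x + w (flip i x)))"]
      sum_flip_average[OF i, of a]
    by simp
qed

definition spin_set :: "nat \<Rightarrow> (nat \<Rightarrow> real) \<Rightarrow> (real \<times> nat) set" where
  "spin_set n x = (\<lambda>i. (x i, i)) ` {..<n}"

lemma inj_spin_set: "inj_on (spin_set n) (cube n)"
proof (rule inj_onI)
  fix x \<tau> assume s: "x \<in> cube n" "\<tau> \<in> cube n" and e: "spin_set n x = spin_set n \<tau>"
  show "x = \<tau>"
  proof (rule cube_eqI[OF s])
    fix i assume "i < n"
    then have "(x i, i) \<in> spin_set n \<tau>" unfolding e[symmetric] by (auto simp: spin_set_def)
    then show "x i = \<tau> i" by (auto simp: spin_set_def)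
  qed
qed

lemma spin_set_props:
  assumes "x \<in> cube n"
  shows "spin_set n x \<subseteq> {-1, 1} \<times> {..<n}" "card (spin_set n x) = n"
    "(\<Prod>p\<in>spin_set n x. z p) = (\<Prod>i<n. z (x i, i) :: real)"
proof -
  have inj: "inj_on (\<lambda>i. (x i, i)) {..<n}" by (auto simp: inj_on_def)
  show "spin_set n x \<subseteq> {-1, 1} \<times> {..<n}" using cube_site[OF assms] by (auto simp: spin_set_def)
  show "card (spin_set n x) = n" using card_image[OF inj] by (simp add: spin_set_def)
  show "(\<Prod>p\<in>spin_set n x. z p) = (\<Prod>i<n. z (x i, i))"
    unfolding spin_set_def using prod.reindex[OF inj, of z] by simp
qed

lemma relative_entropy_ge:
  fixes p q :: real
  assumes "0 \<le> p" "0 \<le> q" "q = 0 \<longrightarrow> p = 0"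
  shows "p - q \<le> p * (ln p - ln q)"
proof (cases "p = 0")
  case True
  then show ?thesis using assms by simp
next
  case False
  then have p: "0 < p" and q: "0 < q" using assms by auto
  have "ln (q / p) \<le> q / p - 1" using p q by (intro ln_le_minus_one) auto
  then have "p * (1 - q / p) \<le> p * (ln p - ln q)" using p q by (intro mult_left_mono) (auto simp: ln_div)
  then show ?thesis using p by (simp add: right_diff_distrib)
qed

lemma glauber_steps_Suc: "glauber_steps n \<mu> (Suc t) x = bind_pmf (glauber_steps n \<mu> t x) (glauber n \<mu>)"
  by (simp add: glauber_steps_def)

context
  fixes n :: nat and \<mu> :: "(nat \<Rightarrow> real) pmf"
  assumes supp: "set_pmf \<mu> = cube n"
begin

lemma mu_pos: "\<forall>x\<in>cube n. 0 < pmf \<mu> x"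
  using supp by (metis pmf_positive)

lemma mu_support: "set_pmf \<mu> \<subseteq> cube n"
  using supp by simp

lemma pmf_resample:
  assumes s: "x \<in> cube n" and i: "i < n"
  shows "pmf (resample n \<mu> i x) y
    = (if y = x \<or> y = flip i x then pmf \<mu> y / (pmf \<mu> x + pmf \<mu> (flip i x)) else 0)"
proof -
  let ?S = "{\<tau>. \<forall>j<n. j \<noteq> i \<longrightarrow> \<tau> j = x j}"
  have S: "?S \<inter> cube n = {x, flip i x}"
    using eq_or_flip[OF _ s i] s i by (auto simp: flip_other)
  have "measure_pmf.prob \<mu> ?S = measure_pmf.prob \<mu> (?S \<inter> cube n)"
    using measure_Int_set_pmf[of \<mu> ?S] supp by simp
  also have "\<dots> = pmf \<mu> x + pmf \<mu> (flip i x)"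
    unfolding S using flip_neq[OF s i] by (subst measure_measure_pmf_finite) auto
  finally have m: "measure_pmf.prob \<mu> ?S = pmf \<mu> x + pmf \<mu> (flip i x)" .
  have ne: "set_pmf \<mu> \<inter> ?S \<noteq> {}" using S supp by auto
  have "pmf (resample n \<mu> i x) y = (if y \<in> ?S then pmf \<mu> y / (pmf \<mu> x + pmf \<mu> (flip i x)) else 0)"
    unfolding resample_def pmf_cond[OF ne] m ..
  also have "\<dots> = (if y = x \<or> y = flip i x then pmf \<mu> y / (pmf \<mu> x + pmf \<mu> (flip i x)) else 0)"
  proof (cases "y \<in> cube n")
    case True
    then have "y \<in> ?S \<longleftrightarrow> y = x \<or> y = flip i x" using S by auto
    then show ?thesis by simp
  next
    case False
    then have "pmf \<mu> y = 0" using supp by (simp add: pmf_eq_0_set_pmf)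
    then show ?thesis by (simp only: div_0 if_cancel)
  qed
  finally show ?thesis .
qed

lemma sum_resample:
  assumes s: "x \<in> cube n" and i: "i < n"
  shows "(\<Sum>y\<in>cube n. pmf (resample n \<mu> i x) y * g y)
    = (pmf \<mu> x * g x + pmf \<mu> (flip i x) * g (flip i x)) / (pmf \<mu> x + pmf \<mu> (flip i x))"
proof -
  have "(\<Sum>y\<in>cube n. pmf (resample n \<mu> i x) y * g y) = (\<Sum>y\<in>{x, flip i x}. pmf (resample n \<mu> i x) y * g y)"
    by (rule sum.mono_neutral_right) (use s i in \<open>auto simp: pmf_resample[OF s i]\<close>)
  also have "\<dots> = (pmf \<mu> x * g x + pmf \<mu> (flip i x) * g (flip i x)) / (pmf \<mu> x + pmf \<mu> (flip i x))"
    using flip_neq[OF s i] by (simp add: pmf_resample[OF s i] add_divide_distrib)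
  finally show ?thesis .
qed

lemma set_resample:
  assumes "x \<in> cube n" "i < n"
  shows "set_pmf (resample n \<mu> i x) \<subseteq> cube n"
proof
  fix y assume "y \<in> set_pmf (resample n \<mu> i x)"
  then have "pmf (resample n \<mu> i x) y \<noteq> 0" by (simp add: set_pmf_iff)
  then have "y = x \<or> y = flip i x" unfolding pmf_resample[OF assms] by presburger
  then show "y \<in> cube n" using assms(1) flip_cube[OF assms] by metis
qed

lemma dirichlet_form_flips:
  assumes n: "0 < n"
  shows "dirichlet_form n \<mu> f g = (\<Sum>i<n. \<Sum>x\<in>cube n.
    pmf \<mu> x * pmf \<mu> (flip i x) * (f x - f (flip i x)) * (g x - g (flip i x))
      / (pmf \<mu> x + pmf \<mu> (flip i x))) / (2 * real n)"
proof -
  have "(\<Sum>x\<in>cube n. \<Sum>y\<in>cube n. pmf \<mu> x * pmf (glauber n \<mu> x) y * (f x - f y) * (g x - g y))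
    = (\<Sum>x\<in>cube n. \<Sum>i<n. pmf \<mu> x * pmf \<mu> (flip i x) * (f x - f (flip i x)) * (g x - g (flip i x))
      / (pmf \<mu> x + pmf \<mu> (flip i x))) / real n"
    unfolding sum_divide_distrib
  proof (intro sum.cong refl)
    fix x assume x: "x \<in> cube n"
    have "(\<Sum>y\<in>cube n. pmf \<mu> x * pmf (glauber n \<mu> x) y * (f x - f y) * (g x - g y))
      = (\<Sum>y\<in>cube n. \<Sum>i<n. pmf \<mu> x * (pmf (resample n \<mu> i x) y * ((f x - f y) * (g x - g y))) / real n)"
      unfolding pmf_glauber[OF n] by (intro sum.cong refl)
        (simp add: sum_distrib_left sum_distrib_right sum_divide_distrib mult_ac)
    also have "\<dots> = (\<Sum>i<n. pmf \<mu> x * (\<Sum>y\<in>cube n. pmf (resample n \<mu> i x) y * ((f x - f y) * (g x - g y))) / real n)"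
      unfolding sum_distrib_left sum_divide_distrib by (rule sum.swap)
    also have "\<dots> = (\<Sum>i<n. pmf \<mu> x * pmf \<mu> (flip i x) * (f x - f (flip i x)) * (g x - g (flip i x))
      / (pmf \<mu> x + pmf \<mu> (flip i x)) / real n)"
    proof (intro sum.cong refl)
      fix i assume "i \<in> {..<n}"
      then have "(\<Sum>y\<in>cube n. pmf (resample n \<mu> i x) y * ((f x - f y) * (g x - g y)))
        = pmf \<mu> (flip i x) * ((f x - f (flip i x)) * (g x - g (flip i x))) / (pmf \<mu> x + pmf \<mu> (flip i x))"
        by (subst sum_resample[OF x]) auto
      then show "pmf \<mu> x * (\<Sum>y\<in>cube n. pmf (resample n \<mu> i x) y * ((f x - f y) * (g x - g y))) / real n
        = pmf \<mu> x * pmf \<mu> (flip i x) * (f x - f (flip i x)) * (g x - g (flip i x))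
          / (pmf \<mu> x + pmf \<mu> (flip i x)) / real n"
        by (simp add: mult.assoc)
    qed
    finally show "(\<Sum>y\<in>cube n. pmf \<mu> x * pmf (glauber n \<mu> x) y * (f x - f y) * (g x - g y)) = \<dots>" .
  qed
  then show ?thesis unfolding dirichlet_form_def by (subst sum.swap) simp
qed

lemma dirichlet_form_eq:
  assumes n: "0 < n"
  shows "dirichlet_form n \<mu> f f = dirichlet n (pmf \<mu>) f / real n"
proof -
  let ?w = "pmf \<mu>"
  have "(\<Sum>x\<in>cube n. ?w x * (cond_dev ?w i f x)\<^sup>2)
     = (\<Sum>x\<in>cube n. ?w x * ?w (flip i x) * (f x - f (flip i x)) * (f x - f (flip i x)) / (?w x + ?w (flip i x))) / 2"
    if i: "i < n" for i
  proof -
    define X where "X x = ?w x * ?w (flip i x) * (f x - f (flip i x))\<^sup>2 / (?w x + ?w (flip i x))" for x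
    have X: "X (flip i x) = X x" for x
      by (simp add: X_def mult.commute add.commute power2_commute)
    have "(\<Sum>x\<in>cube n. ?w x * (cond_dev ?w i f x)\<^sup>2)
        = (\<Sum>x\<in>cube n. ?w (flip i x) * (X x / (?w x + ?w (flip i x))))"
      by (intro sum.cong refl) (simp add: cond_dev_def X_def power2_eq_square)
    also have "\<dots> = (\<Sum>x\<in>cube n. ?w x * (X x / (?w x + ?w (flip i x))))"
      using sum_flip[OF i, of "\<lambda>x. ?w x * (X x / (?w x + ?w (flip i x)))"] by (simp add: X add.commute)
    also have "\<dots> = (\<Sum>x\<in>cube n. X x / 2)"
      using sum_resample_average[OF mu_pos i, of "\<lambda>x. X x / 2"] by (simp add: X)
    finally show ?thesis by (simp add: X_def sum_divide_distrib power2_eq_square mult.assoc)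
  qed
  then have "dirichlet n ?w f = (\<Sum>i<n. (\<Sum>x\<in>cube n.
      ?w x * ?w (flip i x) * (f x - f (flip i x)) * (f x - f (flip i x)) / (?w x + ?w (flip i x))) / 2)"
    unfolding dirichlet_eq_sum by (intro sum.cong refl) auto
  then have D: "dirichlet n ?w f = (\<Sum>i<n. \<Sum>x\<in>cube n.
      ?w x * ?w (flip i x) * (f x - f (flip i x)) * (f x - f (flip i x)) / (?w x + ?w (flip i x))) / 2"
    unfolding sum_divide_distrib[symmetric] .
  show ?thesis unfolding dirichlet_form_flips[OF n] D by simp
qed

lemma variance_eq_wvar:
  shows "measure_pmf.variance \<mu> f = wvar n (pmf \<mu>) f"
proof -
  define m where "m = (\<Sum>x\<in>cube n. pmf \<mu> x * f x)"
  note one = pmf_cube_sum[OF mu_support]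
  have "measure_pmf.variance \<mu> f = (\<Sum>x\<in>cube n. pmf \<mu> x * (f x - m)\<^sup>2)"
    by (simp add: expectation_cube[OF mu_support] m_def)
  also have "\<dots> = (\<Sum>x\<in>cube n. pmf \<mu> x * (f x)\<^sup>2) - 2 * m * (\<Sum>x\<in>cube n. pmf \<mu> x * f x)
      + m\<^sup>2 * (\<Sum>x\<in>cube n. pmf \<mu> x)"
    unfolding sum_distrib_left sum_subtractf[symmetric] sum.distrib[symmetric]
    by (intro sum.cong) (simp_all add: power2_eq_square algebra_simps)
  also have "\<dots> = wvar n (pmf \<mu>) f"
    unfolding wvar_def one m_def[symmetric] by (simp add: power2_eq_square)
  finally show ?thesis .
qed

text \<open>The greatest element exists: it is the infimum of the Rayleigh quotients over the functions of
  positive variance, and there is such a function because a cube of positive dimension has more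
  than one point.\<close>

lemma spectral_gap_greatest:
  assumes n: "0 < n"
    and valid: "\<And>f. \<gamma> * measure_pmf.variance \<mu> f \<le> dirichlet_form n \<mu> f f"
  shows "\<gamma> \<le> spectral_gap n \<mu>"
proof -
  let ?D = "\<lambda>f. dirichlet_form n \<mu> f f"
  let ?V = "\<lambda>f :: (nat \<Rightarrow> real) \<Rightarrow> real. measure_pmf.variance \<mu> f"
  define V where "V = {f :: (nat \<Rightarrow> real) \<Rightarrow> real. 0 < ?V f}"
  define q where "q f = ?D f / ?V f" for f
  define g where "g = (INF f\<in>V. q f)"
  have D0: "0 \<le> ?D f" for f
    unfolding dirichlet_form_eq[OF n] using dirichlet_nonneg[OF mu_pos] by simp
  have Vn0: "0 \<le> ?V f" for f :: "(nat \<Rightarrow> real) \<Rightarrow> real"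
    by (rule integral_nonneg_AE) simp
  have "V \<noteq> {}"
  proof -
    obtain \<tau> where s: "\<tau> \<in> cube n" using cube_nonempty by blast
    define f :: "(nat \<Rightarrow> real) \<Rightarrow> real" where "f x = of_bool (x = \<tau>)" for x
      have "(\<Sum>x\<in>cube n. pmf \<mu> x * f x) = pmf \<mu> \<tau>" "(\<Sum>x\<in>cube n. pmf \<mu> x * (f x)\<^sup>2) = pmf \<mu> \<tau>"
    proof -
      have sq: "(f x)\<^sup>2 = f x" for x by (simp add: f_def)
      show "(\<Sum>x\<in>cube n. pmf \<mu> x * f x) = pmf \<mu> \<tau>"
        using s by (simp add: f_def of_bool_def if_distrib cong: if_cong)
      then show "(\<Sum>x\<in>cube n. pmf \<mu> x * (f x)\<^sup>2) = pmf \<mu> \<tau>" unfolding sq .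
    qed
    then have v: "?V f = pmf \<mu> \<tau> - (pmf \<mu> \<tau>)\<^sup>2"
      unfolding variance_eq_wvar wvar_def pmf_cube_sum[OF mu_support] by simp
    have "pmf \<mu> \<tau> + pmf \<mu> (flip 0 \<tau>) \<le> (\<Sum>x\<in>cube n. pmf \<mu> x)"
    proof -
      have "(\<Sum>x\<in>{\<tau>, flip 0 \<tau>}. pmf \<mu> x) \<le> (\<Sum>x\<in>cube n. pmf \<mu> x)"
        using s n by (intro sum_mono2) auto
      then show ?thesis using flip_neq[OF s n] by simp
    qed
    moreover have "0 < pmf \<mu> (flip 0 \<tau>)" "0 < pmf \<mu> \<tau>" using mu_pos s n by auto
    ultimately have "pmf \<mu> \<tau> < 1" using pmf_cube_sum[OF mu_support] by simp
    then have "0 < pmf \<mu> \<tau> * (1 - pmf \<mu> \<tau>)" using \<open>0 < pmf \<mu> \<tau>\<close> by simp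
    then have "f \<in> V" unfolding V_def mem_Collect_eq v by (simp add: algebra_simps power2_eq_square)
    then show ?thesis by blast
  qed
  have bdd: "bdd_below (q ` V)" using D0 Vn0 by (intro bdd_belowI2[of _ 0]) (auto simp: q_def)
  have "spectral_gap n \<mu> = g"
    unfolding spectral_gap_def
  proof (rule Greatest_equality)
    show "\<forall>f. g * ?V f \<le> ?D f"
    proof
      fix f
      show "g * ?V f \<le> ?D f"
      proof (cases "f \<in> V")
        case True
        then have "g \<le> q f" unfolding g_def using bdd by (intro cINF_lower)
        then show ?thesis using True by (simp add: q_def V_def pos_le_divide_eq)
      next
        case False
        then have "?V f = 0" using Vn0[of f] by (simp add: V_def)
        then show ?thesis using D0 by simp
      qed
    qed
  next
    fix y assume y: "\<forall>f. y * ?V f \<le> ?D f"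
    show "y \<le> g" unfolding g_def
      using \<open>V \<noteq> {}\<close> y by (intro cINF_greatest) (auto simp: V_def q_def pos_le_divide_eq)
  qed
  moreover have "\<gamma> \<le> g" unfolding g_def
    using \<open>V \<noteq> {}\<close> valid by (intro cINF_greatest) (auto simp: V_def q_def pos_le_divide_eq)
  ultimately show ?thesis by simp
qed

theorem spectral_gap_bound:
  assumes n: "0 < n"
    and wi: "weakly_interacting n (pmf \<mu>) \<beta>" and b: "\<beta> \<le> 1/3000"
  shows "1 / ((1 + 4 * \<beta>) * real n) \<le> spectral_gap n \<mu>"
proof (rule spectral_gap_greatest[OF n])
  fix f
  note b0 = weakly_interacting_nonneg[OF wi]
  have "wvar n (pmf \<mu>) f \<le> (1 + 4 * \<beta>) * dirichlet n (pmf \<mu>) f"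
    by (rule weakly_interacting_poincare[OF wi b n])
  then have "wvar n (pmf \<mu>) f / ((1 + 4 * \<beta>) * real n) \<le> (1 + 4 * \<beta>) * dirichlet n (pmf \<mu>) f / ((1 + 4 * \<beta>) * real n)"
    using b0 n by (intro divide_right_mono) auto
  also have "\<dots> = dirichlet n (pmf \<mu>) f / real n" using b0 by simp
  finally show "1 / ((1 + 4 * \<beta>) * real n) * measure_pmf.variance \<mu> f \<le> dirichlet_form n \<mu> f f"
    unfolding variance_eq_wvar dirichlet_form_eq[OF n] by simp
qed

lemma gen_poly_homogenization:
  shows "gen_poly ({-1, 1} \<times> {..<n}) n (homogenization n \<mu>) (\<lambda>p. z p powr \<alpha>) = spin_poly n (pmf \<mu>) \<alpha> z"
proof -
  have hom: "homogenization n \<mu> = map_pmf (spin_set n) \<mu>"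
    by (simp add: homogenization_def spin_set_def[abs_def])
  have fin: "finite {S. S \<subseteq> {-1, 1 :: real} \<times> {..<n} \<and> card S = n}"
    by (rule finite_subset[of _ "Pow ({-1, 1 :: real} \<times> {..<n})"]) auto
  have "gen_poly ({-1, 1} \<times> {..<n}) n (homogenization n \<mu>) (\<lambda>p. z p powr \<alpha>)
     = (\<Sum>S\<in>spin_set n ` cube n. pmf (homogenization n \<mu>) S * (\<Prod>p\<in>S. z p powr \<alpha>))"
    unfolding gen_poly_def
  proof (rule sum.mono_neutral_right[OF fin])
    show "spin_set n ` cube n \<subseteq> {S. S \<subseteq> {-1, 1} \<times> {..<n} \<and> card S = n}"
      using spin_set_props by blast
    have "pmf (homogenization n \<mu>) S = 0" if "S \<notin> spin_set n ` cube n" for S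
      using that supp by (simp add: hom set_pmf_iff[symmetric] pmf_eq_0_set_pmf)
    then show "\<forall>S\<in>{S. S \<subseteq> {-1, 1} \<times> {..<n} \<and> card S = n} - spin_set n ` cube n.
        pmf (homogenization n \<mu>) S * (\<Prod>p\<in>S. z p powr \<alpha>) = 0" by auto
  qed
  also have "\<dots> = (\<Sum>x\<in>cube n. pmf (homogenization n \<mu>) (spin_set n x) * (\<Prod>p\<in>spin_set n x. z p powr \<alpha>))"
    by (simp add: sum.reindex[OF inj_spin_set])
  also have "\<dots> = spin_poly n (pmf \<mu>) \<alpha> z"
    unfolding spin_poly_def
  proof (intro sum.cong refl arg_cong2[of _ _ _ _ "(*)"])
    fix x assume s: "x \<in> cube n"
    show "pmf (homogenization n \<mu>) (spin_set n x) = pmf \<mu> x"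
      unfolding hom by (rule pmf_map_inj) (use inj_spin_set s supp in auto)
    show "(\<Prod>p\<in>spin_set n x. z p powr \<alpha>) = (\<Prod>i<n. z (x i, i) powr \<alpha>)"
      by (rule spin_set_props(3)[OF s])
  qed
  finally show ?thesis .
qed

theorem homogenization_fractionally_log_concave:
  assumes n: "0 < n"
    and wi: "weakly_interacting n (pmf \<mu>) \<beta>" and b: "\<beta> \<le> 1/3000"
  shows "fractionally_log_concave ({-1, 1} \<times> {..<n}) n (homogenization n \<mu>) (1 / (1 + 4 * \<beta>))"
  unfolding fractionally_log_concave_def Let_def
proof (intro conjI allI impI)
  note b0 = weakly_interacting_nonneg[OF wi]
  then show "0 \<le> 1 / (1 + 4 * \<beta>)" "1 / (1 + 4 * \<beta>) \<le> 1" by auto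
  show "finite ({-1, 1 :: real} \<times> {..<n})" by simp
  show "set_pmf (homogenization n \<mu>) \<subseteq> {S. S \<subseteq> {-1, 1} \<times> {..<n} \<and> card S = n}"
    using spin_set_props supp by (auto simp: homogenization_def spin_set_def[symmetric])
  fix z y :: "real \<times> nat \<Rightarrow> real" and t :: real
  assume z: "\<forall>i\<in>{-1, 1} \<times> {..<n}. 0 \<le> z i" and y: "\<forall>i\<in>{-1, 1} \<times> {..<n}. 0 \<le> y i"
    and t: "0 \<le> t" "t \<le> 1"
  define G where "G = spin_poly n (pmf \<mu>) (1 / (1 + 4 * \<beta>))"
  have G0: "0 \<le> G x" for x
    unfolding G_def spin_poly_def by (intro sum_nonneg mult_nonneg_nonneg prod_nonneg) auto
  have "ereal (1 - t) * elog (G z) + ereal t * elog (G y) \<le> elog (G (\<lambda>i. (1 - t) * z i + t * y i))"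
  proof (cases "t = 0 \<or> t = 1")
    case True
    then show ?thesis by (elim disjE) (simp_all flip: zero_ereal_def one_ereal_def)
  next
    case False
    then have t': "0 < t" "t < 1" using t by auto
    show ?thesis
    proof (cases "G z = 0 \<or> G y = 0")
      case True
      then have e: "ereal (1 - t) * elog (G z) + ereal t * elog (G y) = - \<infinity>"
        using t' by (auto simp: elog_def)
      show ?thesis unfolding e by simp
    next
      case False
      then have p: "0 < G z" "0 < G y" using G0[of z] G0[of y] by auto
      have ineq: "G z powr (1 - t) * G y powr t \<le> G (\<lambda>i. (1 - t) * z i + t * y i)" (is "_ \<le> ?m")
        unfolding G_def using z y by (intro spin_poly_log_concave[OF wi b n _ _ t']) auto
      have m: "0 < ?m" using ineq p by (intro less_le_trans[OF _ ineq]) auto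
      have "ln (G z powr (1 - t) * G y powr t) \<le> ln ?m" using ineq p m by (subst ln_le_cancel_iff) auto
      then have "(1 - t) * ln (G z) + t * ln (G y) \<le> ln ?m" using p by (simp add: ln_mult ln_powr)
      then show ?thesis using p m by (simp add: elog_def)
    qed
  qed
  then show "ereal (1 - t) * elog (gen_poly ({-1, 1} \<times> {..<n}) n (homogenization n \<mu>) (\<lambda>i. z i powr (1 / (1 + 4 * \<beta>)))) +
     ereal t * elog (gen_poly ({-1, 1} \<times> {..<n}) n (homogenization n \<mu>) (\<lambda>i. y i powr (1 / (1 + 4 * \<beta>))))
     \<le> elog (gen_poly ({-1, 1} \<times> {..<n}) n (homogenization n \<mu>)
           (\<lambda>i. ((1 - t) * z i + t * y i) powr (1 / (1 + 4 * \<beta>))))"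
    unfolding gen_poly_homogenization G_def .
qed

section \<open>Entropy and mixing\<close>

lemma rel_ent_full_density:
  assumes f: "\<forall>x\<in>cube n. 0 \<le> f x"
  shows "rel_ent n {..<n} (\<lambda>x. pmf \<mu> x * f x) (pmf \<mu>) = (\<Sum>x\<in>cube n. pmf \<mu> x * (f x * ln (f x)))"
  unfolding rel_ent_def
proof (intro sum.cong refl)
  fix x assume s: "x \<in> cube n"
  show "pmf \<mu> x * f x * (ln (marg n {..<n} (\<lambda>x. pmf \<mu> x * f x) x) - ln (marg n {..<n} (pmf \<mu>) x))
     = pmf \<mu> x * (f x * ln (f x))"
  proof (cases "f x = 0")
    case False
    then have "f x > 0" "pmf \<mu> x > 0" using f mu_pos s by (auto simp: order_less_le)
    then show ?thesis using s by (simp add: marg_full ln_mult)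
  qed simp
qed

lemma rel_ent_density:
  assumes f: "\<forall>x\<in>cube n. 0 \<le> f x"
  shows "Ent \<mu> f = rel_ent n {..<n} (\<lambda>x. pmf \<mu> x * f x) (pmf \<mu>) - rel_ent n {} (\<lambda>x. pmf \<mu> x * f x) (pmf \<mu>)"
proof -
  have "rel_ent n {} (\<lambda>x. pmf \<mu> x * f x) (pmf \<mu>)
     = (\<Sum>x\<in>cube n. pmf \<mu> x * f x) * ln (\<Sum>x\<in>cube n. pmf \<mu> x * f x)"
    unfolding rel_ent_def marg_empty pmf_cube_sum[OF mu_support] by (simp add: sum_distrib_right)
  then show ?thesis
    unfolding Ent_def expectation_cube[OF mu_support] rel_ent_full_density[OF f] by simp
qed

lemma Ent_resample:
  assumes s: "x \<in> cube n" and v: "v < n"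
  defines "w \<equiv> pmf \<mu> x" and "w' \<equiv> pmf \<mu> (flip v x)"
  shows "Ent (resample n \<mu> v x) f = (w * (f x * ln (f x)) + w' * (f (flip v x) * ln (f (flip v x)))) / (w + w')
    - (w * f x + w' * f (flip v x)) / (w + w') * ln ((w * f x + w' * f (flip v x)) / (w + w'))"
  unfolding Ent_def expectation_cube[OF set_resample[OF s v]] sum_resample[OF s v] w_def w'_def ..

lemma rel_ent_conditional:
  assumes f: "\<forall>x\<in>cube n. 0 \<le> f x" and v: "v < n"
  defines "h \<equiv> \<lambda>x. pmf \<mu> x * f x"
  shows "measure_pmf.expectation \<mu> (\<lambda>x. Ent (resample n \<mu> v x) f)
    = rel_ent n {..<n} h (pmf \<mu>) - rel_ent n ({..<n} - {v}) h (pmf \<mu>)"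
proof -
  define a where "a x = pmf \<mu> x * (f x * ln (f x))" for x
  define l where "l x = ln ((h x + h (flip v x)) / (pmf \<mu> x + pmf \<mu> (flip v x)))" for x
  have lf: "l (flip v x) = l x" for x by (simp add: l_def add.commute)
  have "measure_pmf.expectation \<mu> (\<lambda>x. Ent (resample n \<mu> v x) f)
    = (\<Sum>x\<in>cube n. pmf \<mu> x * ((a x + a (flip v x)) / (pmf \<mu> x + pmf \<mu> (flip v x)))
       - pmf \<mu> x * ((h x * l x + h (flip v x) * l (flip v x)) / (pmf \<mu> x + pmf \<mu> (flip v x))))"
    unfolding expectation_cube[OF mu_support]
  proof (intro sum.cong refl)
    fix x assume s: "x \<in> cube n"
    show "pmf \<mu> x * Ent (resample n \<mu> v x) f
      = pmf \<mu> x * ((a x + a (flip v x)) / (pmf \<mu> x + pmf \<mu> (flip v x)))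
       - pmf \<mu> x * ((h x * l x + h (flip v x) * l (flip v x)) / (pmf \<mu> x + pmf \<mu> (flip v x)))"
    proof -
      have "(h x * l x + h (flip v x) * l x) / (pmf \<mu> x + pmf \<mu> (flip v x))
          = (h x + h (flip v x)) / (pmf \<mu> x + pmf \<mu> (flip v x)) * l x"
        by (simp add: distrib_right[symmetric])
      then show ?thesis unfolding lf Ent_resample[OF s v]
        by (simp only: a_def h_def l_def right_diff_distrib)
    qed
  qed
  also have "\<dots> = (\<Sum>x\<in>cube n. a x) - (\<Sum>x\<in>cube n. h x * l x)"
    unfolding sum_subtractf
    using sum_resample_average[OF mu_pos v, of a] sum_resample_average[OF mu_pos v, of "\<lambda>x. h x * l x"] by simp
  also have "(\<Sum>x\<in>cube n. a x) = rel_ent n {..<n} h (pmf \<mu>)"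
    unfolding h_def a_def rel_ent_full_density[OF f] ..
  also have "(\<Sum>x\<in>cube n. h x * l x) = rel_ent n ({..<n} - {v}) h (pmf \<mu>)"
    unfolding rel_ent_def
  proof (intro sum.cong refl)
    fix x assume s: "x \<in> cube n"
    have s': "flip v x \<in> cube n" using s v by simp
    show "h x * l x = h x * (ln (marg n ({..<n} - {v}) h x) - ln (marg n ({..<n} - {v}) (pmf \<mu>) x))"
    proof (cases "h x = 0")
      case False
      have "0 \<le> h x" "0 \<le> h (flip v x)" using f s s' by (auto simp: h_def)
      then have "0 < h x + h (flip v x)" using False by simp
      moreover have "0 < pmf \<mu> x + pmf \<mu> (flip v x)" using mu_pos s s' by (auto intro!: add_pos_pos)
      ultimately show ?thesis by (simp add: l_def fibre_all_but_one[OF s v] ln_div)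
    qed simp
  qed
  finally show ?thesis .
qed

theorem entropy_tensorization:
  assumes n: "2 \<le> n"
    and wi: "weakly_interacting n (pmf \<mu>) \<beta>" and b: "\<beta> \<le> 1/3000"
    and f: "\<forall>x\<in>cube n. 0 \<le> f x"
  shows "Ent \<mu> f \<le> 2 * real n powr (4 * \<beta>) * (\<Sum>v<n. measure_pmf.expectation \<mu> (\<lambda>x. Ent (resample n \<mu> v x) f))"
  unfolding rel_ent_density[OF f]
  using rel_ent_tensorization[OF wi b n, of "\<lambda>x. pmf \<mu> x * f x"] f
  by (simp add: rel_ent_conditional[OF f])

text \<open>Jensen's inequality \<open>E (ln f) \<le> ln (E f)\<close> bounds the entropy by the covariance of \<open>f\<close> and \<open>ln f\<close>.\<close>

lemma Ent_resample_le:
  assumes f: "\<forall>x\<in>cube n. 0 < f x" and s: "x \<in> cube n" and v: "v < n"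
  defines "w \<equiv> pmf \<mu> x" and "w' \<equiv> pmf \<mu> (flip v x)"
  shows "Ent (resample n \<mu> v x) f
    \<le> w * w' * (f x - f (flip v x)) * (ln (f x) - ln (f (flip v x))) / (w + w') / (w + w')"
proof -
  define p q where "p = w / (w + w')" and "q = w' / (w + w')"
  define g h where "g = f x" and "h = f (flip v x)"
  have w: "0 < w" "0 < w'" using mu_pos s v by (auto simp: w_def w'_def)
  have xy: "0 < g" "0 < h" using f s v by (auto simp: g_def h_def)
  have pq: "0 < p" "0 < q" "p + q = 1" using w by (auto simp: p_def q_def add_divide_distrib[symmetric])
  have "p * ln g + q * ln h \<le> ln (p * g + q * h)"
  proof -
    have p: "p = 1 - q" using pq by simp
    show ?thesis using concave_onD[OF ln_concave, of q g h] pq(1,2) xy unfolding p by simp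
  qed
  then have "(p * g + q * h) * (p * ln g + q * ln h) \<le> (p * g + q * h) * ln (p * g + q * h)"
    using pq xy by (intro mult_left_mono) auto
  moreover have "p * (g * ln g) + q * (h * ln h) - (p * g + q * h) * (p * ln g + q * ln h)
     = p * q * (g - h) * (ln g - ln h)"
  proof -
    have q: "q = 1 - p" using pq by simp
    show ?thesis unfolding q by (simp add: algebra_simps)
  qed
  ultimately have "p * (g * ln g) + q * (h * ln h) - (p * g + q * h) * ln (p * g + q * h)
    \<le> p * q * (g - h) * (ln g - ln h)" by simp
  also have "\<dots> = w * w' * (g - h) * (ln g - ln h) / (w + w') / (w + w')" by (simp add: p_def q_def)
  finally show ?thesis
    unfolding Ent_resample[OF s v] w_def[symmetric] w'_def[symmetric] g_def[symmetric] h_def[symmetric] p_def q_def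
    by (simp add: add_divide_distrib)
qed

lemma modified_log_sobolev_pos:
  assumes n: "0 < n" and f: "\<forall>x\<in>cube n. 0 < f x"
  shows "(\<Sum>v<n. measure_pmf.expectation \<mu> (\<lambda>x. Ent (resample n \<mu> v x) f))
    \<le> real n * dirichlet_form n \<mu> f (\<lambda>x. ln (f x))"
proof -
  let ?E = "\<lambda>v. measure_pmf.expectation \<mu> (\<lambda>x. Ent (resample n \<mu> v x) f)"
  define X where "X v x = pmf \<mu> x * pmf \<mu> (flip v x) * (f x - f (flip v x)) * (ln (f x) - ln (f (flip v x)))
     / (pmf \<mu> x + pmf \<mu> (flip v x))" for v x
  have X: "X v (flip v x) = X v x" for v x 
  proof -
    have sw: "w' * w * (b - a) * (d - c) = w * w' * (a - b) * (c - d)" for w w' a b c d :: real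
      by (simp add: algebra_simps)
    show ?thesis unfolding X_def flip_flip sw[of "pmf \<mu> (flip v x)" "pmf \<mu> x"]
      by (simp only: add.commute)
  qed
  have "?E v \<le> (\<Sum>x\<in>cube n. X v x) / 2" if v: "v < n" for v
  proof -
    have "?E v
      \<le> (\<Sum>x\<in>cube n. pmf \<mu> x * (X v x / (pmf \<mu> x + pmf \<mu> (flip v x))))"
      unfolding expectation_cube[OF mu_support] X_def
      by (intro sum_mono mult_left_mono Ent_resample_le[OF f _ v]) auto
    also have "\<dots> = (\<Sum>x\<in>cube n. X v x / 2)"
      using sum_resample_average[OF mu_pos v, of "\<lambda>x. X v x / 2"] by (simp add: X)
    finally show ?thesis by (simp add: sum_divide_distrib)
  qed
  then have "(\<Sum>v<n. ?E v) \<le> (\<Sum>v<n. (\<Sum>x\<in>cube n. X v x) / 2)"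
    by (intro sum_mono) auto
  also have "\<dots> = real n * dirichlet_form n \<mu> f (\<lambda>x. ln (f x))"
    unfolding dirichlet_form_flips[OF n] X_def[symmetric] sum_divide_distrib[symmetric] using n by simp
  finally show ?thesis .
qed

text \<open>For positive functions this is tensorization followed by Jensen's inequality on each pair. If \<open>f\<close> vanishes somewhere but not everywhere, the right
  side is infinite.\<close>

theorem modified_log_sobolev_bound:
  assumes n: "2 \<le> n"
    and wi: "weakly_interacting n (pmf \<mu>) \<beta>" and b: "\<beta> \<le> 1/3000"
  shows "modified_log_sobolev n \<mu> (1 / 2 / real n powr (1 + 4 * \<beta>))"
  unfolding modified_log_sobolev_def
proof (intro allI impI)
  fix f :: "(nat \<Rightarrow> real) \<Rightarrow> real" assume f: "\<forall>z\<in>cube n. 0 \<le> f z"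
  have n0: "0 < n" using n by simp
  define t where "t x y = ereal (pmf \<mu> x * pmf (glauber n \<mu> x) y * (f x - f y)) * (elog (f x) - elog (f y))" for x y
  have dfl: "dirichlet_form_log n \<mu> f = ereal (1/2) * (\<Sum>x\<in>cube n. \<Sum>y\<in>cube n. t x y)"
    by (simp add: dirichlet_form_log_def t_def)
  show "ereal (1 / 2 / real n powr (1 + 4 * \<beta>) * Ent \<mu> f) \<le> dirichlet_form_log n \<mu> f"
  proof (cases "\<forall>z\<in>cube n. 0 < f z")
    case True
    have "t x y = ereal (pmf \<mu> x * pmf (glauber n \<mu> x) y * (f x - f y) * (ln (f x) - ln (f y)))"
      if "x \<in> cube n" "y \<in> cube n" for x y
      using True that by (auto simp: t_def elog_def)
    then have "dirichlet_form_log n \<mu> f = ereal (dirichlet_form n \<mu> f (\<lambda>z. ln (f z)))"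
      unfolding dfl dirichlet_form_def by (simp add: sum_ereal cong: sum.cong)
    moreover have "1 / 2 / real n powr (1 + 4 * \<beta>) * Ent \<mu> f \<le> dirichlet_form n \<mu> f (\<lambda>z. ln (f z))"
    proof -
      have "Ent \<mu> f \<le> 2 * real n powr (4 * \<beta>) * (\<Sum>v<n. measure_pmf.expectation \<mu> (\<lambda>z. Ent (resample n \<mu> v z) f))"
        by (rule entropy_tensorization[OF n wi b f])
      also have "\<dots> \<le> 2 * real n powr (4 * \<beta>) * (real n * dirichlet_form n \<mu> f (\<lambda>z. ln (f z)))"
        by (intro mult_left_mono modified_log_sobolev_pos[OF n0 True]) auto
      also have "\<dots> = 2 * real n powr (1 + 4 * \<beta>) * dirichlet_form n \<mu> f (\<lambda>z. ln (f z))"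
        using n0 by (simp add: powr_add)
      finally show ?thesis using n0 by (simp add: pos_divide_le_eq mult.commute)
    qed
    ultimately show ?thesis by simp
  next
    case False
    show ?thesis
    proof (cases "\<forall>z\<in>cube n. f z = 0")
      case True
      then have "Ent \<mu> f = 0" unfolding Ent_def expectation_cube[OF mu_support] by simp
      moreover have "t x y = 0" if "x \<in> cube n" "y \<in> cube n" for x y using True that by (simp add: t_def flip: zero_ereal_def)
      ultimately show ?thesis unfolding dfl by simp
    next
      case nz: False
      (* Some transition of positive probability joins a positive value to a zero, and its summand
         is infinite. *)
      obtain x i where x: "x \<in> cube n" "i < n" "0 < f x" "f (flip i x) = 0"
      proof -
        obtain z where s: "z \<in> cube n" "0 < f z" using nz f by (auto simp: order_less_le)
        obtain \<tau> where t: "\<tau> \<in> cube n" "\<not> 0 < f \<tau>" using False by auto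
        have "\<exists>x i. x \<in> cube n \<and> i < n \<and> 0 < f x \<and> \<not> 0 < f (flip i x)"
          using cube_connected[OF s(1) t(1), of "\<lambda>x. 0 < f x"] s t by blast
        then obtain x i where "x \<in> cube n" "i < n" "0 < f x" "\<not> 0 < f (flip i x)" by blast
        moreover then have "f (flip i x) = 0" using f flip_cube by (metis order_less_le)
        ultimately show ?thesis using that by blast
      qed
      let ?y = "flip i x"
      have yc: "?y \<in> cube n" using x by simp
      have tn: "0 \<le> t a c" if "a \<in> cube n" "c \<in> cube n" for a c
      proof -
        define k where "k = pmf \<mu> a * pmf (glauber n \<mu> a) c"
        have k0: "0 \<le> k" by (simp add: k_def)
        have tk: "t a c = ereal (k * (f a - f c)) * (elog (f a) - elog (f c))" by (simp add: t_def k_def)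
        have "0 \<le> f a" "0 \<le> f c" using f that by auto
        then consider "k = 0 \<or> f a = f c" | "k > 0" "f a = 0" "f c > 0" | "k > 0" "f a > 0" "f c = 0"
          | "k > 0" "f a > 0" "f c > 0" using k0 by fastforce
        then show ?thesis
        proof cases
          case 1
          then show ?thesis by (auto simp: tk simp flip: zero_ereal_def)
        next
          case 2
          then have "k * f c > 0" "\<not> k * f c < 0" by (simp_all add: not_less)
          then show ?thesis using 2 by (simp add: tk elog_def)
        next
          case 3
          then have "k * f a > 0" "\<not> k * f a < 0" by (simp_all add: not_less)
          then show ?thesis using 3 by (simp add: tk elog_def)
        next
          case 4
          have "0 \<le> (f a - f c) * (ln (f a) - ln (f c))"
            using 4 by (cases "f a \<le> f c") (auto intro: mult_nonpos_nonpos mult_nonneg_nonneg)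
          then have "0 \<le> k * ((f a - f c) * (ln (f a) - ln (f c)))" using k0 by simp
          then show ?thesis using 4 by (simp add: tk elog_def mult.assoc)
        qed
      qed
      have "0 < pmf (glauber n \<mu> x) ?y"
      proof -
        have "0 < pmf (resample n \<mu> i x) ?y"
          using mu_pos x yc by (simp add: pmf_resample[OF x(1,2)] add_pos_pos)
        also have "\<dots> \<le> (\<Sum>j<n. pmf (resample n \<mu> j x) ?y)"
          using x by (intro member_le_sum) auto
        finally show ?thesis using n0 by (simp add: pmf_glauber)
      qed
      then have "0 < pmf \<mu> x * pmf (glauber n \<mu> x) ?y * (f x - f ?y)" using mu_pos x by simp
      then have "t x ?y = \<infinity>" using x by (auto simp: t_def elog_def)
      moreover have "t x ?y \<le> (\<Sum>c\<in>cube n. t x c)" using sum_mono2[of "cube n" "{?y}" "t x"] tn x yc by auto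
      moreover have "(\<Sum>c\<in>cube n. t x c) \<le> (\<Sum>a\<in>cube n. \<Sum>c\<in>cube n. t a c)"
      proof -
        have "(\<Sum>a\<in>{x}. \<Sum>c\<in>cube n. t a c) \<le> (\<Sum>a\<in>cube n. \<Sum>c\<in>cube n. t a c)"
          by (rule sum_mono2) (use x tn in \<open>auto intro!: sum_nonneg\<close>)
        then show ?thesis by simp
      qed
      ultimately have "\<infinity> \<le> (\<Sum>a\<in>cube n. \<Sum>c\<in>cube n. t a c)" by (metis order_trans)
      then show ?thesis unfolding dfl by simp
    qed
  qed
qed

lemma pmf_glauber_step:
  assumes n: "0 < n" and p: "set_pmf p \<subseteq> cube n"
  shows "pmf (bind_pmf p (glauber n \<mu>)) y = (\<Sum>i<n. \<Sum>x\<in>cube n. pmf p x * pmf (resample n \<mu> i x) y) / real n"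
proof -
  have "pmf (bind_pmf p (glauber n \<mu>)) y = (\<Sum>x\<in>cube n. pmf p x * ((\<Sum>i<n. pmf (resample n \<mu> i x) y) / real n))"
    unfolding pmf_bind expectation_cube[OF p] pmf_glauber[OF n] ..
  also have "\<dots> = (\<Sum>x\<in>cube n. \<Sum>i<n. pmf p x * pmf (resample n \<mu> i x) y) / real n"
    by (simp add: sum_divide_distrib sum_distrib_left)
  finally show ?thesis by (subst sum.swap)
qed

lemma sum_resample_source:
  assumes y: "y \<in> cube n" and i: "i < n"
  shows "(\<Sum>x\<in>cube n. g x * pmf (resample n \<mu> i x) y)
    = pmf \<mu> y * ((g y + g (flip i y)) / (pmf \<mu> y + pmf \<mu> (flip i y)))"
proof -
  have "(\<Sum>x\<in>cube n. g x * pmf (resample n \<mu> i x) y) = (\<Sum>x\<in>{y, flip i y}. g x * pmf (resample n \<mu> i x) y)"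
  proof (rule sum.mono_neutral_right)
    show "\<forall>x\<in>cube n - {y, flip i y}. g x * pmf (resample n \<mu> i x) y = 0"
    proof
      fix x assume x: "x \<in> cube n - {y, flip i y}"
      then have "y \<noteq> x" "y \<noteq> flip i x" by auto
      then show "g x * pmf (resample n \<mu> i x) y = 0" using x by (simp add: pmf_resample[OF _ i])
    qed
  qed (use y i in auto)
  also have "\<dots> = pmf \<mu> y * ((g y + g (flip i y)) / (pmf \<mu> y + pmf \<mu> (flip i y)))"
    using flip_neq[OF y i] y i
    by (simp add: pmf_resample[OF _ i] add.commute add_divide_distrib distrib_left mult.commute)
  finally show ?thesis .
qed

lemma set_glauber_step:
  assumes n: "0 < n" and p: "set_pmf p \<subseteq> cube n"
  shows "set_pmf (bind_pmf p (glauber n \<mu>)) \<subseteq> cube n"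
proof -
  have "set_pmf (glauber n \<mu> x) \<subseteq> cube n" if "x \<in> cube n" for x
    unfolding glauber_def using set_resample[OF that] n by (auto simp: lessThan_empty_iff)
  then show ?thesis using p by auto
qed

text \<open>The law after one step is the average of the laws obtained by resampling the spin \<open>i\<close>. Relative
  entropy is convex, and resampling a spin leaves exactly the relative entropy of the marginal on
  the others.\<close>

lemma rel_ent_glauber_step:
  assumes n: "0 < n" and p: "set_pmf p \<subseteq> cube n"
  shows "rel_ent n {..<n} (pmf (bind_pmf p (glauber n \<mu>))) (pmf \<mu>)
    \<le> (\<Sum>v<n. rel_ent n ({..<n} - {v}) (pmf p) (pmf \<mu>)) / real n"
proof -
  let ?K = "\<lambda>i. rel_ent n ({..<n} - {i}) (pmf p) (pmf \<mu>)"
  define p' where "p' = pmf (bind_pmf p (glauber n \<mu>))"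
  define r where "r i y = pmf \<mu> y * ((pmf p y + pmf p (flip i y)) / (pmf \<mu> y + pmf \<mu> (flip i y)))" for i y
  have r0: "0 \<le> r i y" for i y unfolding r_def by simp
  have p': "p' y = (\<Sum>i<n. r i y) / real n" if "y \<in> cube n" for y
    unfolding p'_def pmf_glauber_step[OF n p] r_def using sum_resample_source[OF that] by simp
  have rsum: "(\<Sum>y\<in>cube n. r i y) = 1" if "i < n" for i
    unfolding r_def sum_resample_average[OF mu_pos that] by (rule pmf_cube_sum[OF p])
  have psum: "(\<Sum>y\<in>cube n. p' y) = 1"
    unfolding p'_def by (rule pmf_cube_sum[OF set_glauber_step[OF n p]])
  have rent: "?K i = (\<Sum>y\<in>cube n. r i y * (ln (r i y) - ln (pmf \<mu> y)))"
    if i: "i < n" for i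
  proof -
    define l where "l y = ln (pmf p y + pmf p (flip i y)) - ln (pmf \<mu> y + pmf \<mu> (flip i y))" for y
    have lf: "l (flip i y) = l y" for y by (simp add: l_def add.commute)
    have "?K i = (\<Sum>y\<in>cube n. pmf p y * l y)"
      unfolding rel_ent_def by (intro sum.cong refl) (simp add: fibre_all_but_one[OF _ i] l_def)
    also have "\<dots> = (\<Sum>y\<in>cube n. pmf \<mu> y * ((pmf p y * l y + pmf p (flip i y) * l (flip i y)) / (pmf \<mu> y + pmf \<mu> (flip i y))))"
      by (rule sum_resample_average[OF mu_pos i, symmetric])
    also have "\<dots> = (\<Sum>y\<in>cube n. r i y * l y)"
    proof (intro sum.cong refl)
      fix y
      have "pmf p y * l y + pmf p (flip i y) * l y = (pmf p y + pmf p (flip i y)) * l y" by (simp add: distrib_right)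
      then show "pmf \<mu> y * ((pmf p y * l y + pmf p (flip i y) * l (flip i y)) / (pmf \<mu> y + pmf \<mu> (flip i y))) = r i y * l y"
        unfolding lf r_def by simp
    qed
    also have "\<dots> = (\<Sum>y\<in>cube n. r i y * (ln (r i y) - ln (pmf \<mu> y)))"
    proof (intro sum.cong refl)
      fix y assume y: "y \<in> cube n"
      show "r i y * l y = r i y * (ln (r i y) - ln (pmf \<mu> y))"
      proof (cases "pmf p y + pmf p (flip i y) = 0")
        case True
        then show ?thesis by (simp add: r_def)
      next
        case False
        then have a: "0 < pmf p y + pmf p (flip i y)" using pmf_nonneg[of p] by (simp add: order_less_le)
        have b: "0 < pmf \<mu> y" "0 < pmf \<mu> y + pmf \<mu> (flip i y)" using mu_pos y i by (auto intro!: add_pos_pos)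
        have "ln (r i y) = ln (pmf \<mu> y) + l y"
          unfolding r_def l_def using a b by (subst ln_mult) (auto simp: ln_div)
        then show ?thesis by simp
      qed
    qed
    finally show ?thesis .
  qed
  have gibbs: "0 \<le> (\<Sum>y\<in>cube n. r i y * (ln (r i y) - ln (p' y)))" if i: "i < n" for i
  proof -
    have "0 = (\<Sum>y\<in>cube n. r i y - p' y)" using rsum[OF i] psum by (simp add: sum_subtractf)
    also have "\<dots> \<le> (\<Sum>y\<in>cube n. r i y * (ln (r i y) - ln (p' y)))"
    proof (intro sum_mono relative_entropy_ge)
      fix y assume y: "y \<in> cube n"
      show "0 \<le> r i y" by (rule r0)
      show "0 \<le> p' y" by (simp add: p'_def)
      have "r i y \<le> (\<Sum>i<n. r i y)" using i r0 by (intro member_le_sum) auto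
      then show "p' y = 0 \<longrightarrow> r i y = 0" using p'[OF y] r0[of i y] n by auto
    qed
    finally show ?thesis .
  qed
  have "rel_ent n {..<n} p' (pmf \<mu>) = (\<Sum>y\<in>cube n. (\<Sum>i<n. r i y) / real n * (ln (p' y) - ln (pmf \<mu> y)))"
    unfolding rel_ent_def by (intro sum.cong refl) (simp add: marg_full p')
  also have "\<dots> = (\<Sum>y\<in>cube n. \<Sum>i<n. r i y * (ln (p' y) - ln (pmf \<mu> y))) / real n"
    by (simp add: sum_divide_distrib sum_distrib_right)
  also have "(\<Sum>y\<in>cube n. \<Sum>i<n. r i y * (ln (p' y) - ln (pmf \<mu> y))) = (\<Sum>i<n. \<Sum>y\<in>cube n. r i y * (ln (p' y) - ln (pmf \<mu> y)))"
    by (rule sum.swap)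
  also have "\<dots> / real n \<le> (\<Sum>i<n. ?K i) / real n"
  proof (intro divide_right_mono sum_mono)
    fix i assume "i \<in> {..<n}"
    then have i: "i < n" by simp
    have "(\<Sum>y\<in>cube n. r i y * (ln (p' y) - ln (pmf \<mu> y)))
      = (\<Sum>y\<in>cube n. r i y * (ln (r i y) - ln (pmf \<mu> y))) - (\<Sum>y\<in>cube n. r i y * (ln (r i y) - ln (p' y)))"
      unfolding sum_subtractf[symmetric] by (intro sum.cong refl) (simp add: algebra_simps)
    then show "(\<Sum>y\<in>cube n. r i y * (ln (p' y) - ln (pmf \<mu> y))) \<le> ?K i"
      unfolding rent[OF i] using gibbs[OF i] by simp
  qed simp
  finally show ?thesis by (simp add: p'_def)
qed

lemma rel_ent_empty_pmf:
  assumes "set_pmf p \<subseteq> cube n"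
  shows "rel_ent n {} (pmf p) (pmf \<mu>) = 0"
  using assms mu_support by (simp add: rel_ent_def marg_empty pmf_cube_sum)

lemma rel_ent_contraction:
  assumes n: "2 \<le> n" and p: "set_pmf p \<subseteq> cube n"
    and wi: "weakly_interacting n (pmf \<mu>) \<beta>" and b: "\<beta> \<le> 1/3000"
  shows "rel_ent n {..<n} (pmf (bind_pmf p (glauber n \<mu>))) (pmf \<mu>)
    \<le> (1 - 1 / (2 * real n powr (1 + 4 * \<beta>))) * rel_ent n {..<n} (pmf p) (pmf \<mu>)"
proof -
  define K where "K = rel_ent n {..<n} (pmf p) (pmf \<mu>)"
  define S where "S = (\<Sum>v<n. rel_ent n ({..<n} - {v}) (pmf p) (pmf \<mu>))"
  have n0: "0 < n" using n by simp
  have "K \<le> 2 * real n powr (4 * \<beta>) * (real n * K - S)"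
    using rel_ent_tensorization[OF wi b n, of "pmf p"]
    unfolding K_def S_def rel_ent_empty_pmf[OF p] by (simp add: sum_subtractf)
  then have "K / (2 * real n powr (4 * \<beta>)) \<le> real n * K - S"
    using n0 by (simp add: pos_divide_le_eq mult.commute)
  then have "K / (2 * real n powr (4 * \<beta>)) / real n \<le> (real n * K - S) / real n"
    by (rule divide_right_mono) simp
  then have "S / real n \<le> K - K / (2 * real n powr (4 * \<beta>)) / real n"
    using n0 by (simp add: diff_divide_distrib)
  also have "\<dots> = (1 - 1 / (2 * real n powr (1 + 4 * \<beta>))) * K"
    using n0 by (simp add: powr_add left_diff_distrib)
  finally show ?thesis
    using rel_ent_glauber_step[OF n0 p] unfolding K_def S_def by linarith
qed

text \<open>A weak form of Pinsker's inequality, by way of the Hellinger distance.\<close>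

lemma tv_dist_le:
  assumes p: "set_pmf p \<subseteq> cube n"
  shows "tv_dist p \<mu> \<le> 2 * sqrt (rel_ent n {..<n} (pmf p) (pmf \<mu>))"
proof -
  let ?d = "\<Sum>x\<in>cube n. \<bar>pmf p x - pmf \<mu> x\<bar>"
  define K where "K = rel_ent n {..<n} (pmf p) (pmf \<mu>)"
  (* Passing to square roots, the squared Hellinger distance is at most the relative entropy. *)
  define u v where "u x = sqrt (pmf p x)" and "v x = sqrt (pmf \<mu> x)" for x
  have u2: "(u x)\<^sup>2 = pmf p x" and v2: "(v x)\<^sup>2 = pmf \<mu> x" for x by (simp_all add: u_def v_def)
  have uv: "0 \<le> u x" "0 \<le> v x" for x by (simp_all add: u_def v_def)
  have hell: "(\<Sum>x\<in>cube n. (u x - v x)\<^sup>2) \<le> K"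
  proof -
    have "2 * ((u x)\<^sup>2 - u x * v x) \<le> pmf p x * (ln (pmf p x) - ln (pmf \<mu> x))" if x: "x \<in> cube n" for x
    proof (cases "pmf p x = 0")
      case True
      then show ?thesis by (simp add: u_def)
    next
      case False
      then have "0 < pmf p x" "0 < pmf \<mu> x" using mu_pos x pmf_nonneg[of p x] by (auto simp: order_less_le)
      then have up: "0 < u x" "0 < v x" by (simp_all add: u_def v_def)
      have "ln (v x / u x) \<le> v x / u x - 1" using up by (intro ln_le_minus_one) auto
      then have "1 - v x / u x \<le> ln (u x) - ln (v x)" using up by (simp add: ln_div)
      then have "(u x)\<^sup>2 * (2 * (1 - v x / u x)) \<le> (u x)\<^sup>2 * (2 * (ln (u x) - ln (v x)))"
        by (intro mult_left_mono) auto
      moreover have "(u x)\<^sup>2 * (2 * (1 - v x / u x)) = 2 * ((u x)\<^sup>2 - u x * v x)"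
        using up by (simp add: field_simps power2_eq_square)
      moreover have "ln (pmf p x) = 2 * ln (u x)" "ln (pmf \<mu> x) = 2 * ln (v x)"
        unfolding u2[symmetric] v2[symmetric] using up by (simp_all add: ln_realpow)
      ultimately show ?thesis by (simp add: u2)
    qed
    then have "(\<Sum>x\<in>cube n. 2 * ((u x)\<^sup>2 - u x * v x)) \<le> (\<Sum>x\<in>cube n. pmf p x * (ln (pmf p x) - ln (pmf \<mu> x)))"
      by (intro sum_mono)
    also have "\<dots> = K" unfolding K_def rel_ent_def by (intro sum.cong refl) (simp add: marg_full)
    finally have "(\<Sum>x\<in>cube n. 2 * ((u x)\<^sup>2 - u x * v x)) \<le> K" .
    moreover have "(\<Sum>x\<in>cube n. (u x - v x)\<^sup>2) = (\<Sum>x\<in>cube n. 2 * ((u x)\<^sup>2 - u x * v x)) + ((\<Sum>x\<in>cube n. pmf \<mu> x) - (\<Sum>x\<in>cube n. pmf p x))"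
      unfolding sum_subtractf[symmetric] sum.distrib[symmetric]
      by (intro sum.cong refl) (simp add: u2[symmetric] v2[symmetric] power2_eq_square algebra_simps)
    ultimately show ?thesis using pmf_cube_sum[OF p] pmf_cube_sum[OF mu_support] by simp
  qed
  have sumsq: "(\<Sum>x\<in>cube n. (u x + v x)\<^sup>2) \<le> 4"
  proof -
    have "(\<Sum>x\<in>cube n. (u x + v x)\<^sup>2) \<le> (\<Sum>x\<in>cube n. 2 * pmf p x + 2 * pmf \<mu> x)"
    proof (rule sum_mono)
      fix x
      have "0 \<le> (u x - v x)\<^sup>2" by simp
      then show "(u x + v x)\<^sup>2 \<le> 2 * pmf p x + 2 * pmf \<mu> x"
        unfolding u2[symmetric] v2[symmetric] by (simp add: power2_eq_square algebra_simps)
    qed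
    also have "\<dots> = 2 * (\<Sum>x\<in>cube n. pmf p x) + 2 * (\<Sum>x\<in>cube n. pmf \<mu> x)"
      by (simp add: sum.distrib sum_distrib_left)
    finally show ?thesis using pmf_cube_sum[OF p] pmf_cube_sum[OF mu_support] by simp
  qed
  have l1: "?d \<le> 2 * sqrt K"
  proof -
    have "?d = (\<Sum>x\<in>cube n. \<bar>u x - v x\<bar> * (u x + v x))"
    proof (intro sum.cong refl)
      fix x
      have "pmf p x - pmf \<mu> x = (u x - v x) * (u x + v x)"
        unfolding u2[symmetric] v2[symmetric] by (simp add: power2_eq_square algebra_simps)
      then show "\<bar>pmf p x - pmf \<mu> x\<bar> = \<bar>u x - v x\<bar> * (u x + v x)"
        using uv[of x] by (simp add: abs_mult)
    qed
    moreover have "(\<Sum>x\<in>cube n. \<bar>u x - v x\<bar> * (u x + v x))\<^sup>2 \<le> (\<Sum>x\<in>cube n. \<bar>u x - v x\<bar>\<^sup>2) * (\<Sum>x\<in>cube n. (u x + v x)\<^sup>2)"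
      by (rule Cauchy_Schwarz_ineq_sum)
    moreover have "(\<Sum>x\<in>cube n. \<bar>u x - v x\<bar>\<^sup>2) * (\<Sum>x\<in>cube n. (u x + v x)\<^sup>2) \<le> K * 4"
    proof (rule mult_mono)
      show "(\<Sum>x\<in>cube n. \<bar>u x - v x\<bar>\<^sup>2) \<le> K" using hell by simp
      show "0 \<le> K" using hell sum_nonneg[of "cube n" "\<lambda>x. (u x - v x)\<^sup>2"] by simp
    qed (use sumsq in \<open>auto intro: sum_nonneg\<close>)
    ultimately have "?d\<^sup>2 \<le> K * 4" by simp
    then have "?d \<le> sqrt (K * 4)" by (rule real_le_rsqrt)
    then show ?thesis by (simp add: real_sqrt_mult)
  qed
  show ?thesis unfolding tv_dist_def K_def[symmetric]
  proof (rule cSUP_least)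
    fix E
    have pr: "measure_pmf.prob q E = (\<Sum>x\<in>cube n. pmf q x * indicator E x)" if "set_pmf q \<subseteq> cube n" for q
      using expectation_cube[OF that, of "indicator E"] by simp
    have "\<bar>measure_pmf.prob p E - measure_pmf.prob \<mu> E\<bar> = \<bar>\<Sum>x\<in>cube n. (pmf p x - pmf \<mu> x) * indicator E x\<bar>"
      unfolding pr[OF p] pr[OF mu_support] by (simp add: sum_subtractf left_diff_distrib)
    also have "\<dots> \<le> ?d"
      by (intro order_trans[OF sum_abs] sum_mono) (auto simp: indicator_def)
    also note l1
    finally show "\<bar>measure_pmf.prob p E - measure_pmf.prob \<mu> E\<bar> \<le> 2 * sqrt K" .
  qed simp
qed

lemma set_glauber_steps:
  assumes "0 < n" "x \<in> cube n"
  shows "set_pmf (glauber_steps n \<mu> t x) \<subseteq> cube n"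
proof (induction t)
  case 0
  then show ?case using assms supp by (simp add: glauber_steps_def)
next
  case (Suc t)
  then show ?case unfolding glauber_steps_Suc by (rule set_glauber_step[OF assms(1)])
qed

lemma rel_ent_glauber_steps:
  assumes n: "2 \<le> n" and s: "x \<in> cube n"
    and wi: "weakly_interacting n (pmf \<mu>) \<beta>" and b: "\<beta> \<le> 1/3000"
  shows "rel_ent n {..<n} (pmf (glauber_steps n \<mu> t x)) (pmf \<mu>)
    \<le> (1 - 1 / (2 * real n powr (1 + 4 * \<beta>))) ^ t * ln (1 / pmf \<mu> x)"
proof (induction t)
  case 0
  have "rel_ent n {..<n} (pmf (return_pmf x)) (pmf \<mu>) = (\<Sum>y\<in>cube n. if y = x then - ln (pmf \<mu> x) else 0)"
    unfolding rel_ent_def by (intro sum.cong refl) (auto simp: marg_full)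
  also have "\<dots> = ln (1 / pmf \<mu> x)" using s mu_pos by (simp add: ln_div)
  finally have e: "rel_ent n {..<n} (pmf (return_pmf x)) (pmf \<mu>) = ln (1 / pmf \<mu> x)" .
  have g0: "glauber_steps n \<mu> 0 x = return_pmf x" by (simp add: glauber_steps_def)
  show ?case unfolding g0 e power_0 mult_1 ..
next
  case (Suc t)
  let ?c = "1 - 1 / (2 * real n powr (1 + 4 * \<beta>))"
  have n0: "0 < n" using n by simp
  note b0 = weakly_interacting_nonneg[OF wi]
  have "1 \<le> real n powr (1 + 4 * \<beta>)" using n b0 by (intro ge_one_powr_ge_zero) auto
  then have c: "0 \<le> ?c" by (simp add: divide_le_eq)
  have "rel_ent n {..<n} (pmf (glauber_steps n \<mu> (Suc t) x)) (pmf \<mu>)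
    \<le> ?c * rel_ent n {..<n} (pmf (glauber_steps n \<mu> t x)) (pmf \<mu>)"
    unfolding glauber_steps_Suc
    by (rule rel_ent_contraction[OF n set_glauber_steps[OF n0 s] wi b])
  also have "\<dots> \<le> ?c * (?c ^ t * ln (1 / pmf \<mu> x))" by (intro mult_left_mono Suc.IH c)
  finally show ?case by (simp add: mult.assoc)
qed

text \<open>A point mass at \<open>x\<close> has relative entropy \<open>ln (1 / \<mu> x)\<close>, and geometric contraction brings it below
  \<open>\<epsilon>\<^sup>2 / 4\<close> after a multiple of \<open>n\<close> to the power \<open>1 + 4 \<beta>\<close> times the logarithm of the ratio.\<close>

theorem mixing_time_bound:
  assumes n: "2 \<le> n"
    and wi: "weakly_interacting n (pmf \<mu>) \<beta>" and b: "\<beta> \<le> 1/3000"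
    and e: "0 < \<epsilon>" "\<epsilon> < 1"
  shows "ereal_of_enat (mixing_time n \<mu> \<epsilon>)
    \<le> ereal (27 * real n powr (1 + 4 * \<beta>) * (ln (ln (1 / Min (pmf \<mu> ` cube n))) + ln (1 / \<epsilon>)))"
proof -
  have n0: "0 < n" using n by simp
  note b0 = weakly_interacting_nonneg[OF wi]
  define m where "m = Min (pmf \<mu> ` cube n)"
  define N where "N = real n powr (1 + 4 * \<beta>)"
  define c where "c = 1 / (2 * N)"
  have N: "1 \<le> N" unfolding N_def using n b0 by (intro ge_one_powr_ge_zero) auto
  have c: "0 < c" "c \<le> 1" using N by (auto simp: c_def divide_le_eq)
  have mle: "m \<le> pmf \<mu> x" if "x \<in> cube n" for x unfolding m_def using that by (intro Min_le) auto
  have mpos: "0 < m" unfolding m_def using mu_pos cube_nonempty by (subst Min_gr_iff) auto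
  (* Two spins already give four configurations. Hence ln (1 / m) exceeds 1 by a fixed amount and
     the double logarithm is bounded below, which absorbs the additive constants. *)
  have m4: "m \<le> 1/4"
  proof -
    obtain x where s: "x \<in> cube n" using cube_nonempty by blast
    have n1: "0 < n" "1 < n" using n by auto
    let ?A = "{x, flip 0 x, flip 1 x, flip 0 (flip 1 x)}"
    have ne: "u \<noteq> v" if "u i \<noteq> v i" for u v :: "nat \<Rightarrow> real" and i using that by blast
    have s0: "x 0 \<noteq> - x 0" "x 1 \<noteq> - x 1" using cube_values[OF s n1(1)] cube_values[OF s n1(2)] by auto
    have "card ?A = 4"
      using s0 ne[of x 0 "flip 0 x"] ne[of x 1 "flip 1 x"] ne[of x 0 "flip 0 (flip 1 x)"]
        ne[of "flip 0 x" 0 "flip 1 x"] ne[of "flip 0 x" 1 "flip 0 (flip 1 x)"] ne[of "flip 1 x" 0 "flip 0 (flip 1 x)"]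
      by (simp add: flip_def)
    then have "4 * m = (\<Sum>u\<in>?A. m)" by simp
    also have "\<dots> \<le> (\<Sum>u\<in>?A. pmf \<mu> u)" using s n1 by (intro sum_mono mle) auto
    also have "\<dots> \<le> (\<Sum>u\<in>cube n. pmf \<mu> u)" using s n1 by (intro sum_mono2) auto
    finally show ?thesis using pmf_cube_sum[OF mu_support] by simp
  qed
  define L where "L = ln (1 / m)"
  define l where "l = ln L"
  have L: "5/4 \<le> L"
  proof -
    have "exp (5/4 :: real) \<le> 4"
    proof -
      have "exp (1/4 :: real) \<le> 1 + 1/4 + (1/4)\<^sup>2" by (intro exp_bound) auto
      then have "exp (1/4 :: real) ^ 5 \<le> (1 + 1/4 + (1/4)\<^sup>2) ^ 5" by (intro power_mono) auto
      also have "\<dots> \<le> (4::real)" by (simp add: power2_eq_square power_divide)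
      finally show ?thesis by (simp flip: exp_of_nat_mult)
    qed
    also have "4 \<le> 1 / m" using m4 mpos by (simp add: field_simps)
    finally show ?thesis unfolding L_def using mpos by (subst ln_ge_iff) auto
  qed
  have l: "1/5 \<le> l"
  proof -
    have "ln (1 / L) \<le> 1 / L - 1" using L by (intro ln_le_minus_one) auto
    also have "1 / L \<le> 4/5" using L by (simp add: field_simps)
    finally show ?thesis using L by (simp add: l_def ln_div)
  qed
  define le where "le = ln (1 / \<epsilon>)"
  have le0: "0 < le" using e by (simp add: le_def)
  (* After this time the relative entropy is at most (epsilon / 2)^2. *)
  define X where "X = 2 * N * (l + 2 * le + 2)"
  define t where "t = nat \<lceil>X\<rceil>"
  have X0: "0 \<le> X" unfolding X_def using N l le0 by (intro mult_nonneg_nonneg) auto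
  have t: "X \<le> real t" "real t \<le> X + 1" unfolding t_def using X0 by linarith+
  have mix: "tv_dist (glauber_steps n \<mu> t x) \<mu> \<le> \<epsilon>" if s: "x \<in> cube n" for x
  proof -
    define K where "K = rel_ent n {..<n} (pmf (glauber_steps n \<mu> t x)) (pmf \<mu>)"
    have "K \<le> (1 - c) ^ t * ln (1 / pmf \<mu> x)"
      unfolding K_def c_def N_def by (rule rel_ent_glauber_steps[OF n s wi b])
    also have "\<dots> \<le> (1 - c) ^ t * L"
      using mle[OF s] mpos c unfolding L_def by (intro mult_left_mono) (auto simp: field_simps)
    also have "\<dots> \<le> exp (- c) ^ t * L"
      using c exp_ge_add_one_self[of "- c"] L by (intro mult_right_mono power_mono) auto
    also have "exp (- c) ^ t = exp (- (c * real t))" by (simp flip: exp_of_nat_mult add: mult.commute)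
    also have "exp (- (c * real t)) * L \<le> exp (- (c * X)) * L"
      using t c L by (intro mult_right_mono) auto
    also have "c * X = l + 2 * le + 2" using N by (simp add: c_def X_def)
    also have "exp (- (l + 2 * le + 2)) * L = exp (- 2) * \<epsilon>\<^sup>2"
    proof -
      have "exp (- (l + 2 * le + 2)) = exp (- l) * exp (- le) * exp (- le) * exp (- 2)"
        by (simp flip: exp_add)
      moreover have "exp (- l) = 1 / L" using L by (simp add: l_def exp_minus field_simps)
      moreover have "exp (- le) = \<epsilon>" using e by (simp add: le_def ln_div)
      ultimately show ?thesis using L by (simp add: power2_eq_square)
    qed
    also have "\<dots> \<le> 1/4 * \<epsilon>\<^sup>2"
    proof (rule mult_right_mono)
      have "2 \<le> exp (1::real)" using exp_ge_add_one_self[of 1] by simp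
      then have "2 * 2 \<le> exp 1 * exp (1::real)" by (intro mult_mono) auto
      then have "4 \<le> exp (2::real)" by (simp flip: exp_add)
      then show "exp (- 2) \<le> 1/(4::real)" by (simp add: exp_minus field_simps)
    qed simp
    finally have "K \<le> (\<epsilon> / 2)\<^sup>2" by (simp add: power2_eq_square)
    then have "sqrt K \<le> \<epsilon> / 2" using e real_sqrt_le_mono[of K "(\<epsilon> / 2)\<^sup>2"] by simp
    then show ?thesis using tv_dist_le[OF set_glauber_steps[OF n0 s, of t]]
      unfolding K_def by linarith
  qed
  have "mixing_time n \<mu> \<epsilon> \<le> enat t"
    unfolding mixing_time_def
  proof (subst Max_le_iff)
    show "\<forall>a\<in>(\<lambda>x. INF t\<in>{t. tv_dist (glauber_steps n \<mu> t x) \<mu> \<le> \<epsilon>}. enat t) ` cube n. a \<le> enat t"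
      using mix by (auto intro!: INF_lower)
  qed (use cube_nonempty in auto)
  then have "ereal_of_enat (mixing_time n \<mu> \<epsilon>) \<le> ereal_of_enat (enat t)" by (simp only: ereal_of_enat_le_iff)
  also have "\<dots> = ereal (real t)" by simp
  also have "real t \<le> 27 * N * (l + le)"
  proof -
    have "real t \<le> 2 * N * (l + 2 * le + 2) + N * 1" using t N by (simp add: X_def)
    also have "\<dots> = N * (2 * l + 4 * le + 5)" by (simp add: algebra_simps)
    also have "\<dots> \<le> N * (27 * l + 20 * le)" using N l le0 by (intro mult_left_mono) auto
    also have "\<dots> \<le> 27 * N * (l + le)" using N le0 by (simp add: algebra_simps)
    finally show ?thesis .
  qed
  finally show ?thesis by (simp add: N_def l_def L_def m_def le_def)
qed

end

theorem theorem2: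
  "\<exists>A>0. \<exists>B>0. \<exists>K\<^sub>3>0. \<exists>c\<^sub>4>0. \<exists>K\<^sub>5>0.
    \<forall>(n::nat) (\<mu> :: (nat \<Rightarrow> real) pmf) (H :: (nat \<Rightarrow> real) \<Rightarrow> real) (\<beta>::real).
      n \<ge> 1 \<longrightarrow>
      set_pmf \<mu> = cube n \<longrightarrow>
      (\<exists>Z>0. \<forall>\<sigma>\<in>cube n. pmf \<mu> \<sigma> = exp (H \<sigma>) / Z) \<longrightarrow>
      \<beta> = max_hessian_norm n H \<longrightarrow>
      \<beta> \<le> A \<longrightarrow>
        spectral_gap n \<mu> \<ge> 1 / ((1 + B * \<beta>) * real n) \<and>
        fractionally_log_concave ({-1, 1} \<times> {..<n}) n (homogenization n \<mu>) (1 / (1 + B * \<beta>)) \<and>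
        (n \<ge> 2 \<longrightarrow>
          approx_tensorization n \<mu> (K\<^sub>3 * real n powr (B * \<beta>)) \<and>
          modified_log_sobolev n \<mu> (c\<^sub>4 / real n powr (1 + B * \<beta>)) \<and>
          (\<forall>\<epsilon>::real. 0 < \<epsilon> \<longrightarrow> \<epsilon> < 1 \<longrightarrow>
            ereal_of_enat (mixing_time n \<mu> \<epsilon>)
              \<le> ereal (K\<^sub>5 * real n powr (1 + B * \<beta>) *
                  (ln (ln (1 / Min (pmf \<mu> ` cube n))) + ln (1 / \<epsilon>)))))"
proof (rule exI[of _ "1/3000"], rule conjI, simp, rule exI[of _ 4], rule conjI, simp,
    rule exI[of _ 2], rule conjI, simp, rule exI[of _ "1/2"], rule conjI, simp,
    rule exI[of _ 27], rule conjI, simp, intro allI impI)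
  fix n :: nat and \<mu> :: "(nat \<Rightarrow> real) pmf" and H :: "(nat \<Rightarrow> real) \<Rightarrow> real" and \<beta> :: real
  assume n: "n \<ge> 1" and supp: "set_pmf \<mu> = cube n"
    and H: "\<exists>Z>0. \<forall>\<sigma>\<in>cube n. pmf \<mu> \<sigma> = exp (H \<sigma>) / Z"
    and \<beta>: "\<beta> = max_hessian_norm n H" and b: "\<beta> \<le> 1/3000"
  obtain Z where "Z > 0" "\<And>\<sigma>. \<sigma> \<in> cube n \<Longrightarrow> pmf \<mu> \<sigma> = exp (H \<sigma>) / Z" using H by blast
  then have wi: "weakly_interacting n (pmf \<mu>) \<beta>" unfolding \<beta> by (intro gibbs_weakly_interacting)
  have n0: "0 < n" using n by simp
  have "approx_tensorization n \<mu> (2 * real n powr (4 * \<beta>))" if "2 \<le> n"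
    unfolding approx_tensorization_def
    by (intro allI impI entropy_tensorization[OF supp that wi b]) (simp add: less_imp_le)
  then show "1 / ((1 + 4 * \<beta>) * real n) \<le> spectral_gap n \<mu> \<and>
    fractionally_log_concave ({-1, 1} \<times> {..<n}) n (homogenization n \<mu>) (1 / (1 + 4 * \<beta>)) \<and>
    (n \<ge> 2 \<longrightarrow>
      approx_tensorization n \<mu> (2 * real n powr (4 * \<beta>)) \<and>
      modified_log_sobolev n \<mu> (1 / 2 / real n powr (1 + 4 * \<beta>)) \<and>
      (\<forall>\<epsilon>::real. 0 < \<epsilon> \<longrightarrow> \<epsilon> < 1 \<longrightarrow>
        ereal_of_enat (mixing_time n \<mu> \<epsilon>)
          \<le> ereal (27 * real n powr (1 + 4 * \<beta>) *
              (ln (ln (1 / Min (pmf \<mu> ` cube n))) + ln (1 / \<epsilon>)))))"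
    using spectral_gap_bound[OF supp n0 wi b] homogenization_fractionally_log_concave[OF supp n0 wi b]
      modified_log_sobolev_bound[OF supp _ wi b] mixing_time_bound[OF supp _ wi b] by blast
qed

end
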